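(* Let $d \ge 2$. (Hyperbolic paraboloids.) Suppose that the restriction conjecture $\mathrm{RC}(d,\vec u)$ holds for every $\vec u \in \{-1,1\}^{d-1}$. Then the decoupling estimate $\mathrm{Dec}(2d-1,\vec v)$ holds for every $\vec v\in\{-1,1\}^{2d-2}$; that is, for every $\vec v\in\{-1,1\}^{2d-2}$, every $2\le p\le 2+\frac{4}{2d-2}$ and every $\epsilon>0$ there is a constant $C_{p,\epsilon}$ (independent of $R$ and $F$) such that, with $\vec\alpha=(\frac12,\ldots,\frac12)\in[0,1]^{2d-2}$, for all $R\ge 1$, $$\|F\|_{L^p(\mathbb{R}^{2d-1})}\le C_{p,\epsilon}\,R^{\frac12(2d-2)\left(\frac12-\frac1p\right)+\epsilon}\Big(\sum_{\theta\in\Gamma_{\vec\alpha}(R^{-1})}\|\mathcal{P}_\theta F\|_{L^p(\mathbb{R}^{2d-1})}^p\Big)^{1/p}$$ for all functions $F:\mathbb{R}^{2d-1}\to\mathbb{C}$ whose Fourier transforms are supported on $\mathcal{N}_{\mathcal{H}^{2d-2}_{\vec v}}(R^{-1})$. (Paraboloids.) Likewise, if $\mathrm{RC}(d,\vec u)$ holds for $\vec u=(1,\ldots,1)\in\{-1,1\}^{d-1}$, then $\mathrm{Dec}(2d-1,\vec v)$ holds for $\vec v=(1,\ldots,1)\in\{-1,1\}^{2d-2}$.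
   Context: Write $e(t)=e^{2\pi i t}$. For an integer $m\ge2$ and $\vec v=(v_1,\ldots,v_{m-1})\in\{-1,1\}^{m-1}$, the (hyperbolic) paraboloid in $\mathbb{R}^m$ is $$\mathcal{H}^{m-1}_{\vec v}=\Big\{\big(\xi_1,\ldots,\xi_{m-1},\textstyle\sum_{i=1}^{m-1}v_i\xi_i^2\big):(\xi_1,\ldots,\xi_{m-1})\in[0,1]^{m-1}\Big\}.$$ Its extension operator is, for $f:[0,1]^{m-1}\to\mathbb{C}$ and $x\in\mathbb{R}^m$, $$\widehat{f\,d\sigma}(x)=\int_{[0,1]^{m-1}}f(\xi)\,e\Big(x\cdot\big(\xi_1,\ldots,\xi_{m-1},\textstyle\sum_{i=1}^{m-1}v_i\xi_i^2\big)\Big)\,d\xi.$$ Restriction conjecture $\mathrm{RC}(m,\vec v)$: for every $p>2+\frac{2}{m-1}$ there is a constant $C_p$ such that $\|\widehat{f\,d\sigma}\|_{L^p(\mathbb{R}^m)}\le C_p\|f\|_{L^p([0,1]^{m-1})}$ for all $f\in L^p([0,1]^{m-1})$. For $R\ge1$, $\mathcal{N}_{\mathcal{H}^{m-1}_{\vec v}}(R^{-1})$ is the $R^{-1}$-neighborhood of $\mathcal{H}^{m-1}_{\vec v}$ in $\mathbb{R}^m$. For $\vec\alpha=(\alpha_1,\ldots,\alpha_{m-1})\in[0,1]^{m-1}$, $\Gamma_{\vec\alpha}(R^{-1})$ is the collection of sets $(B\times\mathbb{R})\cap\mathcal{N}_{\mathcal{H}^{m-1}_{\vec v}}(R^{-1})$,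 where $B=(c_1,\ldots,c_{m-1})+[0,R^{-\alpha_1}]\times\cdots\times[0,R^{-\alpha_{m-1}}]$ with $c_i\in R^{-\alpha_i}\mathbb{Z}$ for each $i$. For $B\subset\mathbb{R}^m$ and $F:\mathbb{R}^m\to\mathbb{C}$, $\mathcal{P}_BF(x)=\int_B\widehat F(\xi)e(\xi\cdot x)\,d\xi$. Functions $F$ are understood to be such that this makes sense: $\widehat F$ is an integrable function and $F(x)=\int\widehat F(\xi)e(\xi\cdot x)\,d\xi$. Decoupling estimate $\mathrm{Dec}(m,\vec v)$: with $\vec\alpha=(\frac12,\ldots,\frac12)\in[0,1]^{m-1}$, for every $2\le p\le2+\frac{4}{m-1}$ and $\epsilon>0$ there is a constant $C_{p,\epsilon}$ such that for all $R\ge1$ and all functions $F:\mathbb{R}^m\to\mathbb{C}$ with Fourier transform supported on $\mathcal{N}_{\mathcal{H}^{m-1}_{\vec v}}(R^{-1})$, $$\|F\|_{L^p(\mathbb{R}^m)}\le C_{p,\epsilon}R^{\frac12(m-1)(\frac12-\frac1p)+\epsilon}\Big(\sum_{\theta\in\Gamma_{\vec\alpha}(R^{-1})}\|\mathcal{P}_\theta F\|_{L^p(\mathbb{R}^m)}^p\Big)^{1/p}.$$ *)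

theory Defs
  imports "HOL-Analysis.Analysis"
begin

text \<open>
  The ambient space $\mathbb{R}^m$ is rendered as \<^typ>\<open>(real^'n) \<times> real\<close> with \<open>CARD('n) = m - 1\<close>;
  the library's inner product, distance and Lebesgue measure on this product are the Euclidean
  ones. The dimension of a paraboloid is determined by the type of its sign vector.
\<close>

definition e :: "real \<Rightarrow> complex" where
  "e t = exp (2 * of_real pi * \<i> * of_real t)"

text \<open>Powers of extended nonnegative reals, for exponents \<open>a > 0\<close>.\<close>

definition ennreal_powr :: "ennreal \<Rightarrow> real \<Rightarrow> ennreal" where
  "ennreal_powr x a = (if x = \<infinity> then \<infinity> else ennreal (enn2real x powr a))"

text \<open>The norm takes the value \<open>\<infinity>\<close> outside $L^p$.\<close>

definition Lp_norm :: "'a measure \<Rightarrow> real \<Rightarrow> ('a \<Rightarrow> complex) \<Rightarrow> ennreal" where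
  "Lp_norm M p f = ennreal_powr (\<integral>\<^sup>+x. ennreal (norm (f x) powr p) \<partial>M) (1 / p)"

definition Lp_space :: "'a measure \<Rightarrow> real \<Rightarrow> ('a \<Rightarrow> complex) set" where
  "Lp_space M p = {f \<in> borel_measurable M. Lp_norm M p f < \<infinity>}"

definition sign_vectors :: "(real^'n) set" where
  "sign_vectors = {v. \<forall>i. v $ i \<in> {-1, 1}}"

definition unit_cube :: "(real^'n) set" where
  "unit_cube = {\<xi>. \<forall>i. \<xi> $ i \<in> {0..1}}"

definition paraboloid_point :: "real^'n \<Rightarrow> real^'n \<Rightarrow> (real^'n) \<times> real" where
  "paraboloid_point v \<xi> = (\<xi>, \<Sum>i\<in>UNIV. v $ i * (\<xi> $ i)\<^sup>2)"

definition paraboloid :: "real^'n \<Rightarrow> ((real^'n) \<times> real) set" where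
  "paraboloid v = paraboloid_point v ` unit_cube"

definition extension_op :: "real^'n \<Rightarrow> (real^'n \<Rightarrow> complex) \<Rightarrow> (real^'n) \<times> real \<Rightarrow> complex" where
  "extension_op v f x = (LINT \<xi>|lebesgue_on unit_cube. f \<xi> * e (x \<bullet> paraboloid_point v \<xi>))"

definition restriction_conjecture :: "real^'n \<Rightarrow> bool" where
  "restriction_conjecture (v :: real^'n) \<longleftrightarrow>
     (\<forall>p::real. p > 2 + 2 / real CARD('n) \<longrightarrow>
       (\<exists>C::real. \<forall>f \<in> Lp_space (lebesgue_on unit_cube) p.
          Lp_norm lebesgue p (extension_op v f)
            \<le> ennreal C * Lp_norm (lebesgue_on unit_cube) p f))"

definition nbhd :: "'a::metric_space set \<Rightarrow> real \<Rightarrow> 'a set" where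
  "nbhd S r = {x. \<exists>y\<in>S. dist x y < r}"

text \<open>
  The collection $\Gamma_{\vec\alpha}(R^{-1})$. All but finitely many of the boxes \<open>B\<close> give the
  empty set, so the collection is finite (see \<open>finite_caps\<close> below).
\<close>

definition caps :: "real^'n \<Rightarrow> real^'n \<Rightarrow> real \<Rightarrow> ((real^'n) \<times> real) set set" where
  "caps v \<alpha> R =
     {(B \<times> UNIV) \<inter> nbhd (paraboloid v) (1 / R) |B c.
        (\<forall>i. \<exists>k::int. c $ i = R powr (- (\<alpha> $ i)) * of_int k) \<and>
        B = {\<xi>. \<forall>i. \<xi> $ i \<in> {c $ i .. c $ i + R powr (- (\<alpha> $ i))}}}"

text \<open>
  \<open>G\<close> is the Fourier transform of \<open>F\<close>, where \<open>F\<close> is recovered from the integrable function \<open>G\<close> by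
  Fourier inversion. This determines \<open>G\<close> up to a null set.
\<close>

definition has_fourier_transform ::
  "('a::euclidean_space \<Rightarrow> complex) \<Rightarrow> ('a \<Rightarrow> complex) \<Rightarrow> bool" where
  "has_fourier_transform F G \<longleftrightarrow>
     integrable lebesgue G \<and> (\<forall>x. F x = (LINT \<xi>|lebesgue. G \<xi> * e (\<xi> \<bullet> x)))"

text \<open>The projection $\mathcal{P}_B F$, as a function of the Fourier transform \<open>G\<close> of \<open>F\<close>.\<close>

definition freq_proj :: "'a::euclidean_space set \<Rightarrow> ('a \<Rightarrow> complex) \<Rightarrow> 'a \<Rightarrow> complex" where
  "freq_proj B G x = (LINT \<xi>|lebesgue_on B. G \<xi> * e (\<xi> \<bullet> x))"

definition decoupling :: "real^'n \<Rightarrow> bool" where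
  "decoupling (v :: real^'n) \<longleftrightarrow>
     (\<forall>p \<epsilon>. 2 \<le> p \<and> p \<le> 2 + 4 / real CARD('n) \<and> \<epsilon> > 0 \<longrightarrow>
       (\<exists>C::real. \<forall>R\<ge>1. \<forall>F G.
          has_fourier_transform F G \<and>
          (AE \<xi> in lebesgue. \<xi> \<notin> nbhd (paraboloid v) (1 / R) \<longrightarrow> G \<xi> = 0) \<longrightarrow>
          Lp_norm lebesgue p F
            \<le> ennreal (C * R powr (1 / 2 * real CARD('n) * (1 / 2 - 1 / p) + \<epsilon>)) *
               ennreal_powr
                 (\<Sum>\<theta>\<in>caps v (\<chi> i. 1 / 2) R. ennreal_powr (Lp_norm lebesgue p (freq_proj \<theta> G)) p)
                 (1 / p)))"

lemma bounded_nbhd_paraboloid: "bounded (nbhd (paraboloid v) r)"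
proof -
  have "(unit_cube :: (real^'n) set) = cbox 0 1"
    by (auto simp: unit_cube_def mem_box_cart)
  moreover have "continuous_on S (paraboloid_point v)" for S
    unfolding paraboloid_point_def by (intro continuous_intros)
  ultimately have "compact (paraboloid v)"
    unfolding paraboloid_def by (metis compact_cbox compact_continuous_image)
  then obtain b where b: "\<And>y. y \<in> paraboloid v \<Longrightarrow> norm y \<le> b"
    using compact_imp_bounded bounded_iff by metis
  have "norm x \<le> b + r" if "x \<in> nbhd (paraboloid v) r" for x
  proof -
    from that obtain y where "y \<in> paraboloid v" "dist x y < r"
      by (auto simp: nbhd_def)
    with b[of y] show ?thesis
      using norm_triangle_sub[of x y] by (simp add: dist_norm)
  qed
  then show ?thesis
    unfolding bounded_iff by blast
qed

lemma finite_caps: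
  assumes "R > 0"
  shows "finite (caps v \<alpha> R)"
proof -
  let ?N = "nbhd (paraboloid v) (1 / R)"
  let ?s = "\<lambda>i. R powr (- (\<alpha> $ i))"
  let ?c = "\<lambda>k. \<chi> i. ?s i * of_int (k i)"
  let ?B = "\<lambda>c. {\<xi>. \<forall>i. \<xi> $ i \<in> {c $ i .. c $ i + ?s i}}"
  obtain b where b: "\<And>x. x \<in> ?N \<Longrightarrow> norm x \<le> b"
    using bounded_nbhd_paraboloid bounded_iff by metis
  define K where "K i = {\<lfloor>- b / ?s i\<rfloor> - 2 .. \<lceil>b / ?s i\<rceil> + 2}" for i
  have s: "?s i > 0" for i
    using assms by simp
  have "caps v \<alpha> R \<subseteq> insert {} ((\<lambda>k. (?B (?c k) \<times> UNIV) \<inter> ?N) ` (PiE UNIV K))"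
  proof
    fix \<theta> assume "\<theta> \<in> caps v \<alpha> R"
    then obtain c where c: "\<forall>i. \<exists>k::int. c $ i = ?s i * of_int k"
      and \<theta>: "\<theta> = (?B c \<times> UNIV) \<inter> ?N"
      unfolding caps_def by blast
    from c obtain k :: "_ \<Rightarrow> int" where k: "\<And>i. c $ i = ?s i * of_int (k i)"
      by metis
    have ck: "c = ?c k"
      by (simp add: vec_eq_iff k)
    show "\<theta> \<in> insert {} ((\<lambda>k. (?B (?c k) \<times> UNIV) \<inter> ?N) ` (PiE UNIV K))"
    proof (cases "\<theta> = {}")
      case False
      then obtain \<xi> t where x: "\<xi> \<in> ?B c" "(\<xi>, t) \<in> ?N"
        using \<theta> by auto
      have "k i \<in> K i" for i
      proof -
        have "\<bar>\<xi> $ i\<bar> \<le> b"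
          using b[OF x(2)] component_le_norm_cart[of \<xi> i] norm_fst_le[of \<xi> t] by linarith
        moreover have "c $ i \<le> \<xi> $ i" "\<xi> $ i \<le> c $ i + ?s i"
          using x(1) by auto
        ultimately have "?s i * of_int (k i) \<le> b" "- b \<le> ?s i * (of_int (k i) + 1)"
          using k[of i] by (auto simp: algebra_simps)
        then have "of_int (k i) \<le> b / ?s i" "- b / ?s i \<le> of_int (k i) + 1"
          using s[of i] by (simp_all only: pos_le_divide_eq pos_divide_le_eq mult.commute)
        then show ?thesis
          unfolding K_def atLeastAtMost_iff by linarith
      qed
      then have "k \<in> PiE UNIV K"
        by auto
      then show ?thesis
        using \<theta> ck by blast
    qed simp
  qed
  moreover have "finite (PiE UNIV K)"
    by (intro finite_PiE) (auto simp: K_def)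
  ultimately show ?thesis
    by (meson finite.insertI finite_imageI finite_subset)
qed

end

theory Submission
  imports Defs "HOL-Probability.Sinc_Integral"
begin

text \<open>
  Write \<open>n = d - 1\<close>, so that the paraboloid to be decoupled has \<open>2 * n\<close> coordinates, and split them into two
  halves \<open>x\<close> and \<open>y\<close> of \<open>n\<close> coordinates each. The range \<open>p \<le> 2 + 4 / (2 * n)\<close> of the decoupling estimate is the
  range \<open>p \<le> 2 + 2 / n\<close> in which the restriction conjecture for \<open>n\<close> coordinates gives square root cancellation
  at every scale, up to an arbitrarily small power.

  The idea is to use the conjecture in one half at a time. Take a box of side \<open>a\<close> in the directions of \<open>x\<close>
  and side \<open>a / K\<close> in those of \<open>y\<close>. Relative to its corner, \<open>y\<close> contributes to the quadratic form an affine
  function, which a shear removes, and an error of size \<open>a^2 / K^2\<close>. After rescaling \<open>x\<close> by \<open>a\<close> and the last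
  variable by \<open>a^2\<close>, the surface over the box is therefore within \<open>O(1 / K^2)\<close> of the paraboloid in \<open>x\<close> alone, and
  the conjecture decouples the box into \<open>K^(2 * n)\<close> boxes of side \<open>a / K^2\<close> in \<open>x\<close>, at the cost of the square
  root cancellation exponent (\<open>decoupling_step\<close>). Now the sides in \<open>y\<close> are the longer ones by the factor \<open>K\<close>, and
  the next step uses the conjecture in \<open>y\<close>. Alternating about \<open>log R / (2 * log K)\<close> times leads from
  boxes of side about 1 to boxes of side \<open>R powr (- 1/2)\<close> (\<open>iterated_steps\<close>, \<open>fine_scale_decoupling\<close>). The
  exponents add up to the claimed one, and the constants of the steps are harmless when \<open>K\<close> is a large
  constant depending on \<open>\<epsilon>\<close>. Finally the boxes are compared with the caps (\<open>sum_closed_boxes_le_sum_caps\<close>).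
  If all signs of the paraboloid are 1, then so are those of its two halves, which is why the same argument
  proves the statement about elliptic paraboloids.

  It remains to see why restriction implies decoupling into cubes of side \<open>1 / K^2\<close>. On a box of dual size
  \<open>K^2\<close> each piece is locally constant up to the wave of its cube, so that around every point the function looks
  like the extension of a step function on the unit cube. A reproducing formula with an integrable kernel
  (\<open>inv_FT_separation\<close>) makes this exact and reduces the step to a bound for such extensions on a box
  (\<open>decoupling_from_local_estimate\<close>). That bound (\<open>local_estimate\<close>) interpolates between a local form of
  Plancherel's theorem (\<open>local_bessel\<close>) and the conjecture at an exponent slightly above the critical one; the
  interpolation is done on the level sets of the step function, whose number is bounded once a small power of
  the scale may be lost.
\<close>

section \<open>Fejer and de la Vallee Poussin kernels on the line\<close>

lemma e_eq_cis: "e t = cis (2 * pi * t)"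
  by (simp add: e_def cis_conv_exp mult_ac)

lemma norm_e [simp]: "norm (e t) = 1"
  by (simp add: e_eq_cis)

lemma e_add: "e (s + t) = e s * e t"
  by (simp add: e_eq_cis cis_mult algebra_simps)

lemma continuous_on_e [continuous_intros]:
  "continuous_on S f \<Longrightarrow> continuous_on S (\<lambda>x. e (f x))"
  unfolding e_def by (intro continuous_intros)

lemma borel_measurable_e [measurable]: "e \<in> borel_measurable borel"
  by (intro borel_measurable_continuous_onI continuous_intros)

lemma integrable_cauchy_weight: "integrable lborel (\<lambda>w::real. 1 / (1 + w\<^sup>2))"
  using integrable_inverse_1_plus_square
  by (simp add: set_integrable_def inverse_eq_divide)

lemma one_minus_cos_le: "1 - cos x \<le> x\<^sup>2 / 2" for x :: real
proof -
  have "1 - cos x = 2 * (sin (x/2))\<^sup>2"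
    using cos_double_sin[of "x/2"] by simp
  also have "(sin (x/2))\<^sup>2 \<le> (x/2)\<^sup>2"
    using abs_sin_x_le_abs_x[of "x/2"] by (subst (asm) abs_le_square_iff)
  finally show ?thesis by (simp add: power2_eq_square)
qed

lemma fejer_kernel_le:
  fixes c w :: real
  assumes "\<bar>c\<bar> \<le> 2"
  shows "(1 - cos (c * w)) / w\<^sup>2 \<le> 4 / (1 + w\<^sup>2)"
proof (cases "w\<^sup>2 \<le> 1")
  case True
  have "(1 - cos (c * w)) \<le> 2 * w\<^sup>2"
  proof -
    have "c\<^sup>2 \<le> 2\<^sup>2" using assms by (metis abs_le_square_iff abs_numeral)
    then have "(c * w)\<^sup>2 \<le> 4 * w\<^sup>2" by (simp add: power_mult_distrib mult_right_mono)
    then show ?thesis using one_minus_cos_le[of "c * w"] by linarith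
  qed
  then have "(1 - cos (c * w)) / w\<^sup>2 \<le> 2" by (cases "w = 0") (auto simp: pos_divide_le_eq)
  also have "2 \<le> 4 / (1 + w\<^sup>2)" using True by (simp add: pos_le_divide_eq add_pos_nonneg)
  finally show ?thesis .
next
  case False
  have "(1 - cos (c * w)) / w\<^sup>2 \<le> 2 / w\<^sup>2"
    using cos_ge_minus_one[of "c*w"] by (intro divide_right_mono) auto
  also have "\<dots> \<le> 4 / (1 + w\<^sup>2)"
  proof -
    have "w \<noteq> 0" "0 < 1 + w\<^sup>2" using False by (auto simp: add_pos_nonneg)
    then show ?thesis using False by (simp add: divide_simps)
  qed
  finally show ?thesis .
qed

text \<open>
  Scaling of this integral (\<open>fejer_scale\<close>) and its positivity carry all of the Fourier analysis on the
  line; it is the unit in which the Fourier transforms of the kernels are measured.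
\<close>

definition fejer_const :: real where
  "fejer_const = (\<integral>w. (1 - cos w) / w\<^sup>2 \<partial>lborel)"

lemma integrable_fejer1: "integrable lborel (\<lambda>w::real. (1 - cos w) / w\<^sup>2)"
proof (rule Bochner_Integration.integrable_bound)
  show "integrable lborel (\<lambda>w::real. 4 * (1 / (1 + w\<^sup>2)))"
    by (intro integrable_mult_right integrable_cauchy_weight)
  show "AE w in lborel. norm ((1 - cos w) / w\<^sup>2) \<le> norm (4 * (1 / (1 + w\<^sup>2)) :: real)"
  proof (intro always_eventually allI)
    fix w :: real
    have "0 \<le> (1 - cos w) / w\<^sup>2" "0 \<le> 4 * (1 / (1 + w\<^sup>2))"
      by (auto simp: add_nonneg_nonneg)
    then show "norm ((1 - cos w) / w\<^sup>2) \<le> norm (4 * (1 / (1 + w\<^sup>2)) :: real)"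
      using fejer_kernel_le[of 1 w] by simp
  qed
qed measurable

lemma fejer_scale:
  fixes c :: real
  shows "integrable lborel (\<lambda>w. (1 - cos (c * w)) / w\<^sup>2)"
    and "(\<integral>w. (1 - cos (c * w)) / w\<^sup>2 \<partial>lborel) = fejer_const * \<bar>c\<bar>"
proof -
  have eq: "(1 - cos (c * w)) / w\<^sup>2 = c\<^sup>2 * ((1 - cos (0 + c * w)) / (0 + c * w)\<^sup>2)" if "c \<noteq> 0" for w
    using that by (simp add: power_mult_distrib)
  show "integrable lborel (\<lambda>w. (1 - cos (c * w)) / w\<^sup>2)"
  proof (cases "c = 0")
    case False
    have "integrable lborel (\<lambda>w. (1 - cos (0 + c * w)) / (0 + c * w)\<^sup>2)"
      by (rule lborel_integrable_real_affine[OF integrable_fejer1 False])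
    then show ?thesis unfolding eq[OF False] by (rule integrable_mult_right)
  qed simp
  show "(\<integral>w. (1 - cos (c * w)) / w\<^sup>2 \<partial>lborel) = fejer_const * \<bar>c\<bar>"
  proof (cases "c = 0")
    case False
    have "fejer_const = \<bar>c\<bar> * (\<integral>w. (1 - cos (0 + c * w)) / (0 + c * w)\<^sup>2 \<partial>lborel)"
      unfolding fejer_const_def using lborel_integral_real_affine[OF False, of "\<lambda>w. (1 - cos w) / w\<^sup>2" 0]
      by simp
    moreover have "(\<integral>w. (1 - cos (c * w)) / w\<^sup>2 \<partial>lborel)
        = c\<^sup>2 * (\<integral>w. (1 - cos (0 + c * w)) / (0 + c * w)\<^sup>2 \<partial>lborel)"
      unfolding eq[OF False] by (rule integral_mult_right_zero)
    moreover have "c\<^sup>2 = \<bar>c\<bar> * \<bar>c\<bar>"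
      by (simp add: power2_eq_square)
    ultimately show ?thesis
      by (metis mult.assoc mult.commute)
  qed simp
qed

lemma fejer_const_pos: "fejer_const > 0"
proof -
  have c1: "cos (1::real) < 1" using cos_monotone_0_pi[of 0 1] pi_gt3 by simp
  have "0 < (1 - cos (1::real)) / 4 * (\<integral>w. indicator {1..2::real} w \<partial>lborel)"
    using c1 by (intro mult_pos_pos divide_pos_pos) auto
  also have "\<dots> = (\<integral>w. (1 - cos 1) / 4 * indicator {1..2::real} w \<partial>lborel)"
    by (rule integral_mult_right_zero[symmetric])
  also have "\<dots> \<le> fejer_const"
    unfolding fejer_const_def
  proof (rule integral_mono)
    show "integrable lborel (\<lambda>w. (1 - cos (1::real)) / 4 * indicator {1..2::real} w)"
      by (intro integrable_mult_right) simp
    show "(1 - cos (1::real)) / 4 * indicator {1..2} w \<le> (1 - cos w) / w\<^sup>2" for w :: real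
    proof (cases "w \<in> {1..2}")
      case True
      then have "cos w \<le> cos 1" using pi_gt3 by (intro cos_monotone_0_pi_le) auto
      moreover have "w\<^sup>2 \<le> 2\<^sup>2" using True by (intro power_mono) auto
      ultimately have "(1 - cos 1) / 4 \<le> (1 - cos w) / w\<^sup>2"
        using True c1 by (intro frac_le) auto
      then show ?thesis using True by simp
    qed simp
  qed (rule integrable_fejer1)
  finally show ?thesis .
qed

text \<open>
  The Fourier transform of the Fejer kernel is a tent. The product formula for cosines writes the
  integrand as a combination of three dilated Fejer kernels, each integrated by scaling.
\<close>

lemma fejer_cos:
  fixes u :: real
  shows "integrable lborel (\<lambda>y. (1 - cos y) / y\<^sup>2 * cos (u * y))"
    and "(\<integral>y. (1 - cos y) / y\<^sup>2 * cos (u * y) \<partial>lborel) = fejer_const * max 0 (1 - \<bar>u\<bar>)"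
proof -
  have eq: "(1 - cos y) / y\<^sup>2 * cos (u * y) =
      1/2 * ((1 - cos ((1 + u) * y)) / y\<^sup>2) + 1/2 * ((1 - cos ((1 - u) * y)) / y\<^sup>2)
       - (1 - cos (u * y)) / y\<^sup>2" for y
  proof -
    have "(1 - cos y) * cos (u * y) =
      1/2 * (1 - cos ((1 + u) * y)) + 1/2 * (1 - cos ((1 - u) * y)) - (1 - cos (u * y))"
      by (simp add: cos_diff cos_add ring_distribs)
    then show ?thesis
      by (simp only: times_divide_eq_left times_divide_eq_right add_divide_distrib[symmetric] diff_divide_distrib[symmetric])
  qed
  show "integrable lborel (\<lambda>y. (1 - cos y) / y\<^sup>2 * cos (u * y))"
    unfolding eq by (intro Bochner_Integration.integrable_add Bochner_Integration.integrable_diff integrable_mult_right fejer_scale)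
  show "(\<integral>y. (1 - cos y) / y\<^sup>2 * cos (u * y) \<partial>lborel) = fejer_const * max 0 (1 - \<bar>u\<bar>)"
    unfolding eq
    by (simp only: integral_mult_right_zero Bochner_Integration.integral_diff Bochner_Integration.integral_add fejer_scale
        Bochner_Integration.integrable_add Bochner_Integration.integrable_diff integrable_mult_right)
       (simp add: abs_if max_def field_simps)
qed

lemma integral_odd_zero:
  fixes f :: "real \<Rightarrow> 'b :: {banach, second_countable_topology}"
  assumes "\<And>x. f (- x) = - f x"
  shows "(\<integral>x. f x \<partial>lborel) = 0"
proof -
  have "(\<integral>x. f x \<partial>lborel) = (\<integral>x. f (0 + (-1) * x) \<partial>lborel)"
    using lborel_integral_real_affine[of "-1" f 0] by simp
  also have "\<dots> = - (\<integral>x. f x \<partial>lborel)"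
    using assms by simp
  finally show ?thesis by (metis eq_neg_iff_add_eq_0 scaleR_2 scaleR_eq_0_iff zero_neq_numeral)
qed

text \<open>
  A difference of two Fejer kernels at scales 1 and 2. Its Fourier transform is a difference of two
  tents, a trapezoid equal to 1 on \<open>[-1, 1]\<close> (in the normalization \<open>cis (u * w)\<close>), while the kernel itself
  is integrable with the tail \<open>1 / w^2\<close>.
\<close>

definition vallee_poussin :: "real \<Rightarrow> real" where
  "vallee_poussin w = (cos w - cos (2 * w)) / (fejer_const * w\<^sup>2)"

lemma borel_measurable_vallee_poussin [measurable]: "vallee_poussin \<in> borel_measurable borel"
  unfolding vallee_poussin_def by measurable

lemma vallee_poussin_bound: "\<bar>vallee_poussin w\<bar> \<le> 8 / fejer_const * (1 / (1 + w\<^sup>2))"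
proof -
  have "\<bar>cos w - cos (2 * w)\<bar> \<le> (1 - cos w) + (1 - cos (2 * w))"
    using cos_le_one[of w] cos_le_one[of "2 * w"] by linarith
  then have "\<bar>cos w - cos (2 * w)\<bar> / w\<^sup>2 \<le> (1 - cos (1 * w)) / w\<^sup>2 + (1 - cos (2 * w)) / w\<^sup>2"
    by (metis add_divide_distrib divide_right_mono mult_1 zero_le_power2)
  also have "\<dots> \<le> 8 / (1 + w\<^sup>2)"
    using fejer_kernel_le[of 1 w] fejer_kernel_le[of 2 w] by simp
  finally have "\<bar>cos w - cos (2 * w)\<bar> / w\<^sup>2 / fejer_const \<le> 8 / (1 + w\<^sup>2) / fejer_const"
    using fejer_const_pos by (intro divide_right_mono) auto
  then show ?thesis
    using fejer_const_pos by (simp add: vallee_poussin_def abs_mult field_simps)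
qed

lemma integrable_vallee_poussin: "integrable lborel vallee_poussin"
proof (rule Bochner_Integration.integrable_bound)
  show "integrable lborel (\<lambda>w::real. 8 / fejer_const * (1 / (1 + w\<^sup>2)))"
    by (intro integrable_mult_right integrable_cauchy_weight)
  show "AE w in lborel. norm (vallee_poussin w) \<le> norm (8 / fejer_const * (1 / (1 + w\<^sup>2)))"
    using vallee_poussin_bound fejer_const_pos by (intro always_eventually allI) (auto simp: add_nonneg_nonneg abs_mult)
qed measurable

lemma integrable_vallee_poussin_cis: "integrable lborel (\<lambda>w. of_real (vallee_poussin w) * cis (u * w))"
proof (rule Bochner_Integration.integrable_bound[OF integrable_vallee_poussin])
  show "(\<lambda>w. of_real (vallee_poussin w) * cis (u * w)) \<in> borel_measurable lborel"
    unfolding cis_conv_exp by measurable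
qed (simp add: norm_mult)

lemma vallee_poussin_cos:
  assumes "\<bar>u\<bar> \<le> 1"
  shows "(\<integral>w. vallee_poussin w * cos (u * w) \<partial>lborel) = 1"
proof -
  have eq: "vallee_poussin w * cos (u * w) = 1 / (2 * fejer_const) *
     ((1 - cos ((2 + u) * w)) / w\<^sup>2 + (1 - cos ((2 - u) * w)) / w\<^sup>2
      - (1 - cos ((1 + u) * w)) / w\<^sup>2 - (1 - cos ((1 - u) * w)) / w\<^sup>2)" for w
  proof -
    have "(cos w - cos (2 * w)) * cos (u * w) = 1/2 * ((1 - cos ((2 + u) * w)) + (1 - cos ((2 - u) * w))
      - (1 - cos ((1 + u) * w)) - (1 - cos ((1 - u) * w)))"
      by (simp add: cos_diff cos_add ring_distribs)
    then have "vallee_poussin w * cos (u * w) = (1/2 * ((1 - cos ((2 + u) * w)) + (1 - cos ((2 - u) * w))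
      - (1 - cos ((1 + u) * w)) - (1 - cos ((1 - u) * w)))) / (fejer_const * w\<^sup>2)"
      by (simp only: vallee_poussin_def times_divide_eq_left)
    also have "\<dots> = 1 / (2 * fejer_const) * (((1 - cos ((2 + u) * w)) + (1 - cos ((2 - u) * w))
      - (1 - cos ((1 + u) * w)) - (1 - cos ((1 - u) * w))) / w\<^sup>2)"
      by simp
    finally show ?thesis
      by (simp only: add_divide_distrib diff_divide_distrib)
  qed
  have "(\<integral>w. vallee_poussin w * cos (u * w) \<partial>lborel) = 1 / (2 * fejer_const) *
     (fejer_const * \<bar>2 + u\<bar> + fejer_const * \<bar>2 - u\<bar> - fejer_const * \<bar>1 + u\<bar> - fejer_const * \<bar>1 - u\<bar>)"
    unfolding eq
    by (simp only: integral_mult_right_zero Bochner_Integration.integral_diff Bochner_Integration.integral_add fejer_scale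
        Bochner_Integration.integrable_add Bochner_Integration.integrable_diff)
  also have "\<dots> = 1"
  proof -
    have "\<bar>2 + u\<bar> = 2 + u" "\<bar>2 - u\<bar> = 2 - u" "\<bar>1 + u\<bar> = 1 + u" "\<bar>1 - u\<bar> = 1 - u"
      using assms by auto
    then show ?thesis using fejer_const_pos by (simp add: field_simps)
  qed
  finally show ?thesis .
qed

lemma vallee_poussin_cis:
  assumes "\<bar>u\<bar> \<le> 1"
  shows "(\<integral>w. of_real (vallee_poussin w) * cis (u * w) \<partial>lborel) = 1"
proof (rule complex_eqI)
  show "Re (\<integral>w. of_real (vallee_poussin w) * cis (u * w) \<partial>lborel) = Re 1"
    using vallee_poussin_cos[OF assms] by (simp add: integrable_vallee_poussin_cis flip: integral_Re)
  have "(\<integral>w. vallee_poussin w * sin (u * w) \<partial>lborel) = 0"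
    by (rule integral_odd_zero) (simp add: vallee_poussin_def)
  then show "Im (\<integral>w. of_real (vallee_poussin w) * cis (u * w) \<partial>lborel) = Im 1"
    by (simp add: integrable_vallee_poussin_cis flip: integral_Im)
qed

text \<open>
  The kernel separates the variables of a character: as a function of \<open>u\<close>, the wave at the point \<open>s\<close> is
  an average of the waves at other points \<open>w\<close>, with weights free of the frequency \<open>u\<close> as long as it
  lies in \<open>[-1, 1]\<close>.
\<close>

lemma vallee_poussin_reproducing:
  assumes "\<bar>u\<bar> \<le> 1"
  shows "integrable lborel (\<lambda>w. of_real (vallee_poussin (s - w)) * cis (u * w))"
    and "(\<integral>w. of_real (vallee_poussin (s - w)) * cis (u * w) \<partial>lborel) = cis (u * s)"
proof -
  have eq: "of_real (vallee_poussin (s - w)) * cis (u * w)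
      = cis (u * s) * (of_real (vallee_poussin (s + (-1) * w)) * cis ((-u) * (s + (-1) * w)))" for w
    by (simp add: cis_mult algebra_simps)
  have i: "integrable lborel (\<lambda>w. of_real (vallee_poussin (s + (-1) * w)) * cis ((-u) * (s + (-1) * w)))"
    by (rule lborel_integrable_real_affine[OF integrable_vallee_poussin_cis]) simp
  show "integrable lborel (\<lambda>w. of_real (vallee_poussin (s - w)) * cis (u * w))"
    unfolding eq by (rule integrable_mult_right) (rule i)
  have "(\<integral>w. of_real (vallee_poussin (s + (-1) * w)) * cis ((-u) * (s + (-1) * w)) \<partial>lborel)
     = (\<integral>w. of_real (vallee_poussin w) * cis ((-u) * w) \<partial>lborel)"
    using lborel_integral_real_affine[of "-1" "\<lambda>w. of_real (vallee_poussin w) * cis ((-u) * w)" s] by simp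
  then show "(\<integral>w. of_real (vallee_poussin (s - w)) * cis (u * w) \<partial>lborel) = cis (u * s)"
    unfolding eq using vallee_poussin_cis[of "-u"] assms by simp
qed

text \<open>
  Translations by at most 1 change the decay only by the factor 4, so that one integrable majorant
  serves all of them.
\<close>

lemma vallee_poussin_shift_bound:
  assumes "\<bar>s\<bar> \<le> 1"
  shows "\<bar>vallee_poussin (s - w)\<bar> \<le> 32 / fejer_const * (1 / (1 + w\<^sup>2))"
proof -
  have "1 + w\<^sup>2 \<le> 4 * (1 + (s - w)\<^sup>2)"
  proof -
    have "s\<^sup>2 \<le> 1" using assms by (simp add: abs_square_le_1)
    moreover have "w\<^sup>2 \<le> 2 * (s - w)\<^sup>2 + 2 * s\<^sup>2"
      using zero_le_power2[of "w - 2 * s"] by (simp add: power2_eq_square algebra_simps)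
    ultimately have "1 + w\<^sup>2 \<le> 3 + 2 * (s - w)\<^sup>2" by simp
    also have "\<dots> \<le> 4 * (1 + (s - w)\<^sup>2)" by simp
    finally show ?thesis .
  qed
  then have "1 / (1 + (s - w)\<^sup>2) \<le> 4 * (1 / (1 + w\<^sup>2))"
  proof -
    assume *: "1 + w\<^sup>2 \<le> 4 * (1 + (s - w)\<^sup>2)"
    have "0 < 1 + w\<^sup>2" "0 < 1 + (s - w)\<^sup>2" by (simp_all add: add_pos_nonneg)
    with * show ?thesis by (simp add: divide_simps)
  qed
  then have "8 / fejer_const * (1 / (1 + (s - w)\<^sup>2)) \<le> 8 / fejer_const * (4 * (1 / (1 + w\<^sup>2)))"
    using fejer_const_pos by (intro mult_left_mono) auto
  then show ?thesis using vallee_poussin_bound[of "s - w"] by simp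
qed

section \<open>Product kernels on Euclidean space\<close>

lemma lborel_integral_prod:
  fixes f :: "'b::euclidean_space \<Rightarrow> real \<Rightarrow> 'c::{real_normed_field, banach, second_countable_topology}"
  assumes "\<And>b. b \<in> Basis \<Longrightarrow> integrable lborel (f b)"
  shows "integrable lborel (\<lambda>x::'b. \<Prod>b\<in>Basis. f b (x \<bullet> b))"
    and "(\<integral>x. (\<Prod>b\<in>Basis. f b (x \<bullet> b)) \<partial>(lborel :: 'b measure)) = (\<Prod>b\<in>Basis. (\<integral>t. f b t \<partial>lborel))"
proof -
  interpret product_sigma_finite "\<lambda>_::'b. lborel :: real measure" ..
  have m: "(\<lambda>x::'b. \<Prod>b\<in>Basis. f b (x \<bullet> b)) \<in> borel_measurable borel"
  proof (intro borel_measurable_prod)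
    fix b :: 'b assume "b \<in> Basis"
    then have [measurable]: "f b \<in> borel_measurable borel" using assms by auto
    show "(\<lambda>x. f b (x \<bullet> b)) \<in> borel_measurable borel" by measurable
  qed
  have g: "(\<lambda>f. \<Sum>b\<in>Basis. f b *\<^sub>R b) \<in> (\<Pi>\<^sub>M b\<in>(Basis::'b set). lborel :: real measure) \<rightarrow>\<^sub>M (borel :: 'b measure)"
    by measurable
  have eq: "(\<Prod>b\<in>Basis. f b ((\<Sum>c\<in>Basis. x c *\<^sub>R c) \<bullet> b)) = (\<Prod>b\<in>Basis. f b (x b))" for x
    by (intro prod.cong) auto
  show "integrable lborel (\<lambda>x::'b. \<Prod>b\<in>Basis. f b (x \<bullet> b))"
    unfolding lborel_eq[where 'a = 'b] integrable_distr_eq[OF g m] eq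
    using assms by (intro product_integrable_prod) auto
  show "(\<integral>x. (\<Prod>b\<in>Basis. f b (x \<bullet> b)) \<partial>(lborel :: 'b measure)) = (\<Prod>b\<in>Basis. (\<integral>t. f b t \<partial>lborel))"
    unfolding lborel_eq[where 'a = 'b] integral_distr[OF g m] eq
    using assms by (intro product_integral_prod) auto
qed

definition unit_box :: "'b::euclidean_space set" where
  "unit_box = {z. \<forall>b\<in>Basis. \<bar>z \<bullet> b\<bar> \<le> 1}"

lemma unit_box_eq_cbox: "unit_box = cbox (- One) One"
  by (auto simp: unit_box_def mem_box abs_le_iff)

lemma measurable_unit_box [measurable]: "unit_box \<in> sets borel"
  by (simp add: unit_box_eq_cbox)

lemma emeasure_unit_box: "emeasure lborel (unit_box :: 'b::euclidean_space set) = ennreal (2 ^ DIM('b))"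
proof -
  have "emeasure lborel (cbox (- One) One :: 'b set) = ennreal (\<Prod>b\<in>(Basis :: 'b set). 2)"
    by (subst emeasure_lborel_cbox) (auto simp: inner_diff_left inner_add_left intro!: prod.cong arg_cong[where f = ennreal])
  then show ?thesis by (simp add: unit_box_eq_cbox)
qed

definition prod_kernel :: "'b::euclidean_space \<Rightarrow> real" where
  "prod_kernel z = (\<Prod>b\<in>Basis. vallee_poussin (z \<bullet> b))"

definition kernel_majorant :: "'b::euclidean_space \<Rightarrow> real" where
  "kernel_majorant w = (\<Prod>b\<in>Basis. 32 / fejer_const * (1 / (1 + (w \<bullet> b)\<^sup>2)))"

text \<open>
  The \<open>L^1\<close> norm of the majorant. It depends on the dimension alone, hence the type argument.
\<close>

definition kernel_mass :: "'b::euclidean_space itself \<Rightarrow> real" where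
  "kernel_mass _ = (\<integral>w. kernel_majorant w \<partial>(lborel :: 'b measure))"

lemma borel_measurable_prod_kernel [measurable]: "prod_kernel \<in> borel_measurable borel"
  unfolding prod_kernel_def by measurable

lemma borel_measurable_kernel_majorant [measurable]: "kernel_majorant \<in> borel_measurable borel"
  unfolding kernel_majorant_def by measurable

lemma kernel_majorant_pos: "kernel_majorant w > 0"
  unfolding kernel_majorant_def
  using fejer_const_pos by (intro prod_pos) (simp add: add_pos_nonneg)

lemma integrable_kernel_majorant: "integrable lborel kernel_majorant"
  unfolding kernel_majorant_def
  by (intro lborel_integral_prod integrable_mult_right integrable_cauchy_weight)

lemma kernel_mass_pos: "kernel_mass TYPE('b::euclidean_space) > 0"
proof -
  have "kernel_mass TYPE('b) \<ge> 0"
    unfolding kernel_mass_def by (intro integral_nonneg_AE) (simp add: less_imp_le[OF kernel_majorant_pos])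
  moreover have "kernel_mass TYPE('b) \<noteq> 0"
  proof
    assume "kernel_mass TYPE('b) = 0"
    then have "AE w in (lborel :: 'b measure). kernel_majorant w = 0"
      unfolding kernel_mass_def
      by (subst (asm) integral_nonneg_eq_0_iff_AE[OF integrable_kernel_majorant])
         (auto simp: less_imp_le[OF kernel_majorant_pos])
    then have "AE w in (lborel :: 'b measure). False"
      by eventually_elim (metis kernel_majorant_pos less_irrefl)
    then obtain N where "{w \<in> space (lborel :: 'b measure). \<not> False} \<subseteq> N" "emeasure lborel N = 0" "N \<in> sets lborel"
      by (rule AE_E)
    moreover from this have "N = UNIV" by auto
    ultimately show False by simp
  qed
  ultimately show ?thesis by simp
qed

lemma prod_kernel_le_majorant:
  assumes "s \<in> unit_box"
  shows "\<bar>prod_kernel (s - w)\<bar> \<le> kernel_majorant w"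
  unfolding prod_kernel_def kernel_majorant_def abs_prod
proof (intro prod_mono conjI)
  fix b :: 'a assume "b \<in> Basis"
  then show "\<bar>vallee_poussin ((s - w) \<bullet> b)\<bar> \<le> 32 / fejer_const * (1 / (1 + (w \<bullet> b)\<^sup>2))"
    using vallee_poussin_shift_bound[of "s \<bullet> b" "w \<bullet> b"] assms by (simp add: unit_box_def inner_diff_left)
qed simp

lemma cis_inner: "cis (u \<bullet> w) = (\<Prod>b\<in>Basis. cis ((u \<bullet> b) * (w \<bullet> b)))"
  unfolding euclidean_inner[of u w] cis_conv_exp
  by (simp add: exp_sum sum_distrib_left sum_distrib_right)

lemma prod_kernel_reproducing:
  fixes u s :: "'b::euclidean_space"
  assumes "\<And>b. b \<in> Basis \<Longrightarrow> \<bar>u \<bullet> b\<bar> \<le> 1"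
  shows "(\<integral>w. of_real (prod_kernel (s - w)) * cis (u \<bullet> w) \<partial>lborel) = cis (u \<bullet> s)"
proof -
  have eq: "of_real (prod_kernel (s - w)) * cis (u \<bullet> w) =
     (\<Prod>b\<in>Basis. of_real (vallee_poussin (s \<bullet> b - w \<bullet> b)) * cis (u \<bullet> b * (w \<bullet> b)))" for w
    by (simp add: prod_kernel_def cis_inner prod.distrib inner_diff_left)
  have "(\<integral>w. of_real (prod_kernel (s - w)) * cis (u \<bullet> w) \<partial>lborel)
    = (\<Prod>b\<in>Basis. cis ((u \<bullet> b) * (s \<bullet> b)))"
    unfolding eq using assms
    by (subst lborel_integral_prod) (auto intro!: vallee_poussin_reproducing prod.cong)
  then show ?thesis by (simp add: cis_inner)
qed

section \<open>Convexity inequalities\<close>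

text \<open>
  The graph of \<open>h powr p\<close> lies above its tangent at \<open>A\<close>. Taking for \<open>A\<close> the mean of \<open>h\<close> and averaging
  gives the two forms of Jensen's inequality below.
\<close>

lemma young_tangent:
  fixes A h p :: real
  assumes "A \<ge> 0" "h \<ge> 0" "p > 1"
  shows "p * A powr (p - 1) * h \<le> h powr p + (p - 1) * A powr p"
proof -
  have "h * A powr (p - 1) \<le> h powr p / p + (A powr (p - 1)) powr (p / (p - 1)) / (p / (p - 1))"
    using assms by (intro Youngs_inequality) (auto simp: field_simps)
  also have "(A powr (p - 1)) powr (p / (p - 1)) = A powr p"
    using assms by (simp add: powr_powr)
  finally have "p * (h * A powr (p - 1)) \<le> p * (h powr p / p + A powr p / (p / (p - 1)))"
    using assms by (intro mult_left_mono) auto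
  also have "\<dots> = h powr p + (p - 1) * A powr p"
    using assms by (simp add: field_simps)
  finally show ?thesis by (simp add: mult_ac)
qed

lemma jensen_weighted:
  fixes W h :: "'a \<Rightarrow> real"
  assumes W: "\<And>x. W x \<ge> 0" "integrable M W" "(\<integral>x. W x \<partial>M) = m" "m > 0"
    and h: "\<And>x. h x \<ge> 0" "h \<in> borel_measurable M" "integrable M (\<lambda>x. W x * h x)"
    and p: "p > 1"
  shows "ennreal ((\<integral>x. W x * h x \<partial>M) powr p)
      \<le> ennreal (m powr (p - 1)) * (\<integral>\<^sup>+x. ennreal (W x) * ennreal (h x powr p) \<partial>M)"
proof -
  note [measurable] = h(2) borel_measurable_integrable[OF W(2)]
  define S where "S = (\<integral>x. W x * h x \<partial>M)"
  define A where "A = S / m"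
  have S0: "S \<ge> 0" unfolding S_def using W h by (intro integral_nonneg_AE) auto
  then have A0: "A \<ge> 0" using W by (simp add: A_def)
  let ?Y = "\<integral>\<^sup>+x. ennreal (W x) * ennreal (h x powr p) \<partial>M"
  have "ennreal (p * A powr (p - 1) * S) = (\<integral>\<^sup>+x. ennreal (p * A powr (p - 1) * (W x * h x)) \<partial>M)"
    unfolding S_def using W h p A0
    by (subst nn_integral_eq_integral) auto
  also have "\<dots> \<le> (\<integral>\<^sup>+x. ennreal (W x) * ennreal (h x powr p) + ennreal ((p - 1) * A powr p * W x) \<partial>M)"
  proof (intro nn_integral_mono)
    fix x
    have "W x * (p * A powr (p - 1) * h x) \<le> W x * (h x powr p + (p - 1) * A powr p)"
      using W young_tangent[OF A0 h(1) p] by (intro mult_left_mono) auto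
    then have "ennreal (p * A powr (p - 1) * (W x * h x)) \<le> ennreal (W x * h x powr p + (p - 1) * A powr p * W x)"
      by (intro ennreal_leI) (simp add: algebra_simps)
    also have "\<dots> = ennreal (W x) * ennreal (h x powr p) + ennreal ((p - 1) * A powr p * W x)"
      using W p by (subst ennreal_plus) (auto simp: ennreal_mult)
    finally show "ennreal (p * A powr (p - 1) * (W x * h x)) \<le> ennreal (W x) * ennreal (h x powr p) + ennreal ((p - 1) * A powr p * W x)" .
  qed
  also have "\<dots> = ?Y + (\<integral>\<^sup>+x. ennreal ((p - 1) * A powr p * W x) \<partial>M)"
    by (intro nn_integral_add) auto
  also have "(\<integral>\<^sup>+x. ennreal ((p - 1) * A powr p * W x) \<partial>M) = ennreal ((p - 1) * A powr p * m)"
    using W p by (subst nn_integral_eq_integral) auto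
  finally have le: "ennreal (p * A powr (p - 1) * S) \<le> ?Y + ennreal ((p - 1) * A powr p * m)" .
  have "A powr (p - 1) * S = A powr p * m"
  proof (cases "A = 0")
    case False
    then have "A powr p = A powr (p - 1) * A"
      using A0 by (simp add: powr_diff)
    then show ?thesis using W by (simp add: A_def)
  qed simp
  then have "p * A powr (p - 1) * S = A powr p * m + (p - 1) * A powr p * m"
    by (simp add: algebra_simps)
  then have "ennreal (A powr p * m) + ennreal ((p - 1) * A powr p * m) \<le> ?Y + ennreal ((p - 1) * A powr p * m)"
    using le W p by (simp flip: ennreal_plus)
  then have Y: "ennreal (A powr p * m) \<le> ?Y"
    by (simp add: ennreal_add_left_cancel_le add.commute)
  have "S powr p = m powr (p - 1) * (A powr p * m)"
  proof -
    have "S powr p = (A * m) powr p" using W by (simp add: A_def)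
    also have "\<dots> = A powr p * (m powr (p - 1) * m powr 1)"
      using A0 W by (simp add: powr_mult powr_diff)
    finally show ?thesis using W by simp
  qed
  then have "ennreal (S powr p) = ennreal (m powr (p - 1)) * ennreal (A powr p * m)"
    using W by (simp add: ennreal_mult)
  also have "\<dots> \<le> ennreal (m powr (p - 1)) * ?Y"
    using Y by (intro mult_left_mono) auto
  finally show ?thesis by (simp add: S_def)
qed

lemma sum_powr_le:
  fixes x :: "'i \<Rightarrow> real"
  assumes "finite I" "\<And>i. i \<in> I \<Longrightarrow> x i \<ge> 0" "p > 1"
  shows "(\<Sum>i\<in>I. x i) powr p \<le> real (card I) powr (p - 1) * (\<Sum>i\<in>I. x i powr p)"
proof (cases "I = {}")
  case False
  define N where "N = real (card I)"
  have N: "N > 0" using False assms by (simp add: N_def card_gt_0_iff)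
  define S where "S = (\<Sum>i\<in>I. x i)"
  define A where "A = S / N"
  have A0: "A \<ge> 0" using assms N by (auto simp: A_def S_def intro!: divide_nonneg_nonneg sum_nonneg)
  have "(\<Sum>i\<in>I. p * A powr (p - 1) * x i) \<le> (\<Sum>i\<in>I. x i powr p + (p - 1) * A powr p)"
    using assms A0 by (intro sum_mono young_tangent) auto
  then have "p * A powr (p - 1) * S \<le> (\<Sum>i\<in>I. x i powr p) + (p - 1) * A powr p * N"
    by (simp add: S_def N_def sum.distrib sum_distrib_left sum_distrib_right mult_ac)
  moreover have eqS: "A powr (p - 1) * S = A powr p * N"
  proof (cases "A = 0")
    case False
    then have "A powr p = A powr (p - 1) * A"
      using A0 by (simp add: powr_diff)
    then show ?thesis using N by (simp add: A_def)
  qed simp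
  ultimately have "p * (A powr p * N) \<le> (\<Sum>i\<in>I. x i powr p) + (p - 1) * A powr p * N"
    by (metis mult.assoc)
  then have "A powr p * N \<le> (\<Sum>i\<in>I. x i powr p)"
    by (simp add: algebra_simps)
  then have "N powr (p - 1) * (A powr p * N) \<le> N powr (p - 1) * (\<Sum>i\<in>I. x i powr p)"
    by (intro mult_left_mono) auto
  moreover have "N powr (p - 1) * (A powr p * N) = S powr p"
  proof -
    have "S powr p = (A * N) powr p" using N by (simp add: A_def)
    also have "\<dots> = A powr p * (N powr (p - 1) * N powr 1)"
      using A0 N by (simp add: powr_mult powr_diff)
    finally show ?thesis using N by simp
  qed
  ultimately show ?thesis by (simp add: S_def N_def)
qed simp

text \<open>
  Log-convexity of \<open>L^p\<close> norms, in terms of bounds \<open>X\<close> and \<open>Y\<close> at the end points; it is weighted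
  AM-GM applied pointwise to the normalized quantities \<open>g powr r / X\<close> and \<open>g powr q / Y\<close>.
\<close>

lemma nn_integral_interpolation:
  fixes g :: "'a \<Rightarrow> real"
  assumes g [measurable]: "g \<in> borel_measurable M" and "\<And>x. g x \<ge> 0"
    and "(\<integral>\<^sup>+x. ennreal (g x powr r) \<partial>M) \<le> ennreal X"
    and "(\<integral>\<^sup>+x. ennreal (g x powr q) \<partial>M) \<le> ennreal Y"
    and XY: "X > 0" "Y > 0" and ab: "a \<ge> 0" "b \<ge> 0" "a + b = 1" and p: "p = r * a + q * b"
  shows "(\<integral>\<^sup>+x. ennreal (g x powr p) \<partial>M) \<le> ennreal (X powr a * Y powr b)"
proof -
  let ?C = "X powr a * Y powr b"
  have "(\<integral>\<^sup>+x. ennreal (g x powr p) \<partial>M) \<le> (\<integral>\<^sup>+x. ennreal (?C * a / X) * ennreal (g x powr r) + ennreal (?C * b / Y) * ennreal (g x powr q) \<partial>M)"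
  proof (rule nn_integral_mono)
    fix x
    have "g x powr p \<le> ?C * a / X * g x powr r + ?C * b / Y * g x powr q"
    proof (cases "g x = 0")
      case False
      then have gx: "g x > 0" using assms(2)[of x] by simp
      have "(g x powr r / X) powr a * (g x powr q / Y) powr b \<le> a * (g x powr r / X) + b * (g x powr q / Y)"
        using gx XY ab by (intro Youngs_inequality_0) auto
      then have "?C * ((g x powr r / X) powr a * (g x powr q / Y) powr b) \<le> ?C * (a * (g x powr r / X) + b * (g x powr q / Y))"
        by (intro mult_left_mono) auto
      moreover have "?C * ((g x powr r / X) powr a * (g x powr q / Y) powr b) = g x powr p"
        using XY gx by (simp add: powr_divide powr_powr p powr_add)
      ultimately show ?thesis by (simp add: algebra_simps)
    qed (use XY ab in auto)
    then show "ennreal (g x powr p) \<le> ennreal (?C * a / X) * ennreal (g x powr r) + ennreal (?C * b / Y) * ennreal (g x powr q)"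
      using XY ab by (simp flip: ennreal_mult ennreal_plus)
  qed
  also have "\<dots> = ennreal (?C * a / X) * (\<integral>\<^sup>+x. ennreal (g x powr r) \<partial>M) + ennreal (?C * b / Y) * (\<integral>\<^sup>+x. ennreal (g x powr q) \<partial>M)"
    by (subst nn_integral_add) (auto simp: nn_integral_cmult)
  also have "\<dots> \<le> ennreal (?C * a / X) * ennreal X + ennreal (?C * b / Y) * ennreal Y"
    using assms by (intro add_mono mult_left_mono) auto
  also have "\<dots> = ennreal (?C * (a + b))"
    using XY ab(1,2) by (simp add: distrib_left flip: ennreal_mult ennreal_plus)
  finally show ?thesis using ab by simp
qed

definition Lp_pow :: "real \<Rightarrow> ('a::euclidean_space \<Rightarrow> complex) \<Rightarrow> ennreal" where
  "Lp_pow p F = (\<integral>\<^sup>+x. ennreal (norm (F x) powr p) \<partial>lborel)"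

lemma Lp_pow_sum_le:
  assumes "finite I" "\<And>i. i \<in> I \<Longrightarrow> F i \<in> borel_measurable borel" "p > 1"
  shows "Lp_pow p (\<lambda>x. \<Sum>i\<in>I. F i x) \<le> ennreal (real (card I) powr (p - 1)) * (\<Sum>i\<in>I. Lp_pow p (F i))"
proof -
  have "Lp_pow p (\<lambda>x. \<Sum>i\<in>I. F i x) \<le> (\<integral>\<^sup>+x. ennreal (real (card I) powr (p - 1)) * (\<Sum>i\<in>I. ennreal (norm (F i x) powr p)) \<partial>lborel)"
    unfolding Lp_pow_def
  proof (rule nn_integral_mono)
    fix x
    have "norm (\<Sum>i\<in>I. F i x) powr p \<le> (\<Sum>i\<in>I. norm (F i x)) powr p"
      using assms by (intro powr_mono2 norm_sum) auto
    also have "\<dots> \<le> real (card I) powr (p - 1) * (\<Sum>i\<in>I. norm (F i x) powr p)"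
      using assms by (intro sum_powr_le) auto
    finally show "ennreal (norm (\<Sum>i\<in>I. F i x) powr p) \<le> ennreal (real (card I) powr (p - 1)) * (\<Sum>i\<in>I. ennreal (norm (F i x) powr p))"
      by (simp add: sum_nonneg flip: ennreal_mult)
  qed
  also have "\<dots> = ennreal (real (card I) powr (p - 1)) * (\<Sum>i\<in>I. Lp_pow p (F i))"
  proof -
    have [measurable]: "\<And>i. i \<in> I \<Longrightarrow> F i \<in> borel_measurable lborel" using assms by simp
    show ?thesis
      unfolding Lp_pow_def by (subst nn_integral_cmult; (subst nn_integral_sum)?) (auto intro!: borel_measurable_sum)
  qed
  finally show ?thesis .
qed

section \<open>From local estimates to decoupling inequalities\<close>

definition inv_FT :: "('a::euclidean_space \<Rightarrow> complex) \<Rightarrow> 'a \<Rightarrow> complex" where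
  "inv_FT G x = (\<integral>\<omega>. G \<omega> * e (\<omega> \<bullet> x) \<partial>lborel)"

lemma integrable_mult_bounded:
  fixes f h :: "'a \<Rightarrow> complex"
  assumes "integrable M f" "h \<in> borel_measurable M" "\<And>x. norm (h x) \<le> C"
  shows "integrable M (\<lambda>x. f x * h x)"
proof (rule Bochner_Integration.integrable_bound)
  show "integrable M (\<lambda>x. C * norm (f x))" using assms by (intro integrable_mult_right integrable_norm)
  have "0 \<le> C" using assms(3) norm_ge_zero order_trans by blast
  then have "norm (f x * h x) \<le> norm (C * norm (f x))" for x
    using mult_left_mono[OF assms(3)[of x] norm_ge_zero[of "f x"]] by (simp add: norm_mult mult_ac)
  then show "AE x in M. norm (f x * h x) \<le> norm (C * norm (f x))" by simp
  show "(\<lambda>x. f x * h x) \<in> borel_measurable M"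
    using assms(2) borel_measurable_integrable[OF assms(1)] by measurable
qed

lemma integrable_mult_e:
  assumes "integrable lborel G" "h \<in> borel_measurable lborel"
  shows "integrable lborel (\<lambda>\<omega>. G \<omega> * e (h \<omega>))"
  using assms by (intro integrable_mult_bounded[where C = 1]) auto

lemma borel_measurable_inv_FT [measurable]:
  assumes "integrable lborel G"
  shows "inv_FT G \<in> borel_measurable borel"
proof -
  have [measurable]: "G \<in> borel_measurable borel" using assms by auto
  show ?thesis unfolding inv_FT_def[abs_def] by measurable
qed

lemma norm_inv_FT_le: "norm (inv_FT G x) \<le> (\<integral>\<omega>. norm (G \<omega>) \<partial>lborel)"
  unfolding inv_FT_def by (rule order_trans[OF integral_norm_bound]) (simp add: norm_mult)

text \<open>
  Every interchange of integrals below has this shape: two integrable factors of one variable each, and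
  a bounded factor of both.
\<close>

lemma Fubini_bounded_kernel:
  fixes a :: "'a::euclidean_space \<Rightarrow> complex" and b :: "'b::euclidean_space \<Rightarrow> complex"
  assumes a: "integrable lborel a" and b: "integrable lborel b"
    and h [measurable]: "(\<lambda>(x, y). h x y) \<in> borel_measurable (borel \<Otimes>\<^sub>M borel)"
    and le: "\<And>x y. norm (h x y) \<le> C"
  shows "(\<integral>x. a x * (\<integral>y. b y * h x y \<partial>lborel) \<partial>lborel) = (\<integral>y. b y * (\<integral>x. a x * h x y \<partial>lborel) \<partial>lborel)"
proof -
  have [measurable]: "a \<in> borel_measurable borel" "b \<in> borel_measurable borel" using a b by auto
  let ?f = "\<lambda>(x, y). a x * (b y * h x y)"
  have C0: "0 \<le> C" using le norm_ge_zero order_trans by blast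
  have int: "integrable (lborel \<Otimes>\<^sub>M lborel) ?f"
  proof (rule lborel_pair.Fubini_integrable)
    have ib: "integrable lborel (\<lambda>y. b y * h x y)" for x
      using b le by (intro integrable_mult_bounded[where C = C]) (auto intro: measurable_compose[OF _ h[unfolded split_beta], of "\<lambda>y. (x, y)"])
    show "AE x in lborel. integrable lborel (\<lambda>y. ?f (x, y))"
      using ib by simp
    have *: "(\<integral>y. norm (b y * h x y) \<partial>lborel) \<le> C * (\<integral>y. norm (b y) \<partial>lborel)" for x
    proof -
      have "(\<integral>y. norm (b y * h x y) \<partial>lborel) \<le> (\<integral>y. C * norm (b y) \<partial>lborel)"
        using ib[of x] b mult_left_mono[OF le[of x] norm_ge_zero]
        by (intro integral_mono integrable_norm integrable_mult_right) (auto simp: norm_mult mult_ac)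
      then show ?thesis by simp
    qed
    show "integrable lborel (\<lambda>x. \<integral>y. norm (?f (x, y)) \<partial>lborel)"
    proof (rule Bochner_Integration.integrable_bound)
      show "integrable lborel (\<lambda>x. norm (a x) * (C * (\<integral>y. norm (b y) \<partial>lborel)))"
        using a by (intro integrable_mult_left integrable_norm)
      have "norm (\<integral>y. norm (?f (x, y)) \<partial>lborel) \<le> norm (norm (a x) * (C * (\<integral>y. norm (b y) \<partial>lborel)))" for x
        using C0 mult_left_mono[OF *[of x] norm_ge_zero[of "a x"]] by (simp add: norm_mult)
      then show "AE x in lborel. norm (\<integral>y. norm (?f (x, y)) \<partial>lborel) \<le> norm (norm (a x) * (C * (\<integral>y. norm (b y) \<partial>lborel)))"
        by simp
    qed measurable
  qed measurable
  have "(\<integral>x. a x * (\<integral>y. b y * h x y \<partial>lborel) \<partial>lborel) = (\<integral>x. (\<integral>y. ?f (x, y) \<partial>lborel) \<partial>lborel)"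
    by simp
  also have "\<dots> = (\<integral>y. (\<integral>x. ?f (x, y) \<partial>lborel) \<partial>lborel)"
    using lborel_pair.Fubini_integral[of "\<lambda>x y. ?f (x, y)"] int by (simp add: split_beta)
  also have "\<dots> = (\<integral>y. b y * (\<integral>x. a x * h x y \<partial>lborel) \<partial>lborel)"
    by (simp add: mult.left_commute[of "a _"])
  finally show ?thesis .
qed

lemma integrable_prod_kernel:
  assumes "z \<in> unit_box"
  shows "integrable lborel (\<lambda>w. complex_of_real (prod_kernel (z - w)))"
proof (rule Bochner_Integration.integrable_bound[OF integrable_kernel_majorant])
  show "AE w in lborel. norm (complex_of_real (prod_kernel (z - w))) \<le> norm (kernel_majorant w)"
    using prod_kernel_le_majorant[OF assms]
    by (auto intro!: AE_I2 order_trans[OF _ abs_ge_self])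
qed measurable

text \<open>
  The Fourier transform of the measure carried to the surface \<open>P\<close> from the parameter set \<open>T\<close>. For a
  small \<open>T\<close> it is the wave of one cap, with the whole cap in the place of a single frequency.
\<close>

definition cell_transform :: "('c::euclidean_space \<Rightarrow> 'b::euclidean_space) \<Rightarrow> 'c set \<Rightarrow> 'b \<Rightarrow> complex" where
  "cell_transform P T y = (\<integral>\<xi>. indicator T \<xi> * e (P \<xi> \<bullet> y) \<partial>lborel)"

lemma borel_measurable_cell_transform [measurable]:
  assumes [measurable]: "P \<in> borel_measurable borel" "T \<in> sets borel"
  shows "cell_transform P T \<in> borel_measurable borel"
  unfolding cell_transform_def[abs_def] by measurable

lemma integrable_indicator_complex:
  assumes "T \<in> sets lborel" "emeasure lborel T < \<infinity>"
  shows "integrable lborel (\<lambda>x. indicator T x :: complex)"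
proof -
  have "integrable lborel (\<lambda>x. complex_of_real (indicator T x))"
    using assms by (intro integrable_of_real integrable_real_indicator) auto
  then show ?thesis by (simp add: of_real_indicator)
qed

lemma integral_indicator_complex:
  "(\<integral>x. (indicator T x :: complex) \<partial>lborel) = measure lborel T"
proof -
  have "(\<integral>x. (indicator T x :: complex) \<partial>lborel) = (\<integral>x. complex_of_real (indicator T x) \<partial>lborel)"
    by (simp add: of_real_indicator)
  also have "\<dots> = complex_of_real (\<integral>x. indicator T x \<partial>lborel)"
    by (rule integral_complex_of_real)
  finally show ?thesis by simp
qed

lemma norm_cell_transform_le:
  assumes "T \<in> sets lborel" "emeasure lborel T < \<infinity>"
  shows "norm (cell_transform P T y) \<le> measure lborel T"
proof -
  have "norm (cell_transform P T y) \<le> (\<integral>\<xi>. norm (indicator T \<xi> * e (P \<xi> \<bullet> y)) \<partial>lborel)"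
    unfolding cell_transform_def by (rule integral_norm_bound)
  also have "\<dots> = (\<integral>\<xi>. indicator T \<xi> \<partial>lborel)"
    by (intro Bochner_Integration.integral_cong) (auto simp: norm_mult indicator_def)
  finally show ?thesis by simp
qed

text \<open>
  For a single \<open>\<xi>\<close> in \<open>T\<close>, the frequency of \<open>\<nu>\<close> seen through \<open>Z\<close> differs from \<open>P \<xi>\<close> by some \<open>u\<close> in the
  unit box (up to \<open>2 * pi\<close>), so the kernel reproduces the wave of frequency \<open>u\<close>; the remaining factors
  recombine to \<open>P \<xi> \<bullet> (z - w)\<close>. Averaging over \<open>\<xi>\<close> replaces this single character by the wave of \<open>T\<close>.
\<close>

lemma separation_formula:
  fixes Z :: "'b::euclidean_space \<Rightarrow> 'a::euclidean_space" and P :: "'c::euclidean_space \<Rightarrow> 'b"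
  assumes lin: "linear Z" and z: "z \<in> unit_box"
    and T [measurable]: "T \<in> sets borel" and mT: "emeasure lborel T < \<infinity>"
    and P [measurable]: "P \<in> borel_measurable borel"
    and dev: "\<And>\<xi> b. \<xi> \<in> T \<Longrightarrow> b \<in> Basis \<Longrightarrow> \<bar>2 * pi * (\<nu> \<bullet> Z b - P \<xi> \<bullet> b)\<bar> \<le> 1"
  shows "measure lborel T * e (\<nu> \<bullet> Z z) =
    (\<integral>w. of_real (prod_kernel (z - w)) * (e (\<nu> \<bullet> Z w) * cell_transform P T (z - w)) \<partial>lborel)"
proof -
  have [measurable]: "Z \<in> borel_measurable borel"
    using lin by (intro borel_measurable_continuous_onI linear_continuous_on linear_conv_bounded_linear[THEN iffD1])
  have adj: "adjoint Z \<nu> \<bullet> w = \<nu> \<bullet> Z w" for w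
    using adjoint_works[OF lin] by (simp add: inner_commute)
  have pt: "(\<integral>w. of_real (prod_kernel (z - w)) * (e (\<nu> \<bullet> Z w) * e (P \<xi> \<bullet> (z - w))) \<partial>lborel) = e (\<nu> \<bullet> Z z)"
    if "\<xi> \<in> T" for \<xi>
  proof -
    define u where "u = adjoint Z \<nu> - P \<xi>"
    have uw: "u \<bullet> w = \<nu> \<bullet> Z w - P \<xi> \<bullet> w" for w by (simp add: u_def inner_diff_left adj)
    have "(\<integral>w. of_real (prod_kernel (z - w)) * cis (((2 * pi) *\<^sub>R u) \<bullet> w) \<partial>lborel) = cis (((2 * pi) *\<^sub>R u) \<bullet> z)"
    proof (rule prod_kernel_reproducing)
      fix b :: 'b assume "b \<in> Basis"
      then show "\<bar>((2 * pi) *\<^sub>R u) \<bullet> b\<bar> \<le> 1" using dev[OF that] by (simp add: uw)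
    qed
    then have "(\<integral>w. of_real (prod_kernel (z - w)) * e (u \<bullet> w) \<partial>lborel) = e (u \<bullet> z)"
      by (simp add: e_eq_cis)
    then have "e (P \<xi> \<bullet> z) * (\<integral>w. of_real (prod_kernel (z - w)) * e (u \<bullet> w) \<partial>lborel) = e (\<nu> \<bullet> Z z)"
      by (simp add: uw flip: e_add)
    moreover have "of_real (prod_kernel (z - w)) * (e (\<nu> \<bullet> Z w) * e (P \<xi> \<bullet> (z - w))) =
        e (P \<xi> \<bullet> z) * (of_real (prod_kernel (z - w)) * e (u \<bullet> w))" for w
    proof -
      have "e (\<nu> \<bullet> Z w) * e (P \<xi> \<bullet> (z - w)) = e (P \<xi> \<bullet> z) * e (u \<bullet> w)"
        by (simp add: uw inner_diff_right algebra_simps flip: e_add)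
      then show ?thesis by (simp only: mult.left_commute)
    qed
    ultimately show ?thesis by (simp only: integral_mult_right_zero)
  qed
  have "measure lborel T * e (\<nu> \<bullet> Z z) = (\<integral>\<xi>. indicator T \<xi> * e (\<nu> \<bullet> Z z) \<partial>lborel)"
    by (simp add: integral_indicator_complex)
  also have "\<dots> = (\<integral>\<xi>. indicator T \<xi> * (\<integral>w. of_real (prod_kernel (z - w)) * (e (\<nu> \<bullet> Z w) * e (P \<xi> \<bullet> (z - w))) \<partial>lborel) \<partial>lborel)"
    by (intro Bochner_Integration.integral_cong) (auto simp: pt indicator_def)
  also have "\<dots> = (\<integral>w. of_real (prod_kernel (z - w)) * (\<integral>\<xi>. indicator T \<xi> * (e (\<nu> \<bullet> Z w) * e (P \<xi> \<bullet> (z - w))) \<partial>lborel) \<partial>lborel)"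
    using mT by (intro Fubini_bounded_kernel[where C = 1] integrable_prod_kernel[OF z] integrable_indicator_complex)
      (auto simp: norm_mult)
  also have "\<dots> = (\<integral>w. of_real (prod_kernel (z - w)) * (e (\<nu> \<bullet> Z w) * cell_transform P T (z - w)) \<partial>lborel)"
    by (simp add: cell_transform_def mult.left_commute[of "indicator _ _"])
  finally show ?thesis .
qed

text \<open>
  Integrating the separation formula against \<open>G\<close> makes precise that a function whose frequencies are
  localized near one cap is locally constant up to the wave of that cap: at the point \<open>x + Z z\<close> it is an
  average of its values at \<open>x + Z w\<close>, and the dependence on \<open>z\<close> is only through the kernel and the wave.
\<close>

lemma inv_FT_separation:
  fixes Z :: "'b::euclidean_space \<Rightarrow> 'a::euclidean_space" and P :: "'c::euclidean_space \<Rightarrow> 'b"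
  assumes lin: "linear Z" and z: "z \<in> unit_box"
    and T [measurable]: "T \<in> sets borel" and mT: "emeasure lborel T < \<infinity>"
    and P [measurable]: "P \<in> borel_measurable borel"
    and G: "integrable lborel G"
    and dev: "\<And>\<omega> \<xi> b. G \<omega> \<noteq> 0 \<Longrightarrow> \<xi> \<in> T \<Longrightarrow> b \<in> Basis \<Longrightarrow> \<bar>2 * pi * ((\<omega> - \<omega>0) \<bullet> Z b - P \<xi> \<bullet> b)\<bar> \<le> 1"
  shows "measure lborel T * inv_FT G (x + Z z) = e (\<omega>0 \<bullet> Z z) *
    (\<integral>w. of_real (prod_kernel (z - w)) * (e (- (\<omega>0 \<bullet> Z w)) * inv_FT G (x + Z w) * cell_transform P T (z - w)) \<partial>lborel)"
proof -
  have [measurable]: "Z \<in> borel_measurable borel"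
    using lin by (intro borel_measurable_continuous_onI linear_continuous_on linear_conv_bounded_linear[THEN iffD1])
  let ?g = "cell_transform P T"
  let ?m = "complex_of_real (measure lborel T)"
  let ?h = "\<lambda>\<omega> w. e (\<omega> \<bullet> x) * (e ((\<omega> - \<omega>0) \<bullet> Z w) * ?g (z - w))"
  have "G \<omega> * e (\<omega> \<bullet> (x + Z z)) * ?m = e (\<omega>0 \<bullet> Z z) * (G \<omega> *
      (\<integral>w. of_real (prod_kernel (z - w)) * ?h \<omega> w \<partial>lborel))" for \<omega>
  proof (cases "G \<omega> = 0")
    case False
    have "?m * e ((\<omega> - \<omega>0) \<bullet> Z z) = (\<integral>w. of_real (prod_kernel (z - w)) * (e ((\<omega> - \<omega>0) \<bullet> Z w) * ?g (z - w)) \<partial>lborel)"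
      using dev[OF False] by (intro separation_formula[OF lin z T mT P])
    moreover have "e (\<omega> \<bullet> (x + Z z)) = e (\<omega>0 \<bullet> Z z) * e (\<omega> \<bullet> x) * e ((\<omega> - \<omega>0) \<bullet> Z z)"
      by (simp add: inner_add_right inner_diff_left flip: e_add)
    moreover have "(\<integral>w. of_real (prod_kernel (z - w)) * ?h \<omega> w \<partial>lborel) =
        e (\<omega> \<bullet> x) * (\<integral>w. of_real (prod_kernel (z - w)) * (e ((\<omega> - \<omega>0) \<bullet> Z w) * ?g (z - w)) \<partial>lborel)"
      by (simp add: mult.left_commute[of _ "e (\<omega> \<bullet> x)"])
    ultimately show ?thesis by (simp add: mult_ac)
  qed simp
  then have eq: "G \<omega> * e (\<omega> \<bullet> (x + Z z)) * ?m = e (\<omega>0 \<bullet> Z z) * (G \<omega> *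
      (\<integral>w. of_real (prod_kernel (z - w)) * ?h \<omega> w \<partial>lborel))" for \<omega> .
  have "?m * inv_FT G (x + Z z) = (\<integral>\<omega>. G \<omega> * e (\<omega> \<bullet> (x + Z z)) * ?m \<partial>lborel)"
    unfolding inv_FT_def by simp
  also have "\<dots> = (\<integral>\<omega>. e (\<omega>0 \<bullet> Z z) * (G \<omega> *
      (\<integral>w. of_real (prod_kernel (z - w)) * ?h \<omega> w \<partial>lborel)) \<partial>lborel)"
    unfolding eq ..
  also have "\<dots> = e (\<omega>0 \<bullet> Z z) * (\<integral>\<omega>. G \<omega> * (\<integral>w. of_real (prod_kernel (z - w)) * ?h \<omega> w \<partial>lborel) \<partial>lborel)"
    by simp
  also have "(\<integral>\<omega>. G \<omega> * (\<integral>w. of_real (prod_kernel (z - w)) * ?h \<omega> w \<partial>lborel) \<partial>lborel)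
     = (\<integral>w. of_real (prod_kernel (z - w)) * (\<integral>\<omega>. G \<omega> * ?h \<omega> w \<partial>lborel) \<partial>lborel)"
    by (intro Fubini_bounded_kernel[where C = "measure lborel T"] integrable_prod_kernel[OF z] G)
      (auto simp: norm_mult intro!: norm_cell_transform_le mT)
  also have "(\<lambda>w. \<integral>\<omega>. G \<omega> * ?h \<omega> w \<partial>lborel) = (\<lambda>w. e (- (\<omega>0 \<bullet> Z w)) * inv_FT G (x + Z w) * ?g (z - w))"
  proof
    fix w
    have "G \<omega> * ?h \<omega> w = (e (- (\<omega>0 \<bullet> Z w)) * ?g (z - w)) * (G \<omega> * e (\<omega> \<bullet> (x + Z w)))" for \<omega>
    proof -
      have "e (\<omega> \<bullet> x) * e ((\<omega> - \<omega>0) \<bullet> Z w) = e (- (\<omega>0 \<bullet> Z w)) * e (\<omega> \<bullet> (x + Z w))"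
        by (simp add: inner_add_right inner_diff_left algebra_simps flip: e_add)
      then show ?thesis by (simp add: mult_ac)
    qed
    then have eq: "G \<omega> * ?h \<omega> w = (e (- (\<omega>0 \<bullet> Z w)) * ?g (z - w)) * (G \<omega> * e (\<omega> \<bullet> (x + Z w)))" for \<omega> .
    show "(\<integral>\<omega>. G \<omega> * ?h \<omega> w \<partial>lborel) = e (- (\<omega>0 \<bullet> Z w)) * inv_FT G (x + Z w) * ?g (z - w)"
      unfolding eq integral_mult_right_zero inv_FT_def by (simp only: mult_ac)
  qed
  finally show ?thesis .
qed

lemma nn_integral_lborel_translate:
  fixes f :: "'a::euclidean_space \<Rightarrow> ennreal"
  assumes [measurable]: "f \<in> borel_measurable borel"
  shows "(\<integral>\<^sup>+x. f (x + c) \<partial>lborel) = (\<integral>\<^sup>+x. f x \<partial>lborel)"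
proof -
  have "(\<integral>\<^sup>+x. f x \<partial>lborel) = (\<integral>\<^sup>+x. f x \<partial>distr lborel borel ((+) c))"
    by (simp add: lborel_distr_plus)
  also have "\<dots> = (\<integral>\<^sup>+x. f (x + c) \<partial>lborel)"
    by (subst nn_integral_distr) (auto simp: add.commute)
  finally show ?thesis by simp
qed

text \<open>
  A bound on the unit box for sums of cap waves with constant coefficients implies decoupling on the whole
  space. At a fixed \<open>x\<close>, the pieces at \<open>x + Z z\<close> are averages over \<open>w\<close> of such sums, with the coefficients
  \<open>inv_FT (G k) (x + Z w)\<close>; Jensen's inequality and the local bound control their integral over \<open>z\<close>. The
  integral over \<open>x\<close> then removes both \<open>z\<close> and \<open>w\<close> by translation invariance. The common factor
  \<open>\<omega>0\<close> is a modulation and allows affine terms in the phase.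
\<close>

theorem decoupling_from_local_estimate:
  fixes Z :: "'b::euclidean_space \<Rightarrow> 'a::euclidean_space" and P :: "'c::euclidean_space \<Rightarrow> 'b"
  assumes lin: "linear Z" and fin: "finite I" and p: "p > 1"
    and T: "\<And>k. k \<in> I \<Longrightarrow> T k \<in> sets borel" and mT: "\<And>k. k \<in> I \<Longrightarrow> emeasure lborel (T k) = ennreal \<mu>" and \<mu>: "\<mu> > 0"
    and P [measurable]: "P \<in> borel_measurable borel"
    and G: "\<And>k. k \<in> I \<Longrightarrow> integrable lborel (G k)"
    and dev: "\<And>k \<omega> \<xi> b. k \<in> I \<Longrightarrow> G k \<omega> \<noteq> 0 \<Longrightarrow> \<xi> \<in> T k \<Longrightarrow> b \<in> Basis \<Longrightarrow>
               \<bar>2 * pi * ((\<omega> - \<omega>0) \<bullet> Z b - P \<xi> \<bullet> b)\<bar> \<le> 1"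
    and loc: "\<And>a w. (\<integral>\<^sup>+z. indicator unit_box z * ennreal (norm (\<Sum>k\<in>I. a k * cell_transform P (T k) (z - w)) powr p) \<partial>lborel)
                \<le> D * (\<Sum>k\<in>I. ennreal (norm (a k :: complex) powr p))"
  shows "ennreal (\<mu> powr p * 2 ^ DIM('b)) * Lp_pow p (\<lambda>x. \<Sum>k\<in>I. inv_FT (G k) x)
    \<le> ennreal (kernel_mass TYPE('b) powr p) * D * (\<Sum>k\<in>I. Lp_pow p (inv_FT (G k)))"
proof -
  have [measurable]: "Z \<in> borel_measurable borel"
    using lin by (intro borel_measurable_continuous_onI linear_continuous_on linear_conv_bounded_linear[THEN iffD1])
  let ?M = "kernel_mass TYPE('b)"
  \<comment> \<open>Extending by zero outside the index set makes measurability unconditional.\<close>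
  define F where "F k = (if k \<in> I then inv_FT (G k) else (\<lambda>_. 0))" for k
  define g where "g k = (if k \<in> I then cell_transform P (T k) else (\<lambda>_. 0))" for k
  have F [measurable]: "F k \<in> borel_measurable borel" for k using G by (auto simp: F_def)
  have g [measurable]: "g k \<in> borel_measurable borel" for k using T by (auto simp: g_def)
  have g_le: "norm (g k y) \<le> \<mu>" if "k \<in> I" for k y
    using norm_cell_transform_le[of "T k" P y] T[OF that] mT[OF that] \<mu> that by (simp add: g_def measure_def)
  define H where "H x z w = (\<Sum>k\<in>I. (e (- (\<omega>0 \<bullet> Z w)) * F k (x + Z w)) * g k (z - w))" for x z w
  have [measurable]: "(\<lambda>(w, z). H x z w) \<in> borel_measurable (borel \<Otimes>\<^sub>M borel)" for x
    unfolding H_def by measurable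
  have [measurable]: "(\<lambda>w. H x z w) \<in> borel_measurable borel" for x z
    unfolding H_def by measurable
  have loc': "(\<integral>\<^sup>+z. indicator unit_box z * ennreal (norm (H x z w) powr p) \<partial>lborel)
       \<le> D * (\<Sum>k\<in>I. ennreal (norm (F k (x + Z w)) powr p))" for x w
    using loc[of "\<lambda>k. e (- (\<omega>0 \<bullet> Z w)) * F k (x + Z w)" w]
    by (simp add: H_def g_def norm_mult cong: sum.cong)
  have pt: "ennreal ((\<mu> * norm (\<Sum>k\<in>I. F k (x + Z z))) powr p)
      \<le> ennreal (?M powr (p - 1)) * (\<integral>\<^sup>+w. ennreal (kernel_majorant w) * ennreal (norm (H x z w) powr p) \<partial>lborel)"
    if z: "z \<in> unit_box" for x z
  proof -
    \<comment> \<open>A crude bound, used only to know that the integrals in Jensen's inequality exist.\<close>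
    define B where "B = (\<Sum>k\<in>I. (\<integral>\<omega>. norm (G k \<omega>) \<partial>lborel) * \<mu>)"
    have HB: "norm (H x z w) \<le> B" for w
      unfolding H_def B_def
    proof (rule sum_norm_le)
      fix k assume k: "k \<in> I"
      have "norm (F k (x + Z w)) * norm (g k (z - w)) \<le> (\<integral>\<omega>. norm (G k \<omega>) \<partial>lborel) * \<mu>"
        using k norm_inv_FT_le g_le[OF k] by (intro mult_mono) (auto simp: F_def)
      then show "norm (e (- (\<omega>0 \<bullet> Z w)) * F k (x + Z w) * g k (z - w)) \<le> (\<integral>\<omega>. norm (G k \<omega>) \<partial>lborel) * \<mu>"
        by (simp add: norm_mult)
    qed
    have intk: "integrable lborel (\<lambda>w. of_real (prod_kernel (z - w)) * ((e (- (\<omega>0 \<bullet> Z w)) * F k (x + Z w)) * g k (z - w)))" if "k \<in> I" for k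
    proof (rule integrable_mult_bounded[OF integrable_prod_kernel[OF z], where C = "(\<integral>\<omega>. norm (G k \<omega>) \<partial>lborel) * \<mu>"])
      fix w
      have "norm (F k (x + Z w)) * norm (g k (z - w)) \<le> (\<integral>\<omega>. norm (G k \<omega>) \<partial>lborel) * \<mu>"
        using that norm_inv_FT_le g_le[OF that] by (intro mult_mono) (auto simp: F_def)
      then show "norm (e (- (\<omega>0 \<bullet> Z w)) * F k (x + Z w) * g k (z - w)) \<le> (\<integral>\<omega>. norm (G k \<omega>) \<partial>lborel) * \<mu>"
        by (simp add: norm_mult)
    qed measurable
    have intH: "integrable lborel (\<lambda>w. kernel_majorant w * norm (H x z w))"
    proof (rule Bochner_Integration.integrable_bound)
      show "integrable lborel (\<lambda>w::'b. kernel_majorant w * B)"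
        by (intro integrable_mult_left integrable_kernel_majorant)
      have "norm (kernel_majorant w * norm (H x z w)) \<le> norm (kernel_majorant w * B)" for w
        using HB[of w] by (auto simp: abs_mult intro!: mult_left_mono)
      then show "AE w in lborel. norm (kernel_majorant w * norm (H x z w)) \<le> norm (kernel_majorant w * B)" by simp
    qed measurable
    have "\<mu> * (\<Sum>k\<in>I. F k (x + Z z)) = (\<Sum>k\<in>I. \<mu> * F k (x + Z z))"
      by (simp add: sum_distrib_left)
    also have "\<dots> = (\<Sum>k\<in>I. e (\<omega>0 \<bullet> Z z) * (\<integral>w. of_real (prod_kernel (z - w)) * ((e (- (\<omega>0 \<bullet> Z w)) * F k (x + Z w)) * g k (z - w)) \<partial>lborel))"
    proof (rule sum.cong)
      fix k assume k: "k \<in> I"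
      show "\<mu> * F k (x + Z z) = e (\<omega>0 \<bullet> Z z) * (\<integral>w. of_real (prod_kernel (z - w)) * ((e (- (\<omega>0 \<bullet> Z w)) * F k (x + Z w)) * g k (z - w)) \<partial>lborel)"
        using inv_FT_separation[OF lin z T[OF k] _ P G[OF k] dev[OF k], where x = x] mT[OF k] \<mu> k
        by (simp add: F_def g_def measure_def)
    qed simp
    also have "\<dots> = e (\<omega>0 \<bullet> Z z) * (\<integral>w. of_real (prod_kernel (z - w)) * H x z w \<partial>lborel)"
      unfolding H_def sum_distrib_left using intk
      by (subst Bochner_Integration.integral_sum) (auto simp: sum_distrib_left)
    finally have "\<mu> * norm (\<Sum>k\<in>I. F k (x + Z z)) = norm (\<integral>w. of_real (prod_kernel (z - w)) * H x z w \<partial>lborel)"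
      using \<mu> by (metis abs_of_pos mult_1 norm_e norm_mult norm_of_real)
    also have "\<dots> \<le> (\<integral>w. norm (of_real (prod_kernel (z - w)) * H x z w) \<partial>lborel)"
      by (rule integral_norm_bound)
    also have "\<dots> \<le> (\<integral>w. kernel_majorant w * norm (H x z w) \<partial>lborel)"
    proof (rule integral_mono)
      show "integrable lborel (\<lambda>w. norm (of_real (prod_kernel (z - w)) * H x z w))"
        using HB by (intro integrable_norm integrable_mult_bounded[OF integrable_prod_kernel[OF z], where C = B]) auto
      show "integrable lborel (\<lambda>w. kernel_majorant w * norm (H x z w))" by (rule intH)
      show "norm (of_real (prod_kernel (z - w)) * H x z w) \<le> kernel_majorant w * norm (H x z w)" for w
        using prod_kernel_le_majorant[OF z, of w] by (simp add: norm_mult mult_right_mono)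
    qed
    finally have le: "\<mu> * norm (\<Sum>k\<in>I. F k (x + Z z)) \<le> (\<integral>w. kernel_majorant w * norm (H x z w) \<partial>lborel)" .
    have "ennreal ((\<mu> * norm (\<Sum>k\<in>I. F k (x + Z z))) powr p) \<le> ennreal ((\<integral>w. kernel_majorant w * norm (H x z w) \<partial>lborel) powr p)"
      using le \<mu> p by (intro ennreal_leI powr_mono2) auto
    also have "\<dots> \<le> ennreal (?M powr (p - 1)) * (\<integral>\<^sup>+w. ennreal (kernel_majorant w) * ennreal (norm (H x z w) powr p) \<partial>lborel)"
      using kernel_mass_pos[where 'b = 'b] intH integrable_kernel_majorant p
      by (intro jensen_weighted) (auto simp: less_imp_le[OF kernel_majorant_pos] kernel_mass_def)
    finally show ?thesis .
  qed
  have ptx: "(\<integral>\<^sup>+z. indicator unit_box z * ennreal ((\<mu> * norm (\<Sum>k\<in>I. F k (x + Z z))) powr p) \<partial>lborel)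
     \<le> ennreal (?M powr (p - 1)) * (\<integral>\<^sup>+w. ennreal (kernel_majorant w) * (D * (\<Sum>k\<in>I. ennreal (norm (F k (x + Z w)) powr p))) \<partial>lborel)" for x
  proof -
    have "(\<integral>\<^sup>+z. indicator unit_box z * ennreal ((\<mu> * norm (\<Sum>k\<in>I. F k (x + Z z))) powr p) \<partial>lborel)
      \<le> (\<integral>\<^sup>+z. ennreal (?M powr (p - 1)) * (\<integral>\<^sup>+w. indicator unit_box z * (ennreal (kernel_majorant w) * ennreal (norm (H x z w) powr p)) \<partial>lborel) \<partial>lborel)"
      using pt by (intro nn_integral_mono) (auto simp: indicator_def)
    also have "\<dots> = ennreal (?M powr (p - 1)) * (\<integral>\<^sup>+w. (\<integral>\<^sup>+z. ennreal (kernel_majorant w) * (indicator unit_box z * ennreal (norm (H x z w) powr p)) \<partial>lborel) \<partial>lborel)"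
      apply (subst nn_integral_cmult)
       apply (measurable)
      apply (subst lborel_pair.Fubini')
       apply measurable
      apply (simp add: mult.left_commute)
      done
    also have "\<dots> = ennreal (?M powr (p - 1)) * (\<integral>\<^sup>+w. ennreal (kernel_majorant w) * (\<integral>\<^sup>+z. indicator unit_box z * ennreal (norm (H x z w) powr p) \<partial>lborel) \<partial>lborel)"
      by (subst nn_integral_cmult) auto
    also have "\<dots> \<le> ennreal (?M powr (p - 1)) * (\<integral>\<^sup>+w. ennreal (kernel_majorant w) * (D * (\<Sum>k\<in>I. ennreal (norm (F k (x + Z w)) powr p))) \<partial>lborel)"
      using loc' by (intro mult_left_mono nn_integral_mono) auto
    finally show ?thesis .
  qed
  have tr: "(\<integral>\<^sup>+x. ennreal (norm (f (x + c)) powr p) \<partial>lborel) = Lp_pow p f" if [measurable]: "f \<in> borel_measurable borel" for f :: "'a \<Rightarrow> complex" and c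
    unfolding Lp_pow_def by (rule nn_integral_lborel_translate) measurable
  have "ennreal (\<mu> powr p * 2 ^ DIM('b)) * Lp_pow p (\<lambda>x. \<Sum>k\<in>I. F k x)
     = (\<integral>\<^sup>+z. indicator unit_box z * (ennreal (\<mu> powr p) * Lp_pow p (\<lambda>x. \<Sum>k\<in>I. F k x)) \<partial>(lborel :: 'b measure))"
    by (subst nn_integral_multc) (auto simp: emeasure_unit_box ennreal_mult mult_ac)
  also have "\<dots> = (\<integral>\<^sup>+z. (\<integral>\<^sup>+x. indicator unit_box z * ennreal ((\<mu> * norm (\<Sum>k\<in>I. F k (x + Z z))) powr p) \<partial>lborel) \<partial>lborel)"
  proof (rule nn_integral_cong)
    fix z :: 'b
    show "indicator unit_box z * (ennreal (\<mu> powr p) * Lp_pow p (\<lambda>x. \<Sum>k\<in>I. F k x)) =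
      (\<integral>\<^sup>+x. indicator unit_box z * ennreal ((\<mu> * norm (\<Sum>k\<in>I. F k (x + Z z))) powr p) \<partial>lborel)"
      using \<mu> by (subst tr[of "\<lambda>x. \<Sum>k\<in>I. F k x" "Z z", symmetric])
        (auto simp: powr_mult ennreal_mult nn_integral_cmult)
  qed
  also have "\<dots> = (\<integral>\<^sup>+x. (\<integral>\<^sup>+z. indicator unit_box z * ennreal ((\<mu> * norm (\<Sum>k\<in>I. F k (x + Z z))) powr p) \<partial>lborel) \<partial>lborel)"
    by (rule lborel_pair.Fubini') measurable
  also have "\<dots> \<le> (\<integral>\<^sup>+x. ennreal (?M powr (p - 1)) * (\<integral>\<^sup>+w. ennreal (kernel_majorant w) * (D * (\<Sum>k\<in>I. ennreal (norm (F k (x + Z w)) powr p))) \<partial>lborel) \<partial>lborel)"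
    by (rule nn_integral_mono[OF ptx])
  also have "\<dots> = ennreal (?M powr (p - 1)) * (\<integral>\<^sup>+w. (\<integral>\<^sup>+x. ennreal (kernel_majorant w) * (D * (\<Sum>k\<in>I. ennreal (norm (F k (x + Z w)) powr p))) \<partial>lborel) \<partial>lborel)"
    apply (subst nn_integral_cmult)
     apply measurable
    apply (subst lborel_pair.Fubini')
     apply measurable
    done
  also have "\<dots> = ennreal (?M powr (p - 1)) * (\<integral>\<^sup>+w. ennreal (kernel_majorant w) * (D * (\<Sum>k\<in>I. Lp_pow p (F k))) \<partial>(lborel :: 'b measure))"
  proof -
    have sumF: "(\<integral>\<^sup>+x. (\<Sum>k\<in>I. ennreal (norm (F k (x + Z w)) powr p)) \<partial>lborel) = (\<Sum>k\<in>I. Lp_pow p (F k))" for w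
      by (subst nn_integral_sum) (auto simp: tr)
    have "(\<integral>\<^sup>+x. ennreal (kernel_majorant w) * (D * (\<Sum>k\<in>I. ennreal (norm (F k (x + Z w)) powr p))) \<partial>lborel)
       = ennreal (kernel_majorant w) * (D * (\<Sum>k\<in>I. Lp_pow p (F k)))" for w
      by (subst nn_integral_cmult, measurable, subst nn_integral_cmult, measurable) (simp only: sumF)
    then show ?thesis by simp
  qed
  also have "\<dots> = ennreal (?M powr (p - 1)) * (ennreal ?M * (D * (\<Sum>k\<in>I. Lp_pow p (F k))))"
    by (subst nn_integral_multc)
       (auto simp: nn_integral_eq_integral[OF integrable_kernel_majorant] less_imp_le[OF kernel_majorant_pos] kernel_mass_def)
  also have "\<dots> = ennreal (?M powr p) * D * (\<Sum>k\<in>I. Lp_pow p (F k))"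
  proof -
    have "ennreal (?M powr (p - 1)) * ennreal ?M = ennreal (?M powr p)"
      using kernel_mass_pos[where 'b = 'b] by (subst ennreal_mult[symmetric]) (auto simp: powr_diff)
    then show ?thesis by (simp only: mult.assoc[symmetric])
  qed
  finally show ?thesis by (simp add: F_def cong: sum.cong)
qed

section \<open>A local Plancherel bound\<close>

lemma AE_lborel_inner_neq:
  fixes b :: "'a::euclidean_space"
  assumes "b \<in> Basis"
  shows "AE x in lborel. x \<bullet> b \<noteq> c"
proof -
  have "negligible {x. x \<bullet> b = c}"
    by (rule negligible_standard_hyperplane[OF assms])
  then have "AE x in lebesgue. x \<notin> {x. x \<bullet> b = c}"
    by (intro AE_not_in) (simp add: negligible_iff_null_sets)
  then show ?thesis by (simp add: AE_completion_iff)
qed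

lemma norm_integral_le_nn_integral:
  "ennreal (norm (\<integral>x. f x \<partial>M)) \<le> (\<integral>\<^sup>+x. ennreal (norm (f x)) \<partial>M)"
  for f :: "'a \<Rightarrow> 'b::{banach, second_countable_topology}"
  by (cases "integrable M f") (auto simp: integral_norm_bound_ennreal not_integrable_integral_eq)

lemma one_minus_cos_ge:
  fixes y :: real
  assumes "\<bar>y\<bar> \<le> 1"
  shows "y\<^sup>2 / 4 \<le> 1 - cos y"
proof -
  obtain t where "cos y = (\<Sum>m<4. cos_coeff m * y ^ m) + (cos (t + 1 / 2 * real (4::nat) * pi) / fact 4) * y ^ 4"
    using Maclaurin_cos_expansion[of y 4] by blast
  moreover have "(\<Sum>m<4. cos_coeff m * y ^ m) = 1 - y\<^sup>2 / 2"
    by (simp add: cos_coeff_def eval_nat_numeral sum.lessThan_Suc fact_numeral) presburger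
  moreover have "(cos (t + 1 / 2 * real (4::nat) * pi) / fact 4) * y ^ 4 \<le> 1 * y ^ 4 / 4"
  proof -
    have "cos (t + 1 / 2 * real (4::nat) * pi) * y ^ 4 \<le> 1 * y ^ 4"
      by (intro mult_right_mono) auto
    then show ?thesis by (simp add: fact_numeral) (smt (verit) zero_le_power_eq_numeral even_numeral zero_le_even_power)
  qed
  moreover have "y ^ 4 \<le> y\<^sup>2"
    using assms power_decreasing[of 2 4 "\<bar>y\<bar>"] by (simp add: power_even_abs)
  ultimately show ?thesis by simp
qed

text \<open>
  A nonnegative integrable weight, bounded below on the unit box, with a nonnegative compactly supported
  Fourier transform. It takes the value 0 on the coordinate hyperplanes, since division by zero yields 0;
  hence the lower bound on the unit box holds only almost everywhere.
\<close>

definition fejer_weight :: "'b::euclidean_space \<Rightarrow> real" where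
  "fejer_weight x = (\<Prod>b\<in>Basis. (1 - cos (x \<bullet> b)) / (x \<bullet> b)\<^sup>2)"

lemma borel_measurable_fejer_weight [measurable]: "fejer_weight \<in> borel_measurable borel"
  unfolding fejer_weight_def by measurable

lemma fejer_weight_nonneg: "fejer_weight x \<ge> 0"
  unfolding fejer_weight_def by (intro prod_nonneg) auto

lemma integrable_fejer_weight: "integrable lborel fejer_weight"
  unfolding fejer_weight_def by (intro lborel_integral_prod integrable_fejer1)

lemma fejer_weight_transform:
  fixes v :: "'b::euclidean_space"
  shows "(\<integral>x. of_real (fejer_weight x) * e (v \<bullet> x) \<partial>lborel)
     = of_real (\<Prod>b\<in>Basis. fejer_const * max 0 (1 - \<bar>2 * pi * (v \<bullet> b)\<bar>))"
proof -
  have one: "integrable lborel (\<lambda>y. of_real ((1 - cos y) / y\<^sup>2) * cis (c * y))"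
      "(\<integral>y. of_real ((1 - cos y) / y\<^sup>2) * cis (c * y) \<partial>lborel) = of_real (fejer_const * max 0 (1 - \<bar>c\<bar>))" for c
  proof -
    show i: "integrable lborel (\<lambda>y. of_real ((1 - cos y) / y\<^sup>2) * cis (c * y))"
      using integrable_fejer1 unfolding cis_conv_exp
      by (intro integrable_mult_bounded[where C = 1] integrable_of_real) auto
    show "(\<integral>y. of_real ((1 - cos y) / y\<^sup>2) * cis (c * y) \<partial>lborel) = of_real (fejer_const * max 0 (1 - \<bar>c\<bar>))"
    proof (rule complex_eqI)
      have "Re (\<integral>y. of_real ((1 - cos y) / y\<^sup>2) * cis (c * y) \<partial>lborel) = (\<integral>y. (1 - cos y) / y\<^sup>2 * cos (c * y) \<partial>lborel)"
        by (subst integral_Re[symmetric, OF i]) (simp add: Re_divide_of_real flip: of_real_diff of_real_power)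
      then show "Re (\<integral>y. of_real ((1 - cos y) / y\<^sup>2) * cis (c * y) \<partial>lborel) = Re (of_real (fejer_const * max 0 (1 - \<bar>c\<bar>)))"
        using fejer_cos(2)[of c] by simp
      have "Im (\<integral>y. of_real ((1 - cos y) / y\<^sup>2) * cis (c * y) \<partial>lborel) = (\<integral>y. (1 - cos y) / y\<^sup>2 * sin (c * y) \<partial>lborel)"
        by (subst integral_Im[symmetric, OF i]) (simp add: Im_divide_of_real flip: of_real_diff of_real_power)
      also have "\<dots> = 0" by (rule integral_odd_zero) simp
      finally show "Im (\<integral>y. of_real ((1 - cos y) / y\<^sup>2) * cis (c * y) \<partial>lborel) = Im (of_real (fejer_const * max 0 (1 - \<bar>c\<bar>)))"
        by simp
    qed
  qed
  have eq: "of_real (fejer_weight x) * e (v \<bullet> x) =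
     (\<Prod>b\<in>Basis. of_real ((1 - cos (x \<bullet> b)) / (x \<bullet> b)\<^sup>2) * cis ((2 * pi * (v \<bullet> b)) * (x \<bullet> b)))" for x
    using cis_inner[of "(2 * pi) *\<^sub>R v" x]
    by (simp only: fejer_weight_def e_eq_cis prod.distrib of_real_prod inner_scaleR_left mult.assoc)
  show ?thesis
    unfolding eq of_real_prod by (subst lborel_integral_prod(2)[OF one(1)]) (intro prod.cong refl one(2))
qed

lemma fejer_weight_ge:
  "AE x in lborel. x \<in> unit_box \<longrightarrow> (1/4) ^ DIM('b::euclidean_space) \<le> fejer_weight (x::'b)"
proof -
  have "AE x in (lborel :: 'b measure). \<forall>b\<in>Basis. x \<bullet> b \<noteq> 0"
    by (subst AE_finite_all) (auto intro: AE_lborel_inner_neq)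
  then show ?thesis
  proof eventually_elim
    case (elim x)
    show ?case
    proof
      assume x: "x \<in> unit_box"
      have "(\<Prod>b\<in>(Basis::'b set). 1/4) \<le> fejer_weight x"
        unfolding fejer_weight_def
      proof (rule prod_mono, intro conjI)
        fix b :: 'b assume b: "b \<in> Basis"
        then have "(x \<bullet> b)\<^sup>2 / 4 \<le> 1 - cos (x \<bullet> b)" using x by (intro one_minus_cos_ge) (auto simp: unit_box_def)
        then show "1 / 4 \<le> (1 - cos (x \<bullet> b)) / (x \<bullet> b)\<^sup>2" using elim b by (simp add: pos_le_divide_eq)
      qed simp
      then show "(1/4) ^ DIM('b) \<le> fejer_weight x" by simp
    qed
  qed
qed

text \<open>
  Replacing the indicator of the unit box by the weight turns the left hand side into a quadratic form in
  \<open>g\<close> whose kernel is the Fourier transform of the weight at \<open>L *\<^sub>R (\<xi> - \<eta>)\<close>. This kernel is supported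
  where all coordinates of \<open>\<xi> - \<eta>\<close> are at most \<open>1 / L\<close>, so Schur's test gives the decay in \<open>L\<close>. The
  constant 8 is 4, from the lower bound of the weight, times 2, from the length of \<open>[- 1 / L, 1 / L]\<close>.
\<close>

lemma local_bessel:
  fixes g :: "'c::euclidean_space \<Rightarrow> complex"
  assumes g: "integrable lborel g" and L: "L > 0"
  shows "(\<integral>\<^sup>+x. indicator unit_box x * ennreal ((norm (\<integral>\<xi>. g \<xi> * e ((L *\<^sub>R \<xi>) \<bullet> x) \<partial>lborel))\<^sup>2) \<partial>lborel)
     \<le> ennreal ((8 * fejer_const / L) ^ DIM('c)) * (\<integral>\<^sup>+\<xi>. ennreal ((norm (g \<xi>))\<^sup>2) \<partial>lborel)"
proof -
  have [measurable]: "g \<in> borel_measurable borel" using g by auto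
  define gh where "gh x = (\<integral>\<xi>. g \<xi> * e ((L *\<^sub>R \<xi>) \<bullet> x) \<partial>lborel)" for x :: 'c
  have [measurable]: "gh \<in> borel_measurable borel" unfolding gh_def[abs_def] by measurable
  define B where "B = (\<integral>\<xi>. norm (g \<xi>) \<partial>lborel)"
  have ghB: "norm (gh x) \<le> B" for x
    unfolding gh_def B_def by (rule order_trans[OF integral_norm_bound]) (simp add: norm_mult)
  define K where "K v = (\<Prod>b\<in>Basis. fejer_const * max 0 (1 - \<bar>2 * pi * (v \<bullet> b)\<bar>))" for v :: 'c
  have [measurable]: "K \<in> borel_measurable borel" unfolding K_def by measurable
  have K0: "K v \<ge> 0" for v unfolding K_def using fejer_const_pos by (intro prod_nonneg) auto
  have iw: "integrable lborel (\<lambda>x::'c. complex_of_real (fejer_weight x))"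
    by (intro integrable_of_real integrable_fejer_weight)
  have cg: "integrable lborel (\<lambda>\<xi>. cnj (g \<xi>))" using g by simp
  have cgh: "cnj (gh x) = (\<integral>\<eta>. cnj (g \<eta>) * e (- ((L *\<^sub>R \<eta>) \<bullet> x)) \<partial>lborel)" for x
    unfolding gh_def by (simp add: e_eq_cis cis_cnj flip: Bochner_Integration.integral_cnj)
  have "(\<integral>x. of_real (fejer_weight x) * (\<integral>\<eta>. cnj (g \<eta>) * (e (- ((L *\<^sub>R \<eta>) \<bullet> x)) * gh x) \<partial>lborel) \<partial>lborel)
      = (\<integral>\<eta>. cnj (g \<eta>) * (\<integral>x. of_real (fejer_weight x) * (e (- ((L *\<^sub>R \<eta>) \<bullet> x)) * gh x) \<partial>lborel) \<partial>lborel)"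
    using ghB by (intro Fubini_bounded_kernel[where C = B] iw cg) (auto simp: norm_mult)
  also have "(\<lambda>\<eta>. \<integral>x. of_real (fejer_weight x) * (e (- ((L *\<^sub>R \<eta>) \<bullet> x)) * gh x) \<partial>lborel)
     = (\<lambda>\<eta>. \<integral>\<xi>. g \<xi> * of_real (K (L *\<^sub>R (\<xi> - \<eta>))) \<partial>lborel)"
  proof
    fix \<eta> :: 'c
    have "(\<integral>x. of_real (fejer_weight x) * (e (- ((L *\<^sub>R \<eta>) \<bullet> x)) * gh x) \<partial>lborel)
      = (\<integral>x. of_real (fejer_weight x) * (\<integral>\<xi>. g \<xi> * e ((L *\<^sub>R (\<xi> - \<eta>)) \<bullet> x) \<partial>lborel) \<partial>lborel)"
    proof (rule Bochner_Integration.integral_cong)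
      fix x :: 'c
      have "g \<xi> * e ((L *\<^sub>R (\<xi> - \<eta>)) \<bullet> x) = e (- ((L *\<^sub>R \<eta>) \<bullet> x)) * (g \<xi> * e ((L *\<^sub>R \<xi>) \<bullet> x))" for \<xi>
      proof -
        have "e ((L *\<^sub>R (\<xi> - \<eta>)) \<bullet> x) = e (- ((L *\<^sub>R \<eta>) \<bullet> x)) * e ((L *\<^sub>R \<xi>) \<bullet> x)"
          by (simp add: inner_diff_left algebra_simps flip: e_add)
        then show ?thesis by (simp only: mult.left_commute)
      qed
      then show "of_real (fejer_weight x) * (e (- ((L *\<^sub>R \<eta>) \<bullet> x)) * gh x) = of_real (fejer_weight x) * (\<integral>\<xi>. g \<xi> * e ((L *\<^sub>R (\<xi> - \<eta>)) \<bullet> x) \<partial>lborel)"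
        unfolding gh_def by (simp only: integral_mult_right_zero)
    qed simp
    also have "\<dots> = (\<integral>\<xi>. g \<xi> * (\<integral>x. of_real (fejer_weight x) * e ((L *\<^sub>R (\<xi> - \<eta>)) \<bullet> x) \<partial>lborel) \<partial>lborel)"
      by (intro Fubini_bounded_kernel[where C = 1] iw g) (auto simp: norm_mult)
    also have "\<dots> = (\<integral>\<xi>. g \<xi> * of_real (K (L *\<^sub>R (\<xi> - \<eta>))) \<partial>lborel)"
      unfolding K_def fejer_weight_transform ..
    finally show "(\<integral>x. of_real (fejer_weight x) * (e (- ((L *\<^sub>R \<eta>) \<bullet> x)) * gh x) \<partial>lborel)
      = (\<integral>\<xi>. g \<xi> * of_real (K (L *\<^sub>R (\<xi> - \<eta>))) \<partial>lborel)" .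
  qed
  also have "(\<lambda>x. \<integral>\<eta>. cnj (g \<eta>) * (e (- ((L *\<^sub>R \<eta>) \<bullet> x)) * gh x) \<partial>lborel) = (\<lambda>x. of_real ((norm (gh x))\<^sup>2))"
  proof
    fix x :: 'c
    have "(\<integral>\<eta>. cnj (g \<eta>) * (e (- ((L *\<^sub>R \<eta>) \<bullet> x)) * gh x) \<partial>lborel) = cnj (gh x) * gh x"
      unfolding cgh by (simp add: mult.assoc flip: integral_mult_left_zero)
    then show "(\<integral>\<eta>. cnj (g \<eta>) * (e (- ((L *\<^sub>R \<eta>) \<bullet> x)) * gh x) \<partial>lborel) = of_real ((norm (gh x))\<^sup>2)"
      by (simp add: complex_norm_square mult.commute del: of_real_power)
  qed
  finally have form: "(\<integral>x. complex_of_real (fejer_weight x) * of_real ((norm (gh x))\<^sup>2) \<partial>lborel)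
     = (\<integral>\<eta>. cnj (g \<eta>) * (\<integral>\<xi>. g \<xi> * of_real (K (L *\<^sub>R (\<xi> - \<eta>))) \<partial>lborel) \<partial>lborel)" .
  have iwg: "integrable lborel (\<lambda>x. fejer_weight x * (norm (gh x))\<^sup>2)"
  proof (rule Bochner_Integration.integrable_bound)
    show "integrable lborel (\<lambda>x::'c. fejer_weight x * B\<^sup>2)"
      by (intro integrable_mult_left integrable_fejer_weight)
    show "AE x in lborel. norm (fejer_weight x * (norm (gh x))\<^sup>2) \<le> norm (fejer_weight x * B\<^sup>2)"
      using ghB by (intro AE_I2) (auto simp: abs_mult intro!: mult_left_mono power_mono)
  qed measurable
  have KI: "(\<integral>\<^sup>+\<xi>. ennreal (K (L *\<^sub>R (\<xi> - \<eta>))) \<partial>lborel) \<le> ennreal ((2 * fejer_const / L) ^ DIM('c))" for \<eta>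
  proof -
    have "ennreal (K (L *\<^sub>R (\<xi> - \<eta>))) \<le> ennreal (fejer_const ^ DIM('c)) * indicator (cbox (\<eta> - (1/L) *\<^sub>R One) (\<eta> + (1/L) *\<^sub>R One)) \<xi>" for \<xi>
    proof (cases "\<xi> \<in> cbox (\<eta> - (1/L) *\<^sub>R One) (\<eta> + (1/L) *\<^sub>R One)")
      case True
      have "K (L *\<^sub>R (\<xi> - \<eta>)) \<le> (\<Prod>b\<in>(Basis::'c set). fejer_const)"
        unfolding K_def using fejer_const_pos by (intro prod_mono) auto
      then show ?thesis using True by (simp add: ennreal_leI)
    next
      case False
      then obtain b where b: "b \<in> Basis" "\<not> \<bar>(\<xi> - \<eta>) \<bullet> b\<bar> \<le> 1 / L"
        by (auto simp: mem_box inner_diff_left inner_add_left abs_le_iff algebra_simps)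
      then have "1 < \<bar>(\<xi> - \<eta>) \<bullet> b\<bar> * L" using L by (simp add: pos_divide_less_eq not_le)
      then have "1 < \<bar>L * ((\<xi> - \<eta>) \<bullet> b)\<bar>" using L by (simp add: abs_mult mult.commute)
      also have "\<dots> \<le> 2 * pi * \<bar>L * ((\<xi> - \<eta>) \<bullet> b)\<bar>"
        using mult_right_mono[of 1 "2 * pi" "\<bar>L * ((\<xi> - \<eta>) \<bullet> b)\<bar>"] pi_gt3 by simp
      finally have "fejer_const * max 0 (1 - \<bar>2 * pi * ((L *\<^sub>R (\<xi> - \<eta>)) \<bullet> b)\<bar>) = 0"
        by (simp add: abs_mult)
      then have "K (L *\<^sub>R (\<xi> - \<eta>)) = 0" unfolding K_def using b(1) by (intro prod_zero) auto
      then show ?thesis by simp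
    qed
    then have "(\<integral>\<^sup>+\<xi>. ennreal (K (L *\<^sub>R (\<xi> - \<eta>))) \<partial>lborel) \<le> (\<integral>\<^sup>+\<xi>. ennreal (fejer_const ^ DIM('c)) * indicator (cbox (\<eta> - (1/L) *\<^sub>R One) (\<eta> + (1/L) *\<^sub>R One)) \<xi> \<partial>lborel)"
      by (intro nn_integral_mono)
    also have "\<dots> = ennreal (fejer_const ^ DIM('c)) * emeasure lborel (cbox (\<eta> - (1/L) *\<^sub>R One) (\<eta> + (1/L) *\<^sub>R One))"
      by (simp add: nn_integral_cmult)
    also have "emeasure lborel (cbox (\<eta> - (1/L) *\<^sub>R One) (\<eta> + (1/L) *\<^sub>R One)) = ennreal (\<Prod>b\<in>(Basis::'c set). 2 / L)"
      using L by (subst emeasure_lborel_cbox) (auto simp: inner_diff_left inner_add_left intro!: prod.cong arg_cong[where f = ennreal])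
    also have "ennreal (fejer_const ^ DIM('c)) * \<dots> = ennreal ((2 * fejer_const / L) ^ DIM('c))"
      using L fejer_const_pos by (simp add: power_mult_distrib power_divide mult_ac flip: ennreal_mult)
    finally show ?thesis .
  qed
  let ?G2 = "\<integral>\<^sup>+\<xi>. ennreal ((norm (g \<xi>))\<^sup>2) \<partial>lborel"
  let ?k = "\<lambda>\<xi> \<eta>. ennreal (K (L *\<^sub>R (\<xi> - \<eta>)))"
  have Ksym: "K (L *\<^sub>R (\<xi> - \<eta>)) = K (L *\<^sub>R (\<eta> - \<xi>))" for \<xi> \<eta>
    unfolding K_def by (simp add: inner_diff_left abs_mult abs_minus_commute)
  \<comment> \<open>Schur's test: after the arithmetic-geometric mean inequality each half is an integral of the kernel alone.\<close>
  have half: "(\<integral>\<^sup>+\<eta>. (\<integral>\<^sup>+\<xi>. ennreal ((norm (g \<eta>))\<^sup>2) * ?k \<xi> \<eta> \<partial>lborel) \<partial>lborel) \<le> ennreal ((2 * fejer_const / L) ^ DIM('c)) * ?G2"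
  proof -
    have "(\<integral>\<^sup>+\<eta>. (\<integral>\<^sup>+\<xi>. ennreal ((norm (g \<eta>))\<^sup>2) * ?k \<xi> \<eta> \<partial>lborel) \<partial>lborel)
       = (\<integral>\<^sup>+\<eta>. ennreal ((norm (g \<eta>))\<^sup>2) * (\<integral>\<^sup>+\<xi>. ?k \<xi> \<eta> \<partial>lborel) \<partial>lborel)"
      by (subst nn_integral_cmult) auto
    also have "\<dots> \<le> (\<integral>\<^sup>+\<eta>. ennreal ((norm (g \<eta>))\<^sup>2) * ennreal ((2 * fejer_const / L) ^ DIM('c)) \<partial>lborel)"
      using KI by (intro nn_integral_mono mult_left_mono) auto
    finally show ?thesis by (simp add: nn_integral_multc mult.commute)
  qed
  have half': "(\<integral>\<^sup>+\<eta>. (\<integral>\<^sup>+\<xi>. ennreal ((norm (g \<xi>))\<^sup>2) * ?k \<xi> \<eta> \<partial>lborel) \<partial>lborel) \<le> ennreal ((2 * fejer_const / L) ^ DIM('c)) * ?G2"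
  proof -
    have "(\<integral>\<^sup>+\<eta>. (\<integral>\<^sup>+\<xi>. ennreal ((norm (g \<xi>))\<^sup>2) * ?k \<xi> \<eta> \<partial>lborel) \<partial>lborel) =
      (\<integral>\<^sup>+\<xi>. (\<integral>\<^sup>+\<eta>. ennreal ((norm (g \<xi>))\<^sup>2) * ?k \<xi> \<eta> \<partial>lborel) \<partial>lborel)"
      by (rule lborel_pair.Fubini') measurable
    also have "\<dots> \<le> ennreal ((2 * fejer_const / L) ^ DIM('c)) * ?G2"
      using half by (subst Ksym)
    finally show ?thesis .
  qed
  have "ennreal (\<integral>x. fejer_weight x * (norm (gh x))\<^sup>2 \<partial>lborel) \<le> ennreal (norm (\<integral>x. complex_of_real (fejer_weight x) * of_real ((norm (gh x))\<^sup>2) \<partial>lborel))"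
  proof -
    have "(\<integral>x. complex_of_real (fejer_weight x) * of_real ((norm (gh x))\<^sup>2) \<partial>lborel) = of_real (\<integral>x. fejer_weight x * (norm (gh x))\<^sup>2 \<partial>lborel)"
      by (simp flip: of_real_mult of_real_power)
    then show ?thesis by (simp only: norm_of_real) (rule ennreal_leI, simp)
  qed
  also have "\<dots> \<le> (\<integral>\<^sup>+\<eta>. ennreal (norm (cnj (g \<eta>) * (\<integral>\<xi>. g \<xi> * of_real (K (L *\<^sub>R (\<xi> - \<eta>))) \<partial>lborel))) \<partial>lborel)"
    unfolding form by (rule norm_integral_le_nn_integral)
  also have "\<dots> \<le> (\<integral>\<^sup>+\<eta>. (\<integral>\<^sup>+\<xi>. ennreal (1/2) * (ennreal ((norm (g \<eta>))\<^sup>2) * ?k \<xi> \<eta> + ennreal ((norm (g \<xi>))\<^sup>2) * ?k \<xi> \<eta>) \<partial>lborel) \<partial>lborel)"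
  proof (rule nn_integral_mono)
    fix \<eta> :: 'c
    have "ennreal (norm (cnj (g \<eta>) * (\<integral>\<xi>. g \<xi> * of_real (K (L *\<^sub>R (\<xi> - \<eta>))) \<partial>lborel)))
      \<le> ennreal (norm (g \<eta>)) * (\<integral>\<^sup>+\<xi>. ennreal (norm (g \<xi> * of_real (K (L *\<^sub>R (\<xi> - \<eta>))))) \<partial>lborel)"
      unfolding norm_mult[of "cnj _"] by (simp add: ennreal_mult) (intro mult_left_mono norm_integral_le_nn_integral, simp)
    also have "\<dots> = (\<integral>\<^sup>+\<xi>. ennreal (norm (g \<eta>)) * ennreal (norm (g \<xi> * of_real (K (L *\<^sub>R (\<xi> - \<eta>))))) \<partial>lborel)"
      by (rule nn_integral_cmult[symmetric]) measurable
    also have "\<dots> \<le> (\<integral>\<^sup>+\<xi>. ennreal (1/2) * (ennreal ((norm (g \<eta>))\<^sup>2) * ?k \<xi> \<eta> + ennreal ((norm (g \<xi>))\<^sup>2) * ?k \<xi> \<eta>) \<partial>lborel)"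
    proof (rule nn_integral_mono)
      fix \<xi> :: 'c
      have "norm (g \<eta>) * norm (g \<xi>) \<le> 1/2 * ((norm (g \<eta>))\<^sup>2 + (norm (g \<xi>))\<^sup>2)"
        using sum_squares_bound[of "norm (g \<eta>)" "norm (g \<xi>)"] by simp
      then have "norm (g \<eta>) * norm (g \<xi>) * K (L *\<^sub>R (\<xi> - \<eta>)) \<le> 1/2 * ((norm (g \<eta>))\<^sup>2 + (norm (g \<xi>))\<^sup>2) * K (L *\<^sub>R (\<xi> - \<eta>))"
        using K0 by (rule mult_right_mono)
      then have "ennreal (norm (g \<eta>) * (norm (g \<xi>) * K (L *\<^sub>R (\<xi> - \<eta>)))) \<le> ennreal (1/2 * ((norm (g \<eta>))\<^sup>2 * K (L *\<^sub>R (\<xi> - \<eta>)) + (norm (g \<xi>))\<^sup>2 * K (L *\<^sub>R (\<xi> - \<eta>))))"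
        by (intro ennreal_leI) (simp add: algebra_simps)
      also have "\<dots> = ennreal (1/2) * (ennreal ((norm (g \<eta>))\<^sup>2) * ?k \<xi> \<eta> + ennreal ((norm (g \<xi>))\<^sup>2) * ?k \<xi> \<eta>)"
        using K0 by (subst ennreal_mult) (auto simp: ennreal_plus ennreal_mult add_nonneg_nonneg)
      finally show "ennreal (norm (g \<eta>)) * ennreal (norm (g \<xi> * of_real (K (L *\<^sub>R (\<xi> - \<eta>))))) \<le> ennreal (1/2) * (ennreal ((norm (g \<eta>))\<^sup>2) * ?k \<xi> \<eta> + ennreal ((norm (g \<xi>))\<^sup>2) * ?k \<xi> \<eta>)"
        using K0 by (simp add: norm_mult ennreal_mult)
    qed
    finally show "ennreal (norm (cnj (g \<eta>) * (\<integral>\<xi>. g \<xi> * of_real (K (L *\<^sub>R (\<xi> - \<eta>))) \<partial>lborel)))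
      \<le> (\<integral>\<^sup>+\<xi>. ennreal (1/2) * (ennreal ((norm (g \<eta>))\<^sup>2) * ?k \<xi> \<eta> + ennreal ((norm (g \<xi>))\<^sup>2) * ?k \<xi> \<eta>) \<partial>lborel)" .
  qed
  also have "\<dots> = ennreal (1/2) * ((\<integral>\<^sup>+\<eta>. (\<integral>\<^sup>+\<xi>. ennreal ((norm (g \<eta>))\<^sup>2) * ?k \<xi> \<eta> \<partial>lborel) \<partial>lborel) + (\<integral>\<^sup>+\<eta>. (\<integral>\<^sup>+\<xi>. ennreal ((norm (g \<xi>))\<^sup>2) * ?k \<xi> \<eta> \<partial>lborel) \<partial>lborel))"
  proof -
    have "(\<integral>\<^sup>+\<xi>. ennreal (1/2) * (ennreal ((norm (g \<eta>))\<^sup>2) * ?k \<xi> \<eta> + ennreal ((norm (g \<xi>))\<^sup>2) * ?k \<xi> \<eta>) \<partial>lborel)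
       = ennreal (1/2) * ((\<integral>\<^sup>+\<xi>. ennreal ((norm (g \<eta>))\<^sup>2) * ?k \<xi> \<eta> \<partial>lborel) + (\<integral>\<^sup>+\<xi>. ennreal ((norm (g \<xi>))\<^sup>2) * ?k \<xi> \<eta> \<partial>lborel))" for \<eta>
      by (subst nn_integral_cmult, measurable, subst nn_integral_add, measurable)
    then show ?thesis
      apply simp
      apply (subst nn_integral_cmult, measurable)
      apply (subst nn_integral_add, measurable)
      done
  qed
  also have "\<dots> \<le> ennreal (1/2) * (ennreal ((2 * fejer_const / L) ^ DIM('c)) * ?G2 + ennreal ((2 * fejer_const / L) ^ DIM('c)) * ?G2)"
    by (intro mult_left_mono add_mono half half') simp
  also have "\<dots> = ennreal ((2 * fejer_const / L) ^ DIM('c)) * ?G2"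
  proof -
    have "ennreal (1/2) * (y + y) = y" for y
    proof -
      have "ennreal (1/2) * (y + y) = (ennreal (1/2) + ennreal (1/2)) * y" by (simp only: distrib_left distrib_right)
      also have "ennreal (1/2) + ennreal (1/2) = ennreal (1/2 + 1/2)" by (rule ennreal_plus[symmetric]) auto
      finally show ?thesis by simp
    qed
    then show ?thesis .
  qed
  finally have main: "ennreal (\<integral>x. fejer_weight x * (norm (gh x))\<^sup>2 \<partial>lborel) \<le> ennreal ((2 * fejer_const / L) ^ DIM('c)) * ?G2" .
  have "(\<integral>\<^sup>+x. indicator unit_box x * ennreal ((norm (gh x))\<^sup>2) \<partial>lborel) \<le> (\<integral>\<^sup>+x. ennreal (4 ^ DIM('c)) * ennreal (fejer_weight x * (norm (gh x))\<^sup>2) \<partial>lborel)"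
  proof (rule nn_integral_mono_AE)
    show "AE x in lborel. indicator unit_box x * ennreal ((norm (gh x))\<^sup>2) \<le> ennreal (4 ^ DIM('c)) * ennreal (fejer_weight x * (norm (gh x))\<^sup>2)"
      using fejer_weight_ge[where 'b = 'c]
    proof eventually_elim
    case (elim x)
    show ?case
    proof (cases "x \<in> unit_box")
      case True
      then have "(1/4) ^ DIM('c) \<le> fejer_weight x" using elim by simp
      then have "1 \<le> 4 ^ DIM('c) * fejer_weight x" by (simp add: power_one_over field_simps)
      then have "1 * (norm (gh x))\<^sup>2 \<le> 4 ^ DIM('c) * fejer_weight x * (norm (gh x))\<^sup>2" by (intro mult_right_mono) auto
      then show ?thesis using True fejer_weight_nonneg[of x] by (simp add: mult.assoc ennreal_leI flip: ennreal_mult)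
    qed simp
    qed
  qed
  also have "\<dots> = ennreal (4 ^ DIM('c)) * ennreal (\<integral>x. fejer_weight x * (norm (gh x))\<^sup>2 \<partial>lborel)"
  proof -
    have "(\<integral>\<^sup>+x. ennreal (fejer_weight x * (norm (gh x))\<^sup>2) \<partial>lborel) = ennreal (\<integral>x. fejer_weight x * (norm (gh x))\<^sup>2 \<partial>lborel)"
      by (rule nn_integral_eq_integral[OF iwg]) (simp add: fejer_weight_nonneg)
    then show ?thesis by (subst nn_integral_cmult) auto
  qed
  also have "\<dots> \<le> ennreal (4 ^ DIM('c)) * (ennreal ((2 * fejer_const / L) ^ DIM('c)) * ?G2)"
    using main by (rule mult_left_mono) simp
  also have "\<dots> = ennreal ((8 * fejer_const / L) ^ DIM('c)) * ?G2"
  proof -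
    have "4 ^ DIM('c) * (2 * fejer_const / L) ^ DIM('c) = (8 * fejer_const / L) ^ DIM('c)"
      by (simp flip: power_mult_distrib)
    then show ?thesis using L fejer_const_pos by (simp flip: mult.assoc ennreal_mult)
  qed
  finally show ?thesis by (simp add: gh_def)
qed

section \<open>Local estimates from the restriction conjecture\<close>

lemma ennreal_powr_mono:
  assumes "x \<le> y" "a \<ge> 0"
  shows "ennreal_powr x a \<le> ennreal_powr y a"
proof (cases "y = \<infinity>")
  case False
  then have "x < top" "y < top" using assms(1) by (auto simp: less_top[symmetric] top_unique)
  then have "enn2real x powr a \<le> enn2real y powr a"
    using assms by (intro powr_mono2 enn2real_mono) auto
  then show ?thesis using False \<open>x < top\<close> by (auto simp: ennreal_powr_def ennreal_leI)
qed (simp add: ennreal_powr_def)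

lemma ennreal_powr_powr:
  assumes "a \<noteq> 0"
  shows "ennreal_powr (ennreal_powr x (1 / a)) a = x"
  using assms by (cases x) (auto simp: ennreal_powr_def powr_powr)

lemma ennreal_powr_cmult:
  assumes "c > 0"
  shows "ennreal_powr (ennreal c * x) a = ennreal (c powr a) * ennreal_powr x a"
proof (cases x)
  case (real r)
  then show ?thesis using assms by (simp add: ennreal_powr_def powr_mult flip: ennreal_mult)
next
  case top
  then show ?thesis using assms by (simp add: ennreal_powr_def ennreal_mult_top)
qed

lemma unit_cube_eq_cbox: "(unit_cube :: (real^'n) set) = cbox 0 1"
  by (auto simp: unit_cube_def mem_box_cart)

lemma measurable_unit_cube [measurable]: "(unit_cube :: (real^'n) set) \<in> sets borel"
  by (simp add: unit_cube_eq_cbox)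

lemma emeasure_unit_cube: "emeasure lborel (unit_cube :: (real^'n) set) = 1"
proof -
  have "emeasure lborel (cbox 0 (1 :: real^'n)) = ennreal (\<Prod>b\<in>(Basis :: (real^'n) set). 1)"
    by (subst emeasure_lborel_cbox)
       (auto simp: Basis_vec_def inner_axis intro!: prod.neutral arg_cong[where f = ennreal])
  then show ?thesis by (simp add: unit_cube_eq_cbox)
qed

lemma borel_measurable_paraboloid_point [measurable]: "paraboloid_point v \<in> borel_measurable borel"
  unfolding paraboloid_point_def by (intro borel_measurable_continuous_onI continuous_intros)

text \<open>
  The extension operator on Borel functions, over Borel-Lebesgue measure instead of the restricted
  complete measure.
\<close>

definition extension :: "real^'n \<Rightarrow> (real^'n \<Rightarrow> complex) \<Rightarrow> (real^'n) \<times> real \<Rightarrow> complex" where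
  "extension v f x = (\<integral>\<xi>. f \<xi> * e (paraboloid_point v \<xi> \<bullet> x) \<partial>lborel)"

lemma borel_measurable_extension [measurable]:
  assumes [measurable]: "f \<in> borel_measurable borel"
  shows "extension v f \<in> borel_measurable borel"
  unfolding extension_def[abs_def] by measurable

lemma extension_op_eq:
  fixes f :: "real^'n \<Rightarrow> complex"
  assumes [measurable]: "f \<in> borel_measurable borel" and "\<And>\<xi>. \<xi> \<notin> unit_cube \<Longrightarrow> f \<xi> = 0"
  shows "extension_op v f = extension v f"
proof
  fix x
  have "extension_op v f x = (LINT \<xi>|lebesgue. indicator unit_cube \<xi> *\<^sub>R (f \<xi> * e (x \<bullet> paraboloid_point v \<xi>)))"
    unfolding extension_op_def by (subst integral_restrict_space) auto
  also have "\<dots> = (LINT \<xi>|lebesgue. f \<xi> * e (paraboloid_point v \<xi> \<bullet> x))"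
    using assms(2) by (intro Bochner_Integration.integral_cong) (auto simp: indicator_def inner_commute)
  also have "\<dots> = extension v f x"
    unfolding extension_def by (rule integral_completion) measurable
  finally show "extension_op v f x = extension v f x" .
qed

text \<open>
  The restriction estimate in the form in which it is used: for functions that lie in every \<open>L^q\<close> because
  they are bounded, and with powers of norms in the place of norms.
\<close>

definition bounded_extension :: "real \<Rightarrow> real^'n \<Rightarrow> real \<Rightarrow> bool" where
  "bounded_extension q v C \<longleftrightarrow> (\<forall>f B. f \<in> borel_measurable borel \<longrightarrow> (\<forall>\<xi>. \<xi> \<notin> unit_cube \<longrightarrow> f \<xi> = 0) \<longrightarrow>
     (\<forall>\<xi>. norm (f \<xi>) \<le> B) \<longrightarrow> Lp_pow q (extension v f) \<le> ennreal C * Lp_pow q f)"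

lemma restriction_conjecture_imp_bound:
  fixes v :: "real^'n"
  assumes rc: "restriction_conjecture v" and q: "q > 2 + 2 / real CARD('n)"
  obtains C where "C > 0" "bounded_extension q v C"
proof -
  have q0: "q > 0" using q by (smt (verit) divide_nonneg_nonneg of_nat_0_le_iff)
  obtain C where C: "\<And>f. f \<in> Lp_space (lebesgue_on unit_cube) q \<Longrightarrow>
          Lp_norm lebesgue q (extension_op v f) \<le> ennreal C * Lp_norm (lebesgue_on unit_cube) q f"
    using rc q unfolding restriction_conjecture_def by blast
  define C' where "C' = max C 1"
  have "(\<integral>\<^sup>+x. ennreal (norm (extension v f x) powr q) \<partial>lborel)
         \<le> ennreal (C' powr q) * (\<integral>\<^sup>+\<xi>. ennreal (norm (f \<xi>) powr q) \<partial>lborel)"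
    if [measurable]: "f \<in> borel_measurable borel" and supp: "\<And>\<xi>. \<xi> \<notin> unit_cube \<Longrightarrow> f \<xi> = 0" and B: "\<And>\<xi>. norm (f \<xi>) \<le> B"
    for f B
  proof -
    let ?Nf = "\<integral>\<^sup>+\<xi>. ennreal (norm (f \<xi>) powr q) \<partial>lborel"
    have eqf: "(\<integral>\<^sup>+\<xi>. ennreal (norm (f \<xi>) powr q) \<partial>lebesgue_on unit_cube) = ?Nf"
    proof -
      have "(\<integral>\<^sup>+\<xi>. ennreal (norm (f \<xi>) powr q) \<partial>lebesgue_on unit_cube) = (\<integral>\<^sup>+\<xi>. ennreal (norm (f \<xi>) powr q) * indicator unit_cube \<xi> \<partial>lebesgue)"
        by (rule nn_integral_restrict_space) auto
      also have "\<dots> = (\<integral>\<^sup>+\<xi>. ennreal (norm (f \<xi>) powr q) \<partial>lebesgue)"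
        using supp by (intro nn_integral_cong) (auto simp: indicator_def)
      finally show ?thesis by (simp add: nn_integral_completion)
    qed
    have "?Nf \<le> (\<integral>\<^sup>+\<xi>. ennreal (B powr q) * indicator (unit_cube :: (real^'n) set) \<xi> \<partial>lborel)"
      using supp B q0 by (intro nn_integral_mono) (auto simp: indicator_def intro!: ennreal_leI powr_mono2)
    also have "\<dots> = ennreal (B powr q)" by (simp add: nn_integral_cmult emeasure_unit_cube)
    finally have fin: "?Nf < \<infinity>" by (simp add: order_le_less_trans)
    then have "f \<in> Lp_space (lebesgue_on unit_cube) q"
      unfolding Lp_space_def Lp_norm_def
      by (auto simp: ennreal_powr_def eqf intro!: measurable_restrict_space1 measurable_completion)
    from C[OF this] have "Lp_norm lebesgue q (extension v f) \<le> ennreal C * ennreal_powr ?Nf (1 / q)"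
      using extension_op_eq[of f v] supp by (simp add: Lp_norm_def eqf)
    also have "\<dots> \<le> ennreal C' * ennreal_powr ?Nf (1 / q)"
      by (intro mult_right_mono ennreal_leI) (auto simp: C'_def)
    finally have "ennreal_powr (Lp_norm lebesgue q (extension v f)) q \<le> ennreal_powr (ennreal C' * ennreal_powr ?Nf (1 / q)) q"
      using q0 by (intro ennreal_powr_mono) auto
    then show ?thesis
      using q0 by (simp add: Lp_norm_def ennreal_powr_powr ennreal_powr_cmult C'_def nn_integral_completion)
  qed
  then show thesis
    by (intro that[of "C' powr q"]) (auto simp: C'_def bounded_extension_def Lp_pow_def)
qed

lemma nn_integral_lborel_scale:
  fixes f :: "'a::euclidean_space \<Rightarrow> ennreal"
  assumes [measurable]: "f \<in> borel_measurable borel" and c: "c > 0"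
  shows "(\<integral>\<^sup>+x. f (c *\<^sub>R x) \<partial>lborel) = ennreal ((1 / c) ^ DIM('a)) * (\<integral>\<^sup>+x. f x \<partial>lborel)"
proof -
  have "(\<integral>\<^sup>+x. f x \<partial>lborel) = (\<integral>\<^sup>+x. f x \<partial>density (distr lborel borel (\<lambda>x. 0 + c *\<^sub>R x)) (\<lambda>_. \<bar>c\<bar> ^ DIM('a)))"
    using lborel_affine[of c "0::'a"] c by simp
  also have "\<dots> = ennreal (c ^ DIM('a)) * (\<integral>\<^sup>+x. f (c *\<^sub>R x) \<partial>lborel)"
    using c by (simp add: nn_integral_density nn_integral_distr nn_integral_cmult)
  finally have "ennreal ((1 / c) ^ DIM('a)) * (\<integral>\<^sup>+x. f x \<partial>lborel)
    = ennreal ((1 / c) ^ DIM('a) * c ^ DIM('a)) * (\<integral>\<^sup>+x. f (c *\<^sub>R x) \<partial>lborel)"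
    using c by (simp add: ennreal_mult mult.assoc)
  also have "(1 / c) ^ DIM('a) * c ^ DIM('a) = 1" using c by (simp add: power_one_over)
  finally show ?thesis by simp
qed

lemma unit_box_Pair: "(x, s) \<in> unit_box \<longleftrightarrow> x \<in> unit_box \<and> s \<in> unit_box"
  unfolding unit_box_def Basis_prod_def by (simp add: ball_Un)

text \<open>
  The last variable contributes only a modulation of \<open>f\<close> on each slice, where the local Plancherel bound
  applies.
\<close>

lemma extension_local_L2:
  fixes v :: "real^'n" and f :: "real^'n \<Rightarrow> complex"
  assumes f: "integrable lborel f" and L: "L > 0"
  shows "(\<integral>\<^sup>+z. indicator unit_box z * ennreal ((norm (extension v f (L *\<^sub>R z)))\<^sup>2) \<partial>lborel)
     \<le> ennreal (2 * (8 * fejer_const / L) ^ CARD('n)) * (\<integral>\<^sup>+\<xi>. ennreal ((norm (f \<xi>))\<^sup>2) \<partial>lborel)"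
proof -
  have [measurable]: "f \<in> borel_measurable borel" using f by auto
  let ?Q = "\<lambda>\<xi>. \<Sum>i\<in>UNIV. v $ i * (\<xi> $ i)\<^sup>2"
  let ?F2 = "\<integral>\<^sup>+\<xi>. ennreal ((norm (f \<xi>))\<^sup>2) \<partial>lborel"
  have Q [measurable]: "?Q \<in> borel_measurable borel"
    by (intro borel_measurable_continuous_onI continuous_intros)
  have slice: "(\<integral>\<^sup>+x. indicator unit_box x * ennreal ((norm (extension v f (L *\<^sub>R (x, s))))\<^sup>2) \<partial>lborel)
     \<le> ennreal ((8 * fejer_const / L) ^ CARD('n)) * ?F2" for s
  proof -
    have g: "integrable lborel (\<lambda>\<xi>. f \<xi> * e (L * s * ?Q \<xi>))"
      by (intro integrable_mult_e f) measurable
    have "extension v f (L *\<^sub>R (x, s)) = (\<integral>\<xi>. (f \<xi> * e (L * s * ?Q \<xi>)) * e ((L *\<^sub>R \<xi>) \<bullet> x) \<partial>lborel)" for x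
      unfolding extension_def
      by (intro Bochner_Integration.integral_cong) (simp_all add: paraboloid_point_def e_add mult_ac)
    then show ?thesis
      using local_bessel[OF g L] by (simp add: norm_mult)
  qed
  have "(\<integral>\<^sup>+z. indicator unit_box z * ennreal ((norm (extension v f (L *\<^sub>R z)))\<^sup>2) \<partial>lborel)
     = (\<integral>\<^sup>+s. (\<integral>\<^sup>+x. indicator unit_box (x, s) * ennreal ((norm (extension v f (L *\<^sub>R (x, s))))\<^sup>2) \<partial>lborel) \<partial>lborel)"
  proof -
    have [measurable]: "(\<lambda>z. indicator unit_box z * ennreal ((norm (extension v f (L *\<^sub>R z)))\<^sup>2)) \<in> borel_measurable (lborel \<Otimes>\<^sub>M lborel)"
      unfolding lborel_prod by measurable
    show ?thesis
      unfolding lborel_prod[symmetric] by (subst lborel_pair.nn_integral_snd[symmetric]) auto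
  qed
  also have "\<dots> = (\<integral>\<^sup>+s. indicator unit_box s * (\<integral>\<^sup>+x. indicator unit_box x * ennreal ((norm (extension v f (L *\<^sub>R (x, s))))\<^sup>2) \<partial>lborel) \<partial>lborel)"
    by (intro nn_integral_cong) (auto simp: unit_box_Pair indicator_def)
  also have "\<dots> \<le> (\<integral>\<^sup>+s. indicator unit_box s * (ennreal ((8 * fejer_const / L) ^ CARD('n)) * ?F2) \<partial>(lborel :: real measure))"
    using slice by (intro nn_integral_mono mult_left_mono) auto
  also have "\<dots> = emeasure lborel (unit_box :: real set) * (ennreal ((8 * fejer_const / L) ^ CARD('n)) * ?F2)"
    by (subst nn_integral_multc) auto
  also have "\<dots> = ennreal (2 * (8 * fejer_const / L) ^ CARD('n)) * ?F2"
    using fejer_const_pos L by (simp add: emeasure_unit_box ennreal_mult mult.assoc)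
  finally show ?thesis .
qed

lemma sum_cell_transform_eq_extension:
  fixes v :: "real^'n" and a :: "'i \<Rightarrow> complex"
  assumes fin: "finite I" and T: "\<And>k. k \<in> I \<Longrightarrow> T k \<in> sets borel" "\<And>k. k \<in> I \<Longrightarrow> emeasure lborel (T k) < \<infinity>"
  shows "(\<Sum>k\<in>I. a k * cell_transform (\<lambda>\<xi>. L *\<^sub>R paraboloid_point v \<xi>) (T k) (z - w))
     = extension v (\<lambda>\<xi>. \<Sum>k\<in>I. a k * indicator (T k) \<xi> * e (- (L * (paraboloid_point v \<xi> \<bullet> w)))) (L *\<^sub>R z)"
proof -
  have "extension v (\<lambda>\<xi>. \<Sum>k\<in>I. a k * indicator (T k) \<xi> * e (- (L * (paraboloid_point v \<xi> \<bullet> w)))) (L *\<^sub>R z)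
    = (\<integral>\<xi>. (\<Sum>k\<in>I. a k * (indicator (T k) \<xi> * e ((L *\<^sub>R paraboloid_point v \<xi>) \<bullet> (z - w)))) \<partial>lborel)"
    unfolding extension_def
  proof (intro Bochner_Integration.integral_cong refl)
    fix \<xi>
    have "e ((L *\<^sub>R paraboloid_point v \<xi>) \<bullet> (z - w)) = e (- (L * (paraboloid_point v \<xi> \<bullet> w))) * e (paraboloid_point v \<xi> \<bullet> (L *\<^sub>R z))"
      by (simp add: inner_diff_right algebra_simps flip: e_add)
    then show "(\<Sum>k\<in>I. a k * indicator (T k) \<xi> * e (- (L * (paraboloid_point v \<xi> \<bullet> w)))) * e (paraboloid_point v \<xi> \<bullet> (L *\<^sub>R z))
      = (\<Sum>k\<in>I. a k * (indicator (T k) \<xi> * e ((L *\<^sub>R paraboloid_point v \<xi>) \<bullet> (z - w))))"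
      by (simp only: sum_distrib_right mult.assoc)
  qed
  also have "\<dots> = (\<Sum>k\<in>I. (\<integral>\<xi>. a k * (indicator (T k) \<xi> * e ((L *\<^sub>R paraboloid_point v \<xi>) \<bullet> (z - w))) \<partial>lborel))"
    using T by (intro Bochner_Integration.integral_sum integrable_mult_right integrable_mult_e integrable_indicator_complex) auto
  finally show ?thesis by (simp add: cell_transform_def)
qed

definition equal_pieces :: "('i \<Rightarrow> (real^'n) set) \<Rightarrow> 'i set \<Rightarrow> real \<Rightarrow> bool" where
  "equal_pieces T I \<mu> \<longleftrightarrow> (\<forall>k\<in>I. T k \<in> sets borel \<and> T k \<subseteq> unit_cube \<and> emeasure lborel (T k) = ennreal \<mu>) \<and>
     disjoint_family_on T I \<and> finite I \<and> \<mu> > 0"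

lemma equal_piecesD:
  assumes "equal_pieces T I \<mu>"
  shows "\<And>k. k \<in> I \<Longrightarrow> T k \<in> sets borel" "\<And>k. k \<in> I \<Longrightarrow> T k \<subseteq> unit_cube"
    "\<And>k. k \<in> I \<Longrightarrow> emeasure lborel (T k) = ennreal \<mu>" "disjoint_family_on T I" "finite I" "\<mu> > 0"
  using assms by (auto simp: equal_pieces_def)

lemma equal_pieces_subset: "equal_pieces T I \<mu> \<Longrightarrow> H \<subseteq> I \<Longrightarrow> equal_pieces T H \<mu>"
  unfolding equal_pieces_def by (meson disjoint_family_on_mono finite_subset subsetD)

definition cell_integral :: "real \<Rightarrow> real \<Rightarrow> real^'n \<Rightarrow> ('i \<Rightarrow> (real^'n) set) \<Rightarrow> ('i \<Rightarrow> complex) \<Rightarrow> (real^'n) \<times> real \<Rightarrow> 'i set \<Rightarrow> ennreal" where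
  "cell_integral p L v T a w I = (\<integral>\<^sup>+z. indicator unit_box z *
     ennreal (norm (\<Sum>k\<in>I. a k * cell_transform (\<lambda>\<xi>. L *\<^sub>R paraboloid_point v \<xi>) (T k) (z - w)) powr p) \<partial>lborel)"

text \<open>
  The sum is the extension of a function of modulus at most \<open>h\<close> on the union of the pieces. The bounds
  \<open>h powr r * \<mu> * card I\<close> for the integral of its power \<open>r\<close> interpolate without loss between the local
  Plancherel bound (\<open>r = 2\<close>) and the restriction estimate (\<open>r = q\<close>). The power of \<open>L\<close> is \<open>- n\<close> in the former
  and \<open>- n - 1\<close> in the latter, where it comes from the dilation by \<open>L\<close> in dimension \<open>n + 1\<close>.
\<close>

lemma level_estimate:
  fixes v :: "real^'n" and a :: "'i \<Rightarrow> complex"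
  assumes C: "C > 0"
    and ext: "bounded_extension q v C"
    and p: "2 \<le> p" "p < q" and b: "b = (p - 2) / (q - 2)"
    and L: "L > 0" and h: "h > 0" and ne: "I \<noteq> {}"
    and T: "equal_pieces T I \<mu>"
    and a: "\<And>k. k \<in> I \<Longrightarrow> norm (a k) \<le> h"
  shows "cell_integral p L v T a w I
    \<le> ennreal ((2 * (8 * fejer_const) ^ CARD('n)) powr (1 - b) * C powr b * L powr (- real CARD('n) - b) * (h powr p * \<mu> * card I))"
proof -
  let ?n = "real CARD('n)"
  note T = equal_piecesD[OF T]
  note \<mu> = T(6)
  have I: "finite I" "I \<noteq> {}" using T(5) ne by auto
  define f where "f \<xi> = (\<Sum>k\<in>I. a k * indicator (T k) \<xi> * e (- (L * (paraboloid_point v \<xi> \<bullet> w))))" for \<xi>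
  define U where "U = (\<Union>k\<in>I. T k)"
  define m where "m = \<mu> * card I"
  have m: "m > 0" using \<mu> I by (simp add: m_def card_gt_0_iff)
  have U [measurable]: "U \<in> sets borel" using I T by (auto simp: U_def)
  have mU: "emeasure lborel U = ennreal m"
  proof -
    have "emeasure lborel U = (\<Sum>k\<in>I. emeasure lborel (T k))"
      unfolding U_def using I T by (intro sum_emeasure[symmetric]) auto
    also have "\<dots> = ennreal m" using T \<mu> by (simp add: m_def ennreal_of_nat_eq_real_of_nat mult.commute flip: ennreal_mult)
    finally show ?thesis .
  qed
  have f [measurable]: "f \<in> borel_measurable borel"
    unfolding f_def[abs_def]
  proof (intro borel_measurable_sum)
    fix k assume "k \<in> I"
    then have [measurable]: "T k \<in> sets borel" by (rule T(1))
    show "(\<lambda>\<xi>. a k * indicator (T k) \<xi> * e (- (L * (paraboloid_point v \<xi> \<bullet> w)))) \<in> borel_measurable borel"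
      by measurable
  qed
  have f_le: "norm (f \<xi>) \<le> h * indicator U \<xi>" for \<xi>
  proof (cases "\<xi> \<in> U")
    case True
    then obtain k where k: "k \<in> I" "\<xi> \<in> T k" by (auto simp: U_def)
    have "(\<Sum>j\<in>I. a j * indicator (T j) \<xi> * e (- (L * (paraboloid_point v \<xi> \<bullet> w)))) = (\<Sum>j\<in>{k}. a j * indicator (T j) \<xi> * e (- (L * (paraboloid_point v \<xi> \<bullet> w))))"
    proof (rule sum.mono_neutral_right)
      show "\<forall>i\<in>I - {k}. a i * indicator (T i) \<xi> * e (- (L * (paraboloid_point v \<xi> \<bullet> w))) = 0"
      proof
        fix i assume "i \<in> I - {k}"
        then have "T i \<inter> T k = {}" using T(4) k by (auto simp: disjoint_family_on_def)
        then show "a i * indicator (T i) \<xi> * e (- (L * (paraboloid_point v \<xi> \<bullet> w))) = 0" using k by (auto simp: indicator_def)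
      qed
    qed (use I k in auto)
    then show ?thesis using a k True by (simp add: f_def norm_mult)
  next
    case False
    then have "f \<xi> = 0" unfolding f_def U_def by (intro sum.neutral) (auto simp: indicator_def)
    then show ?thesis using False by simp
  qed
  have f_le': "norm (f \<xi>) \<le> h" for \<xi> using f_le[of \<xi>] h by (cases "\<xi> \<in> U") auto
  have powint: "(\<integral>\<^sup>+\<xi>. ennreal (norm (f \<xi>) powr r) \<partial>lborel) \<le> ennreal (h powr r * m)" if r: "r > 0" for r
  proof -
    have "(\<integral>\<^sup>+\<xi>. ennreal (norm (f \<xi>) powr r) \<partial>lborel) \<le> (\<integral>\<^sup>+\<xi>. ennreal (h powr r) * indicator U \<xi> \<partial>lborel)"
    proof (rule nn_integral_mono)
      fix \<xi>
      show "ennreal (norm (f \<xi>) powr r) \<le> ennreal (h powr r) * indicator U \<xi>"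
        using f_le[of \<xi>] r by (cases "\<xi> \<in> U") (auto intro!: ennreal_leI powr_mono2)
    qed
    also have "\<dots> = ennreal (h powr r * m)" using m by (simp add: nn_integral_cmult mU ennreal_mult)
    finally show ?thesis .
  qed
  have supp: "f \<xi> = 0" if "\<xi> \<notin> unit_cube" for \<xi>
  proof -
    have "\<xi> \<notin> U" using that T(2) by (auto simp: U_def)
    then show ?thesis using f_le[of \<xi>] by simp
  qed
  have fint: "integrable lborel f"
  proof (rule Bochner_Integration.integrable_bound)
    show "integrable lborel (\<lambda>\<xi>. h * indicator U \<xi>)" using mU by (intro integrable_mult_right integrable_real_indicator) auto
    show "AE \<xi> in lborel. norm (f \<xi>) \<le> norm (h * indicator U \<xi>)" using f_le h by (simp add: abs_mult)
  qed measurable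
  have extf: "(\<integral>\<^sup>+x. ennreal (norm (extension v f x) powr q) \<partial>lborel) \<le> ennreal C * (\<integral>\<^sup>+\<xi>. ennreal (norm (f \<xi>) powr q) \<partial>lborel)"
    using ext f supp f_le' unfolding bounded_extension_def Lp_pow_def by blast
  define g where "g z = indicator unit_box z * norm (extension v f (L *\<^sub>R z))" for z :: "(real^'n) \<times> real"
  have [measurable]: "g \<in> borel_measurable borel" unfolding g_def[abs_def] by measurable
  have gp: "ennreal (g z powr r) = indicator unit_box z * ennreal (norm (extension v f (L *\<^sub>R z)) powr r)" for z r
    by (simp add: g_def indicator_def)
  define X where "X = 2 * (8 * fejer_const / L) ^ CARD('n) * (h powr 2 * m)"
  define Y where "Y = C * (1 / L) ^ (CARD('n) + 1) * (h powr q * m)"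
  have "(\<integral>\<^sup>+z. ennreal (g z powr p) \<partial>lborel) \<le> ennreal (X powr (1 - b) * Y powr b)"
  proof (rule nn_integral_interpolation)
    have "(\<integral>\<^sup>+z. ennreal (g z powr 2) \<partial>lborel) = (\<integral>\<^sup>+z. indicator unit_box z * ennreal ((norm (extension v f (L *\<^sub>R z)))\<^sup>2) \<partial>lborel)"
      unfolding gp by simp
    also have "\<dots> \<le> ennreal (2 * (8 * fejer_const / L) ^ CARD('n)) * (\<integral>\<^sup>+\<xi>. ennreal ((norm (f \<xi>))\<^sup>2) \<partial>lborel)"
      by (rule extension_local_L2[OF fint L])
    also have "\<dots> \<le> ennreal (2 * (8 * fejer_const / L) ^ CARD('n)) * ennreal (h powr 2 * m)"
      using powint[of 2] by (intro mult_left_mono) auto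
    also have "\<dots> = ennreal X" using L fejer_const_pos m by (simp add: X_def flip: ennreal_mult)
    finally show "(\<integral>\<^sup>+z. ennreal (g z powr 2) \<partial>lborel) \<le> ennreal X" .
    have "(\<integral>\<^sup>+z. ennreal (g z powr q) \<partial>lborel) \<le> (\<integral>\<^sup>+z. ennreal (norm (extension v f (L *\<^sub>R z)) powr q) \<partial>lborel)"
      unfolding gp by (intro nn_integral_mono) (auto simp: indicator_def)
    also have "\<dots> = ennreal ((1 / L) ^ (CARD('n) + 1)) * (\<integral>\<^sup>+z. ennreal (norm (extension v f z) powr q) \<partial>lborel)"
      using L by (subst nn_integral_lborel_scale[where f = "\<lambda>z. ennreal (norm (extension v f z) powr q)"]) auto
    also have "\<dots> \<le> ennreal ((1 / L) ^ (CARD('n) + 1)) * (ennreal C * ennreal (h powr q * m))"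
      using p by (intro mult_left_mono order_trans[OF extf] powint) auto
    also have "\<dots> = ennreal Y" using L C m by (simp add: Y_def mult_ac flip: ennreal_mult)
    finally show "(\<integral>\<^sup>+z. ennreal (g z powr q) \<partial>lborel) \<le> ennreal Y" .
    show "X > 0" "Y > 0" using L C m h fejer_const_pos by (auto simp: X_def Y_def)
    show "1 - b \<ge> 0" "b \<ge> 0" "1 - b + b = 1" using p by (auto simp: b)
    have "b * (q - 2) = p - 2" using p by (simp add: b)
    then show "p = 2 * (1 - b) + q * b" by (simp add: algebra_simps)
    show "0 \<le> g x" for x by (simp add: g_def)
  qed measurable
  also have "X powr (1 - b) * Y powr b = (2 * (8 * fejer_const) ^ CARD('n)) powr (1 - b) * C powr b * L powr (- ?n - b) * (h powr p * m)"
  proof -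
    have X: "X = (2 * (8 * fejer_const) ^ CARD('n)) * L powr (- ?n) * (h powr 2 * m)"
      using L by (simp add: X_def powr_minus powr_realpow divide_inverse power_mult_distrib power_inverse)
    have Y: "Y = C * L powr (- (?n + 1)) * (h powr q * m)"
    proof -
      have "L powr (- (?n + 1)) = (1 / L) ^ (CARD('n) + 1)"
      proof -
        have "L powr (- (?n + 1)) = inverse (L powr (real (CARD('n) + 1)))"
          by (simp add: add.commute flip: powr_minus)
        also have "\<dots> = (1 / L) ^ (CARD('n) + 1)"
          using L by (simp only: powr_realpow power_one_over inverse_eq_divide)
        finally show ?thesis .
      qed
      then show ?thesis by (simp add: Y_def)
    qed
    have c0: "2 * (8 * fejer_const) ^ CARD('n) > 0" using fejer_const_pos by simp
    have "X powr (1 - b) = (2 * (8 * fejer_const) ^ CARD('n)) powr (1 - b) * L powr (- ?n * (1 - b)) * (h powr (2 * (1 - b)) * m powr (1 - b))"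
      unfolding X using c0 L h m by (simp add: powr_mult powr_powr del: powr_numeral)
    moreover have "Y powr b = C powr b * L powr (- (?n + 1) * b) * (h powr (q * b) * m powr b)"
      unfolding Y using C L h m by (simp add: powr_mult powr_powr)
    moreover have "L powr (- ?n * (1 - b)) * L powr (- (?n + 1) * b) = L powr (- ?n - b)"
      unfolding powr_add[symmetric] by (rule arg_cong[where f = "\<lambda>x. L powr x"]) (simp add: algebra_simps)
    moreover have "h powr (2 * (1 - b)) * h powr (q * b) = h powr p"
    proof -
      have "b * (q - 2) = p - 2" using p by (simp add: b)
      then have "2 * (1 - b) + q * b = p" by (simp add: algebra_simps)
      then show ?thesis by (simp flip: powr_add)
    qed
    moreover have "m powr (1 - b) * m powr b = m" using m by (simp flip: powr_add)
    ultimately show ?thesis by (smt (verit, ccfv_threshold) mult.assoc mult.commute)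
  qed
  also have "(\<integral>\<^sup>+z. ennreal (g z powr p) \<partial>lborel) = cell_integral p L v T a w I"
  proof -
    have "(\<Sum>k\<in>I. a k * cell_transform (\<lambda>\<xi>. L *\<^sub>R paraboloid_point v \<xi>) (T k) (z - w)) = extension v f (L *\<^sub>R z)" for z
      unfolding f_def using T by (intro sum_cell_transform_eq_extension[OF I(1)]) auto
    then show ?thesis unfolding gp cell_integral_def by simp
  qed
  finally show ?thesis by (simp add: m_def mult.assoc)
qed

lemma cell_integral_trivial:
  fixes v :: "real^'n" and a :: "'i \<Rightarrow> complex"
  assumes p: "p > 1" and h: "h \<ge> 0"
    and T: "equal_pieces T I \<mu>"
    and a: "\<And>k. k \<in> I \<Longrightarrow> norm (a k) \<le> h"
  shows "cell_integral p L v T a w I \<le> ennreal (2 ^ (CARD('n) + 1) * h powr p)"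
proof -
  note T = equal_piecesD[OF T]
  note \<mu> = T(6) and I = T(5)
  have card: "\<mu> * card I \<le> 1"
  proof -
    have "ennreal (\<mu> * card I) = (\<Sum>k\<in>I. emeasure lborel (T k))"
      using T \<mu> by (simp add: ennreal_of_nat_eq_real_of_nat mult.commute flip: ennreal_mult)
    also have "\<dots> = emeasure lborel (\<Union>k\<in>I. T k)" using I T by (intro sum_emeasure) auto
    also have "\<dots> \<le> emeasure lborel (unit_cube :: (real^'n) set)" using T by (intro emeasure_mono) auto
    finally show ?thesis by (simp add: emeasure_unit_cube)
  qed
  have "cell_integral p L v T a w I \<le> (\<integral>\<^sup>+z. indicator unit_box z * ennreal (h powr p) \<partial>(lborel :: ((real^'n) \<times> real) measure))"
    unfolding cell_integral_def
  proof (intro nn_integral_mono mult_left_mono ennreal_leI powr_mono2)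
    fix z :: "(real^'n) \<times> real"
    have "norm (\<Sum>k\<in>I. a k * cell_transform (\<lambda>\<xi>. L *\<^sub>R paraboloid_point v \<xi>) (T k) (z - w)) \<le> (\<Sum>k\<in>I. h * \<mu>)"
    proof (rule sum_norm_le)
      fix k assume k: "k \<in> I"
      have "norm (cell_transform (\<lambda>\<xi>. L *\<^sub>R paraboloid_point v \<xi>) (T k) (z - w)) \<le> \<mu>"
        using norm_cell_transform_le[of "T k"] T(1,3)[OF k] \<mu> by (simp add: measure_def)
      then show "norm (a k * cell_transform (\<lambda>\<xi>. L *\<^sub>R paraboloid_point v \<xi>) (T k) (z - w)) \<le> h * \<mu>"
        using a[OF k] h by (auto simp: norm_mult intro!: mult_mono)
    qed
    also have "\<dots> = h * (\<mu> * card I)" by simp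
    also have "\<dots> \<le> h" using card h by (rule mult_left_le)
    finally show "norm (\<Sum>k\<in>I. a k * cell_transform (\<lambda>\<xi>. L *\<^sub>R paraboloid_point v \<xi>) (T k) (z - w)) \<le> h" .
  qed (use p in auto)
  also have "\<dots> = ennreal (2 ^ (CARD('n) + 1) * h powr p)"
    by (subst nn_integral_multc) (auto simp: emeasure_unit_box ennreal_mult)
  finally show ?thesis .
qed

lemma powr_add_le:
  fixes x y :: real
  assumes "x \<ge> 0" "y \<ge> 0" "p > 1"
  shows "(x + y) powr p \<le> 2 powr (p - 1) * (x powr p + y powr p)"
  using sum_powr_le[of "{True, False}" "\<lambda>b. if b then x else y" p] assms by auto

lemma cell_integral_union:
  fixes v :: "real^'n" and a :: "'i \<Rightarrow> complex"
  assumes p: "p > 1" and I: "finite I" "finite I'" "I \<inter> I' = {}"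
    and T: "\<And>k. k \<in> I \<union> I' \<Longrightarrow> T k \<in> sets borel"
  shows "cell_integral p L v T a w (I \<union> I') \<le> ennreal (2 powr (p - 1)) * (cell_integral p L v T a w I + cell_integral p L v T a w I')"
proof -
  let ?S = "\<lambda>I z. \<Sum>k\<in>I. a k * cell_transform (\<lambda>\<xi>. L *\<^sub>R paraboloid_point v \<xi>) (T k) (z - w)"
  have meas: "(\<lambda>z. indicator unit_box z * ennreal (norm (?S H z) powr p)) \<in> borel_measurable borel" if "H \<subseteq> I \<union> I'" for H
  proof -
    have "(\<lambda>z. ?S H z) \<in> borel_measurable borel"
    proof (intro borel_measurable_sum)
      fix k assume "k \<in> H"
      then have [measurable]: "T k \<in> sets borel" using T that by auto
      show "(\<lambda>z. a k * cell_transform (\<lambda>\<xi>. L *\<^sub>R paraboloid_point v \<xi>) (T k) (z - w)) \<in> borel_measurable borel" by measurable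
    qed
    then show ?thesis by measurable
  qed
  have "cell_integral p L v T a w (I \<union> I') \<le> (\<integral>\<^sup>+z. ennreal (2 powr (p - 1)) * (indicator unit_box z * ennreal (norm (?S I z) powr p) + indicator unit_box z * ennreal (norm (?S I' z) powr p)) \<partial>lborel)"
    unfolding cell_integral_def
  proof (rule nn_integral_mono)
    fix z
    have "norm (?S (I \<union> I') z) powr p \<le> (norm (?S I z) + norm (?S I' z)) powr p"
      using p I by (intro powr_mono2) (auto simp: sum.union_disjoint norm_triangle_ineq)
    also have "\<dots> \<le> 2 powr (p - 1) * (norm (?S I z) powr p + norm (?S I' z) powr p)"
      using p by (intro powr_add_le) auto
    finally have "ennreal (norm (?S (I \<union> I') z) powr p) \<le> ennreal (2 powr (p - 1)) * (ennreal (norm (?S I z) powr p) + ennreal (norm (?S I' z) powr p))"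
      by (simp flip: ennreal_mult ennreal_plus)
    then show "indicator unit_box z * ennreal (norm (?S (I \<union> I') z) powr p) \<le> ennreal (2 powr (p - 1)) * (indicator unit_box z * ennreal (norm (?S I z) powr p) + indicator unit_box z * ennreal (norm (?S I' z) powr p))"
      by (cases "z \<in> unit_box") auto
  qed
  also have "\<dots> = ennreal (2 powr (p - 1)) * (cell_integral p L v T a w I + cell_integral p L v T a w I')"
  proof -
    define f where "f H z = indicator unit_box z * ennreal (norm (?S H z) powr p)" for H z
    have [measurable]: "f I \<in> borel_measurable borel" "f I' \<in> borel_measurable borel"
      unfolding f_def[abs_def] by (intro meas; simp)+
    have "(\<integral>\<^sup>+z. ennreal (2 powr (p - 1)) * (f I z + f I' z) \<partial>lborel) = ennreal (2 powr (p - 1)) * (nn_integral lborel (f I) + nn_integral lborel (f I'))"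
      by (subst nn_integral_cmult, measurable, subst nn_integral_add, measurable)
    then show ?thesis unfolding f_def[abs_def] cell_integral_def .
  qed
  finally show ?thesis .
qed

text \<open>
  Square root cancellation for cap waves at scale \<open>L\<close>, for all exponents up to the critical one and
  arbitrary coefficients. The coefficients are sorted into levels by their size, in ratio \<open>L powr \<delta>\<close>:
  within one level the previous lemma loses at most a factor \<open>L powr (\<delta> * p)\<close>, and coefficients smaller than
  the largest one by a factor \<open>L powr (- n)\<close> contribute negligibly, so that the number of levels is bounded
  independently of \<open>L\<close>. The conjecture is applied at an exponent \<open>q\<close> slightly above the critical one, and
  half of \<open>\<epsilon>\<close> pays for this, the other half for the levels. The hypothesis on \<open>\<mu>\<close> says that the pieces are not
  much smaller than \<open>1 / L\<close> cubes.
\<close>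

theorem local_estimate:
  fixes v :: "real^'n"
  assumes rc: "restriction_conjecture v" and p: "2 \<le> p" "p \<le> 2 + 2 / real CARD('n)" and \<epsilon>: "\<epsilon> > 0" and B: "B > 0"
  obtains C where "C > 0"
    "\<And>L (I :: 'i set) T \<mu> a w. \<lbrakk>L \<ge> 1; equal_pieces T I \<mu>; L powr (- real CARD('n)) \<le> B * \<mu>\<rbrakk> \<Longrightarrow>
       cell_integral p L v T a w I \<le> ennreal (C * L powr (\<epsilon> - real CARD('n) * p / 2) * \<mu>) * (\<Sum>k\<in>I. ennreal (norm (a k) powr p))"
proof -
  let ?n = "real CARD('n)"
  have n: "?n > 0" by simp
  \<comment> \<open>With this distance of q from the critical exponent, b falls short of n (p - 2) / 2 by at most \<epsilon> / 2.\<close>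
  define \<eta> where "\<eta> = \<epsilon> / ?n"
  define q where "q = 2 + 2 / ?n + \<eta>"
  have \<eta>: "\<eta> > 0" using \<epsilon> by (simp add: \<eta>_def)
  have q: "q > 2 + 2 / ?n" "p < q" using \<eta> p by (auto simp: q_def)
  define b where "b = (p - 2) / (q - 2)"
  have b_ge: "- ?n - b \<le> \<epsilon> / 2 - ?n * p / 2"
  proof -
    have q2: "q - 2 > 0" using p q by simp
    have e: "?n / 2 * (q - 2) - 1 = ?n / 2 * \<eta>" using n by (simp add: q_def field_simps)
    have "?n * (p - 2) / 2 - b = (p - 2) * (?n / 2 * (q - 2) - 1) / (q - 2)"
      using q2 by (simp add: b_def field_simps)
    also have "\<dots> = (p - 2) / (q - 2) * (?n / 2 * \<eta>)" unfolding e by simp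
    also have "\<dots> \<le> 1 * (?n / 2 * \<eta>)" using p q q2 \<eta> by (intro mult_right_mono) (auto simp: pos_divide_le_eq)
    also have "\<dots> = \<epsilon> / 2" using n by (simp add: \<eta>_def)
    finally show ?thesis by (simp add: algebra_simps)
  qed
  obtain Cq where Cq: "Cq > 0" and ext: "bounded_extension q v Cq"
    by (rule restriction_conjecture_imp_bound[OF rc q(1)])
  define \<delta> where "\<delta> = \<epsilon> / (2 * p)"
  have \<delta>: "\<delta> > 0" using \<epsilon> p by (simp add: \<delta>_def)
  \<comment> \<open>After J levels the coefficients have dropped by L powr n.\<close>
  define J where "J = nat \<lceil>?n / \<delta>\<rceil>"
  have J: "real J * \<delta> \<ge> ?n"
  proof -
    have "?n / \<delta> \<le> real J" unfolding J_def by (rule real_nat_ceiling_ge)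
    then show ?thesis using \<delta> by (simp add: pos_divide_le_eq)
  qed
  define C1 where "C1 = (2 * (8 * fejer_const) ^ CARD('n)) powr (1 - b) * Cq powr b"
  have C1: "C1 > 0" using fejer_const_pos Cq by (simp add: C1_def)
  define C where "C = 2 powr ((p - 1) * J) * (C1 + 2 ^ (CARD('n) + 1) * B)"
  have C: "C > 0" using C1 B by (auto simp: C_def intro!: mult_pos_pos add_pos_pos)
  have main: "cell_integral p L v T a w I \<le> ennreal (C * L powr (\<epsilon> - ?n * p / 2) * \<mu>) * (\<Sum>k\<in>I. ennreal (norm (a k) powr p))"
    if L: "L \<ge> 1" and T: "equal_pieces T I \<mu>" and L\<mu>: "L powr (- ?n) \<le> B * \<mu>" for L and I :: "'i set" and T \<mu> a w
  proof -
    note I = equal_piecesD(5)[OF T] and \<mu> = equal_piecesD(6)[OF T]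
    let ?CI = "cell_integral p L v T a w" and ?S = "\<lambda>H. \<Sum>k\<in>H. norm (a k) powr p"
    let ?R = "\<lambda>h j. 2 ^ (CARD('n) + 1) * (h * L powr (- \<delta> * real j)) powr p"
    define Q where "Q = C1 * L powr (\<epsilon> - ?n * p / 2) * \<mu>"
    have Q: "Q \<ge> 0" using C1 \<mu> by (simp add: Q_def)
    have top: "?CI H \<le> ennreal (Q * ?S H)"
      if H: "H \<subseteq> I" "\<And>k. k \<in> H \<Longrightarrow> norm (a k) \<le> h" "\<And>k. k \<in> H \<Longrightarrow> h * L powr (- \<delta>) < norm (a k)" for H h
    proof (cases "H = {}")
      case True
      then show ?thesis using p by (simp add: cell_integral_def)
    next
      case False
      then obtain k where k: "k \<in> H" by auto
      have "norm (a k) > 0"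
      proof (rule ccontr)
        assume "\<not> norm (a k) > 0"
        then have "h * L powr (- \<delta>) < 0" using H(3)[OF k] by simp
        then have "h < 0" using L by (simp add: mult_less_0_iff)
        then show False using H(2)[OF k] norm_ge_zero[of "a k"] by linarith
      qed
      then have h: "h > 0" using H(2)[OF k] by linarith
      have "?CI H \<le> ennreal (C1 * L powr (- ?n - b) * (h powr p * \<mu> * card H))"
        unfolding C1_def
        using H(2) L
        by (intro level_estimate[OF Cq ext p(1) q(2) b_def _ h False equal_pieces_subset[OF T H(1)]]) auto
      also have "\<dots> \<le> ennreal (Q * ?S H)"
      proof (rule ennreal_leI)
        have "h powr p * L powr (- \<delta> * p) * card H = (\<Sum>k\<in>H. (h * L powr (- \<delta>)) powr p)"
          using h L by (simp add: powr_mult powr_powr)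
        also have "\<dots> \<le> ?S H"
          using H h L p by (intro sum_mono powr_mono2) (auto simp: less_imp_le)
        finally have "L powr (\<delta> * p) * (h powr p * L powr (- \<delta> * p) * card H) \<le> L powr (\<delta> * p) * ?S H"
          by (intro mult_left_mono) auto
        moreover have "L powr (\<delta> * p) * (h powr p * L powr (- \<delta> * p) * card H) = h powr p * card H"
        proof -
          have "L powr (\<delta> * p) * L powr (- \<delta> * p) = 1" using L by (simp flip: powr_add)
          then show ?thesis by (metis mult.assoc mult.commute mult_1)
        qed
        ultimately have hc: "h powr p * card H \<le> L powr (\<delta> * p) * ?S H" by (simp only:)
        have "C1 * L powr (- ?n - b) * (h powr p * \<mu> * card H) = C1 * \<mu> * L powr (- ?n - b) * (h powr p * card H)" by simp
        also have "\<dots> \<le> C1 * \<mu> * L powr (- ?n - b) * (L powr (\<delta> * p) * ?S H)"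
          using hc C1 \<mu> by (intro mult_left_mono) auto
        also have "\<dots> = C1 * \<mu> * L powr (- ?n - b + \<delta> * p) * ?S H"
          by (simp add: powr_add)
        also have "\<dots> \<le> C1 * \<mu> * L powr (\<epsilon> - ?n * p / 2) * ?S H"
        proof -
          have "\<delta> * p = \<epsilon> / 2" using p by (simp add: \<delta>_def)
          then have "- ?n - b + \<delta> * p \<le> \<epsilon> - ?n * p / 2" using b_ge by linarith
          then show ?thesis using C1 \<mu> L by (intro mult_right_mono mult_left_mono powr_mono sum_nonneg) auto
        qed
        finally show "C1 * L powr (- ?n - b) * (h powr p * \<mu> * card H) \<le> Q * ?S H"
          by (simp add: Q_def mult_ac)
      qed
      finally show ?thesis .
    qed
    \<comment> \<open>Peel off the largest coefficients level by level; what remains after j levels is bounded trivially.\<close>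
    have peel: "?CI H \<le> ennreal (2 powr ((p - 1) * real j) * (Q * ?S H + ?R h j))"
      if "H \<subseteq> I" "\<And>k. k \<in> H \<Longrightarrow> norm (a k) \<le> h" "h \<ge> 0" for H h j
      using that
    proof (induction j arbitrary: H h)
      case 0
      have "?CI H \<le> ennreal (2 ^ (CARD('n) + 1) * h powr p)"
        using p 0 by (intro cell_integral_trivial[OF _ _ equal_pieces_subset[OF T 0(1)]]) auto
      also have "\<dots> \<le> ennreal (2 powr ((p - 1) * real 0) * (Q * ?S H + ?R h 0))"
        using Q L by (intro ennreal_leI) (auto intro!: mult_nonneg_nonneg sum_nonneg)
      finally show ?case .
    next
      case (Suc j)
      define H1 where "H1 = {k \<in> H. h * L powr (- \<delta>) < norm (a k)}"
      define H2 where "H2 = H - H1"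
      let ?h = "h * L powr (- \<delta>)"
      have fH: "finite H" using Suc.prems I by (rule_tac finite_subset)
      have HH: "H = H1 \<union> H2" "H1 \<inter> H2 = {}" by (auto simp: H1_def H2_def)
      have fin: "finite H1" "finite H2" using fH by (auto simp: H1_def H2_def)
      have c1: "?CI H1 \<le> ennreal (Q * ?S H1)"
        using Suc.prems by (intro top[where h = h]) (auto simp: H1_def)
      have c2: "?CI H2 \<le> ennreal (2 powr ((p - 1) * real j) * (Q * ?S H2 + ?R ?h j))"
        using Suc.prems by (intro Suc.IH) (auto simp: H2_def H1_def)
      have "?CI H \<le> ennreal (2 powr (p - 1)) * (?CI H1 + ?CI H2)"
        unfolding HH(1) using p fin HH Suc.prems equal_piecesD(1)[OF T] by (intro cell_integral_union) auto
      also have "\<dots> \<le> ennreal (2 powr (p - 1)) * (ennreal (Q * ?S H1) + ennreal (2 powr ((p - 1) * real j) * (Q * ?S H2 + ?R ?h j)))"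
        by (intro mult_left_mono add_mono c1 c2) auto
      also have "\<dots> = ennreal (2 powr (p - 1) * (Q * ?S H1 + 2 powr ((p - 1) * real j) * (Q * ?S H2 + ?R ?h j)))"
        using Q by (simp add: sum_nonneg flip: ennreal_mult ennreal_plus)
      also have "\<dots> \<le> ennreal (2 powr ((p - 1) * real (Suc j)) * (Q * ?S H + ?R h (Suc j)))"
      proof (rule ennreal_leI)
        have sumH: "?S H = ?S H1 + ?S H2"
          unfolding HH(1) using fin HH(2) by (rule sum.union_disjoint)
        have Leq: "L powr (- \<delta>) * L powr (- \<delta> * j) = L powr (- \<delta> * real (Suc j))"
          by (simp add: algebra_simps flip: powr_add)
        have "Q * ?S H1 \<le> 2 powr ((p - 1) * real j) * (Q * ?S H1)"
        proof -
          have "1 \<le> (2::real) powr ((p - 1) * real j)" using p by (intro ge_one_powr_ge_zero) auto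
          moreover have "0 \<le> Q * ?S H1" using Q by (auto intro!: mult_nonneg_nonneg sum_nonneg)
          ultimately show ?thesis using mult_right_mono[of 1 "2 powr ((p - 1) * real j)"] by simp
        qed
        then have "Q * ?S H1 + 2 powr ((p - 1) * real j) * (Q * ?S H2 + ?R ?h j)
          \<le> 2 powr ((p - 1) * real j) * (Q * ?S H + ?R ?h j)"
          unfolding sumH by (simp add: distrib_left)
        then have "2 powr (p - 1) * (Q * ?S H1 + 2 powr ((p - 1) * real j) * (Q * ?S H2 + ?R ?h j))
          \<le> 2 powr (p - 1) * (2 powr ((p - 1) * real j) * (Q * ?S H + ?R ?h j))"
          by (intro mult_left_mono) auto
        also have "\<dots> = 2 powr ((p - 1) * real (Suc j)) * (Q * ?S H + ?R ?h j)"
        proof -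
          have "2 powr (p - 1) * 2 powr ((p - 1) * real j) = (2::real) powr ((p - 1) * real (Suc j))"
            by (simp add: algebra_simps flip: powr_add)
          then show ?thesis by (simp only: mult.assoc[symmetric])
        qed
        finally show "2 powr (p - 1) * (Q * ?S H1 + 2 powr ((p - 1) * real j) * (Q * ?S H2 + ?R ?h j))
          \<le> 2 powr ((p - 1) * real (Suc j)) * (Q * ?S H + ?R h (Suc j))"
          by (simp only: Leq[symmetric] mult.assoc)
      qed
      finally show ?case .
    qed
    show ?thesis
    proof (cases "I = {}")
      case True
      then show ?thesis using p by (simp add: cell_integral_def)
    next
      case False
      define A where "A = Max ((\<lambda>k. norm (a k)) ` I)"
      have "A \<in> (\<lambda>k. norm (a k)) ` I" unfolding A_def using I False by (intro Max_in) auto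
      then obtain k0 where k0: "k0 \<in> I" "A = norm (a k0)" by auto
      have Amax: "norm (a k) \<le> A" if "k \<in> I" for k unfolding A_def using I that by (intro Max_ge) auto
      have AS: "A powr p \<le> ?S I" unfolding k0(2) using I k0 by (intro member_le_sum) auto
      have S0: "?S I \<ge> 0" by (intro sum_nonneg) auto
      have "(A * L powr (- \<delta> * J)) powr p \<le> B * L powr (\<epsilon> - ?n * p / 2) * \<mu> * ?S I"
      proof -
        have "(A * L powr (- \<delta> * J)) powr p = A powr p * L powr (- \<delta> * J * p)"
          using k0 by (simp add: powr_mult powr_powr)
        also have "\<dots> \<le> A powr p * L powr (\<epsilon> - ?n * p / 2 - ?n)"
        proof -
          have "- (J * \<delta>) * p \<le> - ?n * p" using J p by (intro mult_right_mono) auto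
          moreover have "?n * 2 \<le> ?n * p" using p by (intro mult_left_mono) auto
          moreover have "- \<delta> * J * p = - (J * \<delta>) * p" by simp
          ultimately have "- \<delta> * J * p \<le> \<epsilon> - ?n * p / 2 - ?n" using \<epsilon> by linarith
          then show ?thesis using L by (intro mult_left_mono powr_mono) auto
        qed
        also have "\<dots> = A powr p * (L powr (\<epsilon> - ?n * p / 2) * L powr (- ?n))"
          by (simp add: algebra_simps flip: powr_add)
        also have "\<dots> \<le> ?S I * (L powr (\<epsilon> - ?n * p / 2) * (B * \<mu>))"
          using AS L\<mu> S0 by (intro mult_mono mult_left_mono) auto
        finally show ?thesis by (simp add: mult_ac)
      qed
      then have le: "Q * ?S I + ?R A J \<le> Q * ?S I + 2 ^ (CARD('n) + 1) * (B * L powr (\<epsilon> - ?n * p / 2) * \<mu> * ?S I)"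
        by (intro add_left_mono mult_left_mono) auto
      have "?CI I \<le> ennreal (2 powr ((p - 1) * real J) * (Q * ?S I + ?R A J))"
        using Amax k0 by (intro peel) auto
      also have "\<dots> \<le> ennreal (2 powr ((p - 1) * real J) * (Q * ?S I + 2 ^ (CARD('n) + 1) * (B * L powr (\<epsilon> - ?n * p / 2) * \<mu> * ?S I)))"
        using le by (intro ennreal_leI mult_left_mono) auto
      also have "2 powr ((p - 1) * real J) * (Q * ?S I + 2 ^ (CARD('n) + 1) * (B * L powr (\<epsilon> - ?n * p / 2) * \<mu> * ?S I)) = (C * L powr (\<epsilon> - ?n * p / 2) * \<mu>) * ?S I"
        by (simp add: C_def Q_def algebra_simps)
      also have "ennreal \<dots> = ennreal (C * L powr (\<epsilon> - ?n * p / 2) * \<mu>) * (\<Sum>k\<in>I. ennreal (norm (a k) powr p))"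
        using C \<mu> S0 by (simp add: ennreal_mult sum_ennreal)
      finally show ?thesis .
    qed
  qed
  show thesis by (rule that[OF C main])
qed

section \<open>Nested grids of boxes\<close>

text \<open>
  The index of the box of side \<open>\<rho> * t i\<close> in direction \<open>i\<close> that contains \<open>\<zeta>\<close>. Passing to a coarser grid is
  integer division of the index, so nesting of grids becomes arithmetic of \<open>div\<close>.
\<close>

definition cell :: "real \<Rightarrow> ('k \<Rightarrow> int) \<Rightarrow> real^'k \<Rightarrow> 'k \<Rightarrow> int" where
  "cell \<rho> t \<zeta> = (\<lambda>i. \<lfloor>\<zeta> $ i / \<rho>\<rfloor> div t i)"

definition cell_part :: "real \<Rightarrow> ('k \<Rightarrow> int) \<Rightarrow> ('k \<Rightarrow> int) \<Rightarrow> ((real^'k) \<times> real \<Rightarrow> complex) \<Rightarrow> (real^'k) \<times> real \<Rightarrow> complex" where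
  "cell_part \<rho> t m G \<omega> = (if cell \<rho> t (fst \<omega>) = m then G \<omega> else 0)"

lemma cell_iff:
  assumes "\<rho> > 0" "\<And>i. t i > 0"
  shows "cell \<rho> t \<zeta> = m \<longleftrightarrow> (\<forall>i. \<rho> * t i * m i \<le> \<zeta> $ i \<and> \<zeta> $ i < \<rho> * t i * (m i + 1))"
proof -
  have "\<lfloor>\<zeta> $ i / \<rho>\<rfloor> div t i = m i \<longleftrightarrow> \<rho> * t i * m i \<le> \<zeta> $ i \<and> \<zeta> $ i < \<rho> * t i * (m i + 1)" for i
  proof -
    have "\<lfloor>\<zeta> $ i / \<rho>\<rfloor> div t i = \<lfloor>\<zeta> $ i / \<rho> / t i\<rfloor>"
      using assms(2)[of i] floor_divide_real_eq_div[of "t i" "\<zeta> $ i / \<rho>"] by linarith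
    also have "\<dots> = m i \<longleftrightarrow> m i \<le> \<zeta> $ i / \<rho> / t i \<and> \<zeta> $ i / \<rho> / t i < m i + 1"
      by (simp add: floor_eq_iff)
    also have "\<dots> \<longleftrightarrow> \<rho> * t i * m i \<le> \<zeta> $ i \<and> \<zeta> $ i < \<rho> * t i * (m i + 1)"
      using assms(1) assms(2)[of i] by (simp add: pos_le_divide_eq pos_divide_less_eq mult_ac)
    finally show ?thesis .
  qed
  then show ?thesis by (simp add: cell_def fun_eq_iff)
qed

lemma measurable_cell:
  assumes "\<rho> > 0" "\<And>i. t i > 0"
  shows "{\<omega> :: (real^'k) \<times> real. cell \<rho> t (fst \<omega>) = m} \<in> sets borel"
proof -
  have [measurable]: "(\<lambda>\<omega> :: (real^'k) \<times> real. fst \<omega> $ i) \<in> borel_measurable borel" for i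
    by (intro borel_measurable_continuous_onI continuous_intros)
  show ?thesis unfolding cell_iff[OF assms] by measurable
qed

lemma cell_part_eq_indicator:
  "cell_part \<rho> t m G = (\<lambda>\<omega>. indicator {\<omega>. cell \<rho> t (fst \<omega>) = m} \<omega> *\<^sub>R G \<omega>)"
  by (auto simp: cell_part_def fun_eq_iff indicator_def)

lemma integrable_cell_part:
  assumes "\<rho> > 0" "\<And>i. t i > 0" "integrable lborel G"
  shows "integrable lborel (cell_part \<rho> t m G)"
  unfolding cell_part_eq_indicator
  using measurable_cell[OF assms(1,2)] assms(3) by (intro integrable_mult_indicator) auto

lemma inv_FT_sum:
  assumes "finite I" "\<And>k. k \<in> I \<Longrightarrow> integrable lborel (G k)"
  shows "inv_FT (\<lambda>\<omega>. \<Sum>k\<in>I. G k \<omega>) = (\<lambda>x. \<Sum>k\<in>I. inv_FT (G k) x)"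
  unfolding inv_FT_def using assms
  by (auto simp: fun_eq_iff sum_distrib_right intro!: Bochner_Integration.integral_sum integrable_mult_e)

definition subcells :: "('k \<Rightarrow> int) \<Rightarrow> ('k \<Rightarrow> int) \<Rightarrow> ('k \<Rightarrow> int) set" where
  "subcells s m = {m'. \<forall>i. m' i div s i = m i}"

lemma subcells_subset:
  assumes "\<And>i. s i > 0"
  shows "subcells s m \<subseteq> PiE UNIV (\<lambda>i. {s i * m i ..< s i * m i + s i})"
proof
  fix m' assume m': "m' \<in> subcells s m"
  have "m' i \<in> {s i * m i ..< s i * m i + s i}" for i
  proof -
    have "s i * (m' i div s i) + m' i mod s i = m' i" by simp
    moreover have "m' i div s i = m i" using m' by (simp add: subcells_def)
    moreover have "0 \<le> m' i mod s i" "m' i mod s i < s i" using assms[of i] by auto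
    ultimately show ?thesis by (metis add_increasing2 add_less_cancel_left atLeastLessThan_iff order_refl)
  qed
  then show "m' \<in> PiE UNIV (\<lambda>i. {s i * m i ..< s i * m i + s i})" by auto
qed

lemma finite_subcells:
  fixes s :: "'k::finite \<Rightarrow> int"
  assumes "\<And>i. s i > 0"
  shows "finite (subcells s m)"
  by (rule finite_subset[OF subcells_subset[OF assms]]) (intro finite_PiE; simp)

lemma card_subcells_le:
  fixes s :: "'k::finite \<Rightarrow> int"
  assumes "\<And>i. s i > 0" "\<And>i. s i \<le> N"
  shows "real (card (subcells s m)) \<le> real_of_int N ^ CARD('k)"
proof -
  have "card (subcells s m) \<le> card (PiE UNIV (\<lambda>i. {s i * m i ..< s i * m i + s i}))"
    by (intro card_mono subcells_subset assms finite_PiE) auto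
  also have "\<dots> = (\<Prod>i\<in>UNIV. nat (s i))" by (simp add: card_PiE)
  also have "\<dots> \<le> (\<Prod>i\<in>(UNIV::'k set). nat N)" using assms by (intro prod_mono conjI nat_mono) auto
  finally have "real (card (subcells s m)) \<le> real (nat N ^ CARD('k))" by simp
  also have "\<dots> = real_of_int N ^ CARD('k)"
  proof -
    have "N > 0" using assms[of undefined] by simp
    then show ?thesis by simp
  qed
  finally show ?thesis .
qed

lemma cell_mult:
  assumes "\<And>i. t i > 0" "\<And>i. s i > 0"
  shows "cell \<rho> (\<lambda>i. t i * s i) \<zeta> = m \<longleftrightarrow> cell \<rho> t \<zeta> \<in> subcells s m"
  using assms by (auto simp: cell_def subcells_def fun_eq_iff zdiv_zmult2_eq less_imp_le)

lemma cell_part_split: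
  fixes t s :: "'k::finite \<Rightarrow> int"
  assumes "\<rho> > 0" "\<And>i. t i > 0" "\<And>i. s i > 0"
  shows "cell_part \<rho> (\<lambda>i. t i * s i) m G = (\<lambda>\<omega>. \<Sum>k\<in>subcells s m. cell_part \<rho> t k G \<omega>)"
proof
  fix \<omega>
  show "cell_part \<rho> (\<lambda>i. t i * s i) m G \<omega> = (\<Sum>k\<in>subcells s m. cell_part \<rho> t k G \<omega>)"
    using assms finite_subcells[of s m]
    by (simp add: cell_part_def cell_mult sum.delta')
qed

lemma subcells_mult:
  assumes "\<And>i. s i > 0" "\<And>i. t i > 0"
  shows "subcells (\<lambda>i. t i * s i) m = (\<Union>k\<in>subcells s m. subcells t k)"
  using assms by (auto simp: subcells_def zdiv_zmult2_eq less_imp_le)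

lemma disjoint_subcells: "k \<noteq> k' \<Longrightarrow> subcells t k \<inter> subcells t k' = {}"
  by (auto simp: subcells_def fun_eq_iff)

text \<open>
  Splitting into boundedly many boxes needs no cancellation. This suffices for the last step of the
  iteration, which cuts boxes by the fixed factor \<open>K\<close>.
\<close>

lemma trivial_split:
  fixes t s :: "'k::finite \<Rightarrow> int"
  assumes "\<rho> > 0" "\<And>i. t i > 0" "\<And>i. s i > 0" "integrable lborel G" "p > 1" "\<And>i. s i \<le> N"
  shows "Lp_pow p (inv_FT (cell_part \<rho> (\<lambda>i. t i * s i) m G))
     \<le> ennreal ((real_of_int N ^ CARD('k)) powr (p - 1)) * (\<Sum>k\<in>subcells s m. Lp_pow p (inv_FT (cell_part \<rho> t k G)))"
proof -
  have "Lp_pow p (inv_FT (cell_part \<rho> (\<lambda>i. t i * s i) m G)) = Lp_pow p (\<lambda>x. \<Sum>k\<in>subcells s m. inv_FT (cell_part \<rho> t k G) x)"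
    unfolding cell_part_split[OF assms(1-3)] using assms
    by (subst inv_FT_sum) (auto intro!: finite_subcells integrable_cell_part)
  also have "\<dots> \<le> ennreal (real (card (subcells s m)) powr (p - 1)) * (\<Sum>k\<in>subcells s m. Lp_pow p (inv_FT (cell_part \<rho> t k G)))"
    using assms by (intro Lp_pow_sum_le finite_subcells borel_measurable_inv_FT integrable_cell_part)
  also have "\<dots> \<le> ennreal ((real_of_int N ^ CARD('k)) powr (p - 1)) * (\<Sum>k\<in>subcells s m. Lp_pow p (inv_FT (cell_part \<rho> t k G)))"
    using assms by (intro mult_right_mono ennreal_leI powr_mono2 card_subcells_le) auto
  finally show ?thesis .
qed

section \<open>Decoupling in half of the coordinates\<close>

definition quad :: "real^'k \<Rightarrow> real^'k \<Rightarrow> real" where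
  "quad v \<zeta> = (\<Sum>i\<in>UNIV. v $ i * (\<zeta> $ i)\<^sup>2)"

lemma emeasure_half_open_cube:
  fixes l :: "real^'n"
  assumes "r > 0"
  shows "{\<xi>. \<forall>j. l $ j \<le> \<xi> $ j \<and> \<xi> $ j < l $ j + r} \<in> sets borel" (is "?A \<in> _")
    and "emeasure lborel {\<xi>. \<forall>j. l $ j \<le> \<xi> $ j \<and> \<xi> $ j < l $ j + r} = ennreal (r ^ CARD('n))"
proof -
  have [measurable]: "(\<lambda>\<xi> :: real^'n. \<xi> $ i) \<in> borel_measurable borel" for i
    by (intro borel_measurable_continuous_onI continuous_intros)
  show A: "?A \<in> sets borel" by measurable
  let ?u = "l + r *\<^sub>R One"
  have One: "(One :: real^'n) $ j = 1" for j
  proof -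
    have "(One :: real^'n) \<bullet> axis j 1 = 1" by (intro inner_sum_Basis) (auto simp: Basis_vec_def)
    moreover have "x \<bullet> axis j 1 = x $ j" for x :: "real^'n" by (simp add: inner_axis)
    ultimately show ?thesis by metis
  qed
  have le: "box l ?u \<subseteq> ?A" "?A \<subseteq> cbox l ?u"
  proof -
    have u: "?u = (\<chi> j. l $ j + r)"
      unfolding vec_eq_iff vector_add_component vector_scaleR_component One by simp
    show "box l ?u \<subseteq> ?A" "?A \<subseteq> cbox l ?u"
      unfolding u by (auto simp: mem_box_cart less_imp_le)
  qed
  have "emeasure lborel (box l ?u) = ennreal (r ^ CARD('n))" "emeasure lborel (cbox l ?u) = ennreal (r ^ CARD('n))"
    using assms by (auto simp: emeasure_lborel_box_eq emeasure_lborel_cbox_eq inner_add_left)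
  then show "emeasure lborel ?A = ennreal (r ^ CARD('n))"
    using emeasure_mono[OF le(1), of lborel] emeasure_mono[OF le(2), of lborel] A by (auto intro: antisym)
qed

text \<open>
  On every box that is longer by the factor \<open>K\<close> in the directions of \<open>A\<close> than in the others, the directions
  of \<open>A\<close> can be cut into \<open>K^2\<close> parts each at the cost \<open>X\<close>. Afterwards the box is longer by the factor \<open>K\<close> in
  the other directions, ready for a step with the complement of \<open>A\<close>.
\<close>

definition step_bound :: "'k::finite set \<Rightarrow> nat \<Rightarrow> real \<Rightarrow> real \<Rightarrow> real \<Rightarrow> ((real^'k) \<times> real \<Rightarrow> complex) \<Rightarrow> bool" where
  "step_bound A K X p \<rho> G \<longleftrightarrow> (\<forall>T>0. \<forall>m.
      Lp_pow p (inv_FT (cell_part \<rho> (\<lambda>i. (if i \<in> A then T else int K * T) * (if i \<in> A then (int K)\<^sup>2 else 1)) m G))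
      \<le> ennreal X * (\<Sum>k\<in>subcells (\<lambda>i. if i \<in> A then (int K)\<^sup>2 else 1) m.
            Lp_pow p (inv_FT (cell_part \<rho> (\<lambda>i. if i \<in> A then T else int K * T) k G))))"

definition near_paraboloid :: "real^'k \<Rightarrow> real \<Rightarrow> ((real^'k) \<times> real \<Rightarrow> complex) \<Rightarrow> bool" where
  "near_paraboloid v r G \<longleftrightarrow> (\<forall>\<zeta> \<tau>. G (\<zeta>, \<tau>) \<noteq> 0 \<longrightarrow> \<bar>\<tau> - quad v \<zeta>\<bar> \<le> r)"

lemma step_bound_mono:
  assumes "step_bound A K X p \<rho> G" "X \<le> X'"
  shows "step_bound A K X' p \<rho> G"
  using assms unfolding step_bound_def
  by (meson ennreal_leI mult_right_mono order_trans zero_le)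

text \<open>
  Let \<open>\<iota>\<close> embed the coordinates of a paraboloid of half the dimension. A box has side \<open>a = \<rho> * K^2 * T\<close> in
  the directions of \<open>\<iota>\<close> and side \<open>a / K\<close> in the others. Expand the quadratic form about the corner \<open>\<zeta>0\<close> of
  the box: its linear part is removed by a shear of the dual space, and what the short directions contribute
  to the quadratic part is at most \<open>a^2 / K^2\<close> each. So after rescaling the long directions by \<open>a\<close> and the last
  one by \<open>a^2\<close>, the frequencies lie within \<open>O(1 / K^2)\<close> of the paraboloid of \<open>u\<close>, and are decoupled into cubes
  of side \<open>1 / K^2\<close> by the local estimate at the scale \<open>L\<close> comparable to \<open>K^2\<close>. The map \<open>Z\<close> below is the
  adjoint of the rescaled shear.
\<close>

theorem decoupling_step:
  fixes v :: "real^'k" and u :: "real^'n" and \<iota> :: "'n \<Rightarrow> 'k"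
  assumes inj: "inj \<iota>" and u: "\<And>j. u $ j = v $ \<iota> j" and v: "\<And>i. \<bar>v $ i\<bar> \<le> 1"
    and rc: "restriction_conjecture u" and p: "2 \<le> p" "p \<le> 2 + 2 / real CARD('n)" and \<epsilon>: "\<epsilon> > 0" and C0: "C0 \<ge> 0"
  obtains C c where "C > 0"
    "\<And>(K::nat) \<rho> G. \<lbrakk>real K \<ge> c; K > 0; \<rho> > 0; integrable lborel G; near_paraboloid v (C0 * \<rho>\<^sup>2) G\<rbrakk> \<Longrightarrow>
      step_bound (range \<iota>) K (C * real K powr (2 * (real CARD('n) * (p / 2 - 1) + \<epsilon>))) p \<rho> G"
proof -
  let ?n = "real CARD('n)"
  \<comment> \<open>Taking L = K^2 / c1 makes all deviations of frequencies at most 1 / (2 pi).\<close>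
  define c1 where "c1 = 2 * pi * (C0 + real CARD('k) + 2 * ?n + 1)"
  have c1: "c1 \<ge> 1"
  proof -
    have "1 * 1 \<le> (2 * pi) * (C0 + real CARD('k) + 2 * ?n + 1)" using C0 pi_gt3 by (intro mult_mono) auto
    then show ?thesis by (simp add: c1_def)
  qed
  obtain C where C: "C > 0" and loc: "\<And>L (I :: ('k \<Rightarrow> int) set) T \<mu> a w.
       \<lbrakk>L \<ge> 1; equal_pieces T I \<mu>; L powr (- ?n) \<le> c1 powr ?n * \<mu>\<rbrakk> \<Longrightarrow>
       cell_integral p L u T a w I \<le> ennreal (C * L powr (\<epsilon> - ?n * p / 2) * \<mu>) * (\<Sum>k\<in>I. ennreal (norm (a k) powr p))"
    using c1 by (rule_tac local_estimate[OF rc p \<epsilon>, where B = "c1 powr ?n"]) (simp, blast)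
  define M where "M = kernel_mass TYPE((real^'n) \<times> real)"
  have M: "M > 0" unfolding M_def by (rule kernel_mass_pos)
  define C' where "C' = M powr p * C * c1 powr (?n * p / 2)"
  have C': "C' > 0" using M C c1 by (simp add: C'_def)
  have step: "Lp_pow p (inv_FT (cell_part \<rho> (\<lambda>i. (if i \<in> range \<iota> then T else int K * T) * (if i \<in> range \<iota> then (int K)\<^sup>2 else 1)) m G))
      \<le> ennreal (C' * real K powr (2 * (?n * (p / 2 - 1) + \<epsilon>))) *
        (\<Sum>k\<in>subcells (\<lambda>i. if i \<in> range \<iota> then (int K)\<^sup>2 else 1) m.
            Lp_pow p (inv_FT (cell_part \<rho> (\<lambda>i. if i \<in> range \<iota> then T else int K * T) k G)))"
    if Kc: "real K \<ge> c1" and K: "K > 0" and \<rho>: "\<rho> > 0" and T: "T > 0" and G: "integrable lborel G"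
      and supp: "near_paraboloid v (C0 * \<rho>\<^sup>2) G" for K :: nat and \<rho> T m G
  proof -
    define t where "t = (\<lambda>i. if i \<in> range \<iota> then T else int K * T)"
    define s where "s = (\<lambda>i. if i \<in> range \<iota> then (int K)\<^sup>2 else 1)"
    have t: "t i > 0" for i using T K by (simp add: t_def)
    have s: "s i > 0" for i using K by (simp add: s_def)
    define L where "L = (real K)\<^sup>2 / c1"
    have K1: "real K \<ge> 1" using K by simp
    have L1: "L \<ge> 1"
    proof -
      have "c1 * 1 \<le> real K * real K" using Kc K1 by (intro mult_mono) auto
      then show ?thesis using c1 by (simp add: L_def power2_eq_square)
    qed
    define a where "a = \<rho> * (real K)\<^sup>2 * T"
    have a: "a > 0" using \<rho> T K by (simp add: a_def)
    define \<mu> where "\<mu> = (1 / (real K)\<^sup>2) ^ CARD('n)"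
    have \<mu>: "\<mu> > 0" using K by (simp add: \<mu>_def)
    define \<zeta>0 where "\<zeta>0 = (\<chi> i. \<rho> * (t i * s i) * m i)"
    define \<omega>0 where "\<omega>0 = (\<zeta>0, quad v \<zeta>0)"
    define Z where "Z z = ((\<chi> i. L * ((\<Sum>j\<in>UNIV. if \<iota> j = i then fst z $ j / a else 0) - snd z * (2 * v $ i * \<zeta>0 $ i) / a\<^sup>2)), L * snd z / a\<^sup>2)"
      for z :: "(real^'n) \<times> real"
    have linZ: "linear Z"
    proof (rule linearI)
      fix x y :: "(real^'n) \<times> real" and r :: real
      show "Z (x + y) = Z x + Z y"
        unfolding Z_def by (auto simp: vec_eq_iff algebra_simps add_divide_distrib sum.distrib[symmetric] sum_distrib_left intro!: sum.cong)
      show "Z (r *\<^sub>R x) = r *\<^sub>R Z x"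
        unfolding Z_def by (auto simp: vec_eq_iff algebra_simps sum_distrib_left intro!: sum.cong)
    qed
    define I where "I = subcells s m"
    have fI: "finite I" unfolding I_def using s by (rule finite_subcells)
    \<comment> \<open>The position of the box k inside the box m, rescaled to the unit cube.\<close>
    define l where "l k = (\<chi> j. (k (\<iota> j) - (int K)\<^sup>2 * m (\<iota> j)) / (real K)\<^sup>2)" for k :: "'k \<Rightarrow> int"
    define Tc where "Tc k = {\<xi> :: real^'n. \<forall>j. l k $ j \<le> \<xi> $ j \<and> \<xi> $ j < l k $ j + 1 / (real K)\<^sup>2}" for k
    have r: "1 / (real K)\<^sup>2 > 0" using K by simp
    have Tm: "Tc k \<in> sets borel" "emeasure lborel (Tc k) = ennreal \<mu>" for k
      unfolding Tc_def \<mu>_def by (rule emeasure_half_open_cube[OF r])+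
    have res: "0 \<le> k (\<iota> j) - (int K)\<^sup>2 * m (\<iota> j)" "k (\<iota> j) - (int K)\<^sup>2 * m (\<iota> j) + 1 \<le> (int K)\<^sup>2" if "k \<in> I" for k j
      using subsetD[OF subcells_subset[OF s] that[unfolded I_def]] by (auto simp: s_def PiE_iff dest!: spec[of _ "\<iota> j"])
    have Tsub: "Tc k \<subseteq> unit_cube" if "k \<in> I" for k
    proof
      fix \<xi> assume \<xi>: "\<xi> \<in> Tc k"
      have "0 \<le> \<xi> $ j \<and> \<xi> $ j \<le> 1" for j
      proof -
        have "0 \<le> l k $ j" using res(1)[OF that, of j] unfolding l_def
          by (simp del: of_int_diff of_int_power of_int_mult)
        moreover have "l k $ j + 1 / (real K)\<^sup>2 \<le> 1"
        proof -
          have "real_of_int (k (\<iota> j) - (int K)\<^sup>2 * m (\<iota> j) + 1) \<le> real_of_int ((int K)\<^sup>2)"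
            using res(2)[OF that, of j] by (simp only: of_int_le_iff)
          then show ?thesis using K unfolding l_def by (simp add: field_simps)
        qed
        ultimately show ?thesis using \<xi> unfolding Tc_def by (smt (verit, best) mem_Collect_eq)
      qed
      then show "\<xi> \<in> unit_cube" by (simp add: unit_cube_def)
    qed
    have Tdisj: "disjoint_family_on Tc I"
      unfolding disjoint_family_on_def
    proof (intro ballI impI)
      fix k k' assume kk: "k \<in> I" "k' \<in> I" "k \<noteq> k'"
      then obtain i where i: "k i \<noteq> k' i" by (auto simp: fun_eq_iff)
      have "i \<in> range \<iota>"
      proof (rule ccontr)
        assume "i \<notin> range \<iota>"
        then have "s i = 1" by (simp add: s_def)
        then have "k i = m i" "k' i = m i" using kk(1,2) by (auto simp: I_def subcells_def dest: spec[of _ i])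
        then show False using i by simp
      qed
      then obtain j where j: "i = \<iota> j" by auto
      show "Tc k \<inter> Tc k' = {}"
      proof (rule ccontr)
        assume "Tc k \<inter> Tc k' \<noteq> {}"
        then obtain \<xi> where "\<xi> \<in> Tc k" "\<xi> \<in> Tc k'" by auto
        then have "l k $ j \<le> \<xi> $ j" "\<xi> $ j < l k $ j + 1 / (real K)\<^sup>2" "l k' $ j \<le> \<xi> $ j" "\<xi> $ j < l k' $ j + 1 / (real K)\<^sup>2"
          by (auto simp: Tc_def)
        then have "l k $ j < l k' $ j + 1 / (real K)\<^sup>2" "l k' $ j < l k $ j + 1 / (real K)\<^sup>2" by linarith+
        then have "real_of_int (k (\<iota> j)) < real_of_int (k' (\<iota> j)) + 1" "real_of_int (k' (\<iota> j)) < real_of_int (k (\<iota> j)) + 1"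
          using K unfolding l_def by (simp_all add: field_simps)
        then have "k (\<iota> j) < k' (\<iota> j) + 1" "k' (\<iota> j) < k (\<iota> j) + 1" by linarith+
        then show False using i j by simp
      qed
    qed
    have pieces: "equal_pieces Tc I \<mu>"
      using Tm Tsub Tdisj fI \<mu> by (simp add: equal_pieces_def)
    have L\<mu>: "L powr (- ?n) \<le> c1 powr ?n * \<mu>"
    proof -
      have "L powr (- ?n) = c1 powr ?n * (1 / (real K)\<^sup>2) powr ?n"
        unfolding L_def using c1 K by (simp add: powr_minus powr_divide divide_inverse powr_mult inverse_powr)
      then show ?thesis using K by (simp add: \<mu>_def powr_realpow)
    qed
    let ?P = "\<lambda>\<xi>. L *\<^sub>R paraboloid_point u \<xi>"
    define D where "D = C * L powr (\<epsilon> - ?n * p / 2) * \<mu>"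
    have D: "D \<ge> 0" using C \<mu> by (simp add: D_def)
    have main: "ennreal (\<mu> powr p * 2 ^ DIM((real^'n) \<times> real)) * Lp_pow p (\<lambda>x. \<Sum>k\<in>I. inv_FT (cell_part \<rho> t k G) x)
      \<le> ennreal (M powr p) * ennreal D * (\<Sum>k\<in>I. Lp_pow p (inv_FT (cell_part \<rho> t k G)))"
      unfolding M_def
    proof (rule decoupling_from_local_estimate[OF linZ fI _ Tm \<mu>, where P = ?P and ?\<omega>0.0 = \<omega>0])
      show "p > 1" using p by simp
      show "?P \<in> borel_measurable borel" by measurable
      show "integrable lborel (cell_part \<rho> t k G)" for k using \<rho> t G by (rule integrable_cell_part)
      show "(\<integral>\<^sup>+z. indicator unit_box z * ennreal (norm (\<Sum>k\<in>I. a k * cell_transform ?P (Tc k) (z - w)) powr p) \<partial>lborel)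
              \<le> ennreal D * (\<Sum>k\<in>I. ennreal (norm (a k) powr p))" for a w
        using loc[OF L1 pieces L\<mu>] unfolding cell_integral_def D_def .
      fix k \<omega> \<xi> and b :: "(real^'n) \<times> real"
      assume k: "k \<in> I" and nz: "cell_part \<rho> t k G \<omega> \<noteq> 0" and \<xi>: "\<xi> \<in> Tc k" and b: "b \<in> Basis"
      obtain \<zeta> \<tau> where \<omega>: "\<omega> = (\<zeta>, \<tau>)" by (cases \<omega>)
      have ck: "cell \<rho> t \<zeta> = k" and Gnz: "G (\<zeta>, \<tau>) \<noteq> 0" using nz by (auto simp: cell_part_def \<omega> split: if_splits)
      have cm: "cell \<rho> (\<lambda>i. t i * s i) \<zeta> = m" using ck k t s by (simp add: cell_mult I_def)
      define \<delta> where "\<delta> i = \<zeta> $ i - \<zeta>0 $ i" for i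
      have \<delta>: "0 \<le> \<delta> i" "\<delta> i \<le> \<rho> * (t i * s i)" for i
      proof -
        have "\<rho> * real_of_int (t i * s i) * m i \<le> \<zeta> $ i \<and> \<zeta> $ i < \<rho> * real_of_int (t i * s i) * (m i + 1)"
          using cm cell_iff[of \<rho> "\<lambda>i. t i * s i" \<zeta> m] \<rho> t s by simp
        then show "0 \<le> \<delta> i" "\<delta> i \<le> \<rho> * (t i * s i)" by (auto simp: \<delta>_def \<zeta>0_def algebra_simps)
      qed
      have x\<xi>: "\<bar>\<delta> (\<iota> j) / a - \<xi> $ j\<bar> \<le> 1 / (real K)\<^sup>2" for j
      proof -
        have "\<rho> * real_of_int (t (\<iota> j)) * k (\<iota> j) \<le> \<zeta> $ \<iota> j \<and> \<zeta> $ \<iota> j < \<rho> * real_of_int (t (\<iota> j)) * (k (\<iota> j) + 1)"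
          using ck cell_iff[of \<rho> t \<zeta> k] \<rho> t by simp
        then have 1: "\<rho> * T * k (\<iota> j) \<le> \<zeta> $ \<iota> j" "\<zeta> $ \<iota> j < \<rho> * T * (k (\<iota> j) + 1)" by (auto simp: t_def)
        have z0: "\<zeta>0 $ \<iota> j = \<rho> * T * ((real K)\<^sup>2 * m (\<iota> j))" by (simp add: \<zeta>0_def t_def s_def)
        have "l k $ j \<le> \<delta> (\<iota> j) / a"
          using 1(1) a K \<rho> T unfolding \<delta>_def z0 a_def l_def
          by (simp add: pos_divide_le_eq pos_le_divide_eq) (simp add: algebra_simps power2_eq_square)
        moreover have "\<delta> (\<iota> j) / a < l k $ j + 1 / (real K)\<^sup>2"
        proof -
          have "\<delta> (\<iota> j) / a < (k (\<iota> j) - (real K)\<^sup>2 * m (\<iota> j) + 1) / (real K)\<^sup>2"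
            using 1(2) a K \<rho> T unfolding \<delta>_def z0 a_def
            by (simp add: pos_divide_less_eq pos_less_divide_eq) (simp add: algebra_simps power2_eq_square)
          then show ?thesis by (simp add: l_def add_divide_distrib diff_divide_distrib)
        qed
        moreover have "l k $ j \<le> \<xi> $ j" "\<xi> $ j < l k $ j + 1 / (real K)\<^sup>2" using \<xi> by (auto simp: Tc_def)
        ultimately show ?thesis by linarith
      qed
      show "\<bar>2 * pi * ((\<omega> - \<omega>0) \<bullet> Z b - ?P \<xi> \<bullet> b)\<bar> \<le> 1"
      proof (cases "\<exists>j. b = (axis j 1, 0)")
        case True
        then obtain j where j: "b = (axis j 1, 0)" by auto
        have Zb: "Z b = ((\<chi> i. if i = \<iota> j then L / a else 0), 0)"
        proof -
          have "(\<Sum>j'\<in>UNIV. if \<iota> j' = i then fst b $ j' / a else (0::real)) = (\<Sum>j'\<in>UNIV. if j' = j then (if \<iota> j' = i then 1 / a else 0) else 0)" for i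
            by (intro sum.cong) (auto simp: axis_def j)
          then have "(\<Sum>j'\<in>UNIV. if \<iota> j' = i then fst b $ j' / a else (0::real)) = (if i = \<iota> j then 1 / a else 0)" for i
            by simp
          moreover have "snd b = 0" by (simp add: j)
          ultimately show ?thesis unfolding Z_def by (simp add: vec_eq_iff)
        qed
        have "(\<omega> - \<omega>0) \<bullet> Z b = \<delta> (\<iota> j) * (L / a)"
        proof -
          have "(\<omega> - \<omega>0) \<bullet> Z b = (\<Sum>i\<in>UNIV. if i = \<iota> j then \<delta> i * (L / a) else 0)"
            unfolding Zb \<omega> \<omega>0_def \<delta>_def inner_vec_def diff_Pair inner_Pair vec_lambda_beta vector_minus_component inner_real_def mult_zero_right add_0_right
            by (intro sum.cong) auto
          then show ?thesis by simp
        qed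
        moreover have "?P \<xi> \<bullet> b = L * \<xi> $ j" by (simp add: j paraboloid_point_def inner_axis)
        ultimately have "2 * pi * ((\<omega> - \<omega>0) \<bullet> Z b - ?P \<xi> \<bullet> b) = 2 * pi * L * (\<delta> (\<iota> j) / a - \<xi> $ j)"
          by (simp only: right_diff_distrib) simp
        then have "\<bar>2 * pi * ((\<omega> - \<omega>0) \<bullet> Z b - ?P \<xi> \<bullet> b)\<bar> = 2 * pi * L * \<bar>\<delta> (\<iota> j) / a - \<xi> $ j\<bar>"
          using L1 by (simp only: abs_mult) simp
        also have "\<dots> \<le> 2 * pi * L * (1 / (real K)\<^sup>2)" using x\<xi>[of j] L1 by (intro mult_left_mono) auto
        also have "\<dots> = 2 * pi / c1" using K by (simp add: L_def)
        also have "\<dots> \<le> 1"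
        proof -
          have "2 * pi * 1 \<le> c1" unfolding c1_def using C0 by (intro mult_left_mono) auto
          then show ?thesis using c1 by simp
        qed
        finally show ?thesis .
      next
        case False
        then have bb: "b = (0, 1)" using b by (auto simp: Basis_prod_def Basis_vec_def)
        have Zb: "Z b = ((\<chi> i. - (L * (2 * v $ i * \<zeta>0 $ i) / a\<^sup>2)), L / a\<^sup>2)"
        proof -
          have "fst b = 0" "snd b = 1" by (simp_all add: bb)
          moreover from this have "(\<Sum>j\<in>UNIV. if \<iota> j = i then fst b $ j / a else 0) = 0" for i
            by (intro sum.neutral) simp
          ultimately show ?thesis unfolding Z_def by simp
        qed
        have q: "quad v \<zeta> = quad v \<zeta>0 + (\<Sum>i\<in>UNIV. 2 * v $ i * \<zeta>0 $ i * \<delta> i) + (\<Sum>i\<in>UNIV. v $ i * (\<delta> i)\<^sup>2)"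
          unfolding quad_def sum.distrib[symmetric] by (intro sum.cong) (auto simp: \<delta>_def power2_eq_square algebra_simps)
        have "(\<omega> - \<omega>0) \<bullet> Z b = L / a\<^sup>2 * ((\<tau> - quad v \<zeta>0) - (\<Sum>i\<in>UNIV. 2 * v $ i * \<zeta>0 $ i * \<delta> i))"
        proof -
          have "(\<omega> - \<omega>0) \<bullet> Z b = (\<Sum>i\<in>UNIV. \<delta> i * (- (L * (2 * v $ i * \<zeta>0 $ i) / a\<^sup>2))) + (\<tau> - quad v \<zeta>0) * (L / a\<^sup>2)"
            unfolding Zb \<omega> \<omega>0_def \<delta>_def inner_vec_def diff_Pair inner_Pair vec_lambda_beta vector_minus_component inner_real_def ..
          also have "(\<Sum>i\<in>UNIV. \<delta> i * (- (L * (2 * v $ i * \<zeta>0 $ i) / a\<^sup>2))) = - (L / a\<^sup>2 * (\<Sum>i\<in>UNIV. 2 * v $ i * \<zeta>0 $ i * \<delta> i))"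
            unfolding sum_distrib_left sum_negf[symmetric] by (intro sum.cong) auto
          finally show ?thesis by (simp add: right_diff_distrib mult.commute)
        qed
        also have "\<dots> = L / a\<^sup>2 * ((\<tau> - quad v \<zeta>) + (\<Sum>i\<in>UNIV. v $ i * (\<delta> i)\<^sup>2))" unfolding q by simp
        also have "(\<Sum>i\<in>UNIV. v $ i * (\<delta> i)\<^sup>2) = (\<Sum>i\<in>range \<iota>. v $ i * (\<delta> i)\<^sup>2) + (\<Sum>i\<in>- range \<iota>. v $ i * (\<delta> i)\<^sup>2)"
          by (subst sum.union_disjoint[symmetric]) (auto intro!: sum.cong)
        also have "(\<Sum>i\<in>range \<iota>. v $ i * (\<delta> i)\<^sup>2) = a\<^sup>2 * (\<Sum>j\<in>UNIV. u $ j * (\<delta> (\<iota> j) / a)\<^sup>2)"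
          using a by (subst sum.reindex[OF inj]) (simp add: u sum_distrib_left power_divide)
        finally have "(\<omega> - \<omega>0) \<bullet> Z b = L * ((\<tau> - quad v \<zeta>) / a\<^sup>2 + (\<Sum>j\<in>UNIV. u $ j * (\<delta> (\<iota> j) / a)\<^sup>2) + (\<Sum>i\<in>- range \<iota>. v $ i * (\<delta> i)\<^sup>2) / a\<^sup>2)"
          using a by (simp add: field_simps)
        moreover have "?P \<xi> \<bullet> b = L * (\<Sum>j\<in>UNIV. u $ j * (\<xi> $ j)\<^sup>2)" by (simp add: bb paraboloid_point_def)
        ultimately have eq: "(\<omega> - \<omega>0) \<bullet> Z b - ?P \<xi> \<bullet> b = L * ((\<tau> - quad v \<zeta>) / a\<^sup>2
            + (\<Sum>j\<in>UNIV. u $ j * ((\<delta> (\<iota> j) / a)\<^sup>2 - (\<xi> $ j)\<^sup>2)) + (\<Sum>i\<in>- range \<iota>. v $ i * (\<delta> i)\<^sup>2) / a\<^sup>2)"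
        proof -
          have 1: "(\<Sum>j\<in>UNIV. u $ j * ((\<delta> (\<iota> j) / a)\<^sup>2 - (\<xi> $ j)\<^sup>2)) = (\<Sum>j\<in>UNIV. u $ j * (\<delta> (\<iota> j) / a)\<^sup>2) - (\<Sum>j\<in>UNIV. u $ j * (\<xi> $ j)\<^sup>2)"
            unfolding right_diff_distrib sum_subtractf ..
          have 2: "X - Y = L * (A + (B - D) + E)" if "X = L * (A + B + E)" "Y = L * D" for X Y A B D E :: real
            using that by (simp add: algebra_simps)
          show "(\<omega> - \<omega>0) \<bullet> Z b = L * ((\<tau> - quad v \<zeta>) / a\<^sup>2 + (\<Sum>j\<in>UNIV. u $ j * (\<delta> (\<iota> j) / a)\<^sup>2) + (\<Sum>i\<in>- range \<iota>. v $ i * (\<delta> i)\<^sup>2) / a\<^sup>2) \<Longrightarrow>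
            ?P \<xi> \<bullet> b = L * (\<Sum>j\<in>UNIV. u $ j * (\<xi> $ j)\<^sup>2) \<Longrightarrow> ?thesis"
            unfolding 1 by (rule 2)
        qed
        let ?k = "1 / (real K)\<^sup>2"
        have b1: "\<bar>(\<tau> - quad v \<zeta>) / a\<^sup>2\<bar> \<le> C0 * ?k"
        proof -
          have "\<rho>\<^sup>2 * (real K)\<^sup>2 \<le> a\<^sup>2"
          proof -
            have "1 * 1 \<le> real K * real_of_int T" using K1 T by (intro mult_mono) auto
            then have "\<rho> * real K * 1 \<le> \<rho> * real K * (real K * T)" using \<rho> by (intro mult_left_mono) auto
            also have "\<dots> = a" by (simp add: a_def power2_eq_square)
            finally have "(\<rho> * real K)\<^sup>2 \<le> a\<^sup>2" using \<rho> by (intro power_mono) auto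
            then show ?thesis by (simp add: power_mult_distrib)
          qed
          then have "\<rho>\<^sup>2 \<le> a\<^sup>2 * ?k" using K by (simp add: field_simps)
          then have "C0 * \<rho>\<^sup>2 \<le> C0 * (a\<^sup>2 * ?k)" using C0 by (rule mult_left_mono)
          then have "\<bar>\<tau> - quad v \<zeta>\<bar> \<le> (C0 * ?k) * a\<^sup>2" using supp Gnz unfolding near_paraboloid_def by (fastforce simp: mult_ac)
          then show ?thesis using a by (simp add: pos_divide_le_eq)
        qed
        have b2: "\<bar>\<Sum>j\<in>UNIV. u $ j * ((\<delta> (\<iota> j) / a)\<^sup>2 - (\<xi> $ j)\<^sup>2)\<bar> \<le> ?n * (2 * ?k)"
        proof -
          have "\<bar>u $ j * ((\<delta> (\<iota> j) / a)\<^sup>2 - (\<xi> $ j)\<^sup>2)\<bar> \<le> 2 * ?k" for j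
          proof -
            have x: "0 \<le> \<delta> (\<iota> j) / a" "\<delta> (\<iota> j) / a \<le> 1"
              using \<delta>[of "\<iota> j"] a by (auto simp: a_def t_def s_def mult_ac)
            have y: "0 \<le> \<xi> $ j" "\<xi> $ j \<le> 1" using Tsub[OF k] \<xi> by (auto simp: unit_cube_def)
            have "\<bar>(\<delta> (\<iota> j) / a)\<^sup>2 - (\<xi> $ j)\<^sup>2\<bar> = \<bar>\<delta> (\<iota> j) / a + \<xi> $ j\<bar> * \<bar>\<delta> (\<iota> j) / a - \<xi> $ j\<bar>"
              unfolding power2_eq_square square_diff_square_factored abs_mult ..
            also have "\<dots> \<le> 2 * ?k" using x y x\<xi>[of j] by (intro mult_mono) auto
            finally have "\<bar>u $ j\<bar> * \<bar>(\<delta> (\<iota> j) / a)\<^sup>2 - (\<xi> $ j)\<^sup>2\<bar> \<le> 1 * (2 * ?k)"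
              using v[of "\<iota> j"] u[of j] by (intro mult_mono) auto
            then show ?thesis by (simp add: abs_mult)
          qed
          then have "(\<Sum>j\<in>UNIV. \<bar>u $ j * ((\<delta> (\<iota> j) / a)\<^sup>2 - (\<xi> $ j)\<^sup>2)\<bar>) \<le> (\<Sum>j\<in>(UNIV::'n set). 2 * ?k)" by (intro sum_mono)
          then show ?thesis by (intro order_trans[OF sum_abs]) simp
        qed
        have b3: "\<bar>(\<Sum>i\<in>- range \<iota>. v $ i * (\<delta> i)\<^sup>2) / a\<^sup>2\<bar> \<le> real CARD('k) * ?k"
        proof -
          have "\<bar>v $ i * (\<delta> i)\<^sup>2\<bar> \<le> a\<^sup>2 * ?k" if "i \<in> - range \<iota>" for i
          proof -
            have "\<delta> i \<le> \<rho> * (real K * T)" using \<delta>(2)[of i] that by (simp add: t_def s_def)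
            then have "(\<delta> i)\<^sup>2 \<le> (\<rho> * (real K * T))\<^sup>2" using \<delta>(1)[of i] by (intro power_mono)
            also have "\<dots> = a\<^sup>2 * ?k" using K by (simp add: a_def power2_eq_square field_simps)
            finally have "\<bar>v $ i\<bar> * (\<delta> i)\<^sup>2 \<le> 1 * (a\<^sup>2 * ?k)" using v[of i] by (intro mult_mono) auto
            then show ?thesis by (simp add: abs_mult)
          qed
          then have "\<bar>\<Sum>i\<in>- range \<iota>. v $ i * (\<delta> i)\<^sup>2\<bar> \<le> (\<Sum>i\<in>- range \<iota>. a\<^sup>2 * ?k)"
            by (intro order_trans[OF sum_abs] sum_mono)
          also have "\<dots> \<le> (\<Sum>i\<in>(UNIV::'k set). a\<^sup>2 * ?k)" by (intro sum_mono2) auto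
          also have "\<dots> = real CARD('k) * ?k * a\<^sup>2" by simp
          finally show ?thesis using a by (simp add: pos_divide_le_eq)
        qed
        have "\<bar>2 * pi * ((\<omega> - \<omega>0) \<bullet> Z b - ?P \<xi> \<bullet> b)\<bar> = 2 * pi * L * \<bar>(\<tau> - quad v \<zeta>) / a\<^sup>2
            + (\<Sum>j\<in>UNIV. u $ j * ((\<delta> (\<iota> j) / a)\<^sup>2 - (\<xi> $ j)\<^sup>2)) + (\<Sum>i\<in>- range \<iota>. v $ i * (\<delta> i)\<^sup>2) / a\<^sup>2\<bar>"
          unfolding eq using L1 by (simp add: abs_mult)
        also have "\<dots> \<le> 2 * pi * L * (C0 * ?k + ?n * (2 * ?k) + real CARD('k) * ?k)"
          using b1 b2 b3 L1 by (intro mult_left_mono) (linarith, simp)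
        also have "\<dots> = 2 * pi * (C0 + real CARD('k) + 2 * ?n) / c1"
        proof -
          have "L * ?k = 1 / c1" using K by (simp add: L_def)
          moreover have "2 * pi * L * (C0 * ?k + ?n * (2 * ?k) + real CARD('k) * ?k) = 2 * pi * (C0 + real CARD('k) + 2 * ?n) * (L * ?k)"
            by (simp only: ring_distribs mult_ac)
          ultimately show ?thesis by simp
        qed
        also have "\<dots> \<le> 1"
        proof -
          have "2 * pi * (C0 + real CARD('k) + 2 * ?n) \<le> c1" unfolding c1_def by (intro mult_left_mono) auto
          then show ?thesis using c1 by simp
        qed
        finally show ?thesis .
      qed
    qed
    have FTeq: "inv_FT (cell_part \<rho> (\<lambda>i. t i * s i) m G) = (\<lambda>x. \<Sum>k\<in>I. inv_FT (cell_part \<rho> t k G) x)"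
      unfolding cell_part_split[OF \<rho> t s] I_def using \<rho> t s G
      by (intro inv_FT_sum finite_subcells integrable_cell_part)
    let ?Sum = "\<Sum>k\<in>I. Lp_pow p (inv_FT (cell_part \<rho> t k G))"
    let ?F = "Lp_pow p (inv_FT (cell_part \<rho> (\<lambda>i. t i * s i) m G))"
    have "ennreal (\<mu> powr p) * ?F \<le> ennreal (\<mu> powr p * 2 ^ DIM((real^'n) \<times> real)) * ?F"
    proof (intro mult_right_mono ennreal_leI)
      have "1 \<le> (2::real) ^ DIM((real^'n) \<times> real)" by (rule one_le_power) simp
      then show "\<mu> powr p \<le> \<mu> powr p * 2 ^ DIM((real^'n) \<times> real)"
        by (metis mult.right_neutral mult_left_mono powr_ge_zero)
    qed simp
    also have "\<dots> \<le> ennreal (M powr p) * ennreal D * ?Sum"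
      using main unfolding FTeq .
    finally have le: "ennreal (\<mu> powr p) * ?F \<le> ennreal (M powr p * D) * ?Sum" using D by (simp add: ennreal_mult)
    have "?F = ennreal (\<mu> powr (- p)) * (ennreal (\<mu> powr p) * ?F)"
    proof -
      have "ennreal (\<mu> powr (- p)) * ennreal (\<mu> powr p) = 1" using \<mu> by (simp flip: ennreal_mult powr_add)
      then show ?thesis by (simp flip: mult.assoc)
    qed
    also have "\<dots> \<le> ennreal (\<mu> powr (- p)) * (ennreal (M powr p * D) * ?Sum)"
      using le by (rule mult_left_mono) simp
    also have "\<dots> = ennreal (\<mu> powr (- p) * (M powr p * D)) * ?Sum" using D by (simp add: ennreal_mult mult.assoc)
    also have "\<dots> \<le> ennreal (C' * real K powr (2 * (?n * (p / 2 - 1) + \<epsilon>))) * ?Sum"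
    proof (intro mult_right_mono ennreal_leI)
      have \<mu>K: "\<mu> = real K powr (- 2 * ?n)"
      proof -
        have "\<mu> = inverse (real K ^ (2 * CARD('n)))" by (simp only: \<mu>_def power_mult divide_inverse power_inverse mult_1)
        also have "\<dots> = inverse (real K powr real (2 * CARD('n)))" using K by (subst powr_realpow) auto
        also have "\<dots> = real K powr (- 2 * ?n)" by (simp add: powr_minus)
        finally show ?thesis .
      qed
      have LK: "L powr (\<epsilon> - ?n * p / 2) \<le> c1 powr (?n * p / 2) * real K powr (2 * (\<epsilon> - ?n * p / 2))"
      proof -
        have "L powr (\<epsilon> - ?n * p / 2) = c1 powr (- (\<epsilon> - ?n * p / 2)) * ((real K)\<^sup>2) powr (\<epsilon> - ?n * p / 2)"
        proof -
          have "(x / y) powr a = y powr (- a) * x powr a" if "x \<ge> 0" "y > 0" for x y a :: real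
            using that by (simp add: powr_divide powr_minus_divide)
          then show ?thesis unfolding L_def using c1 by simp
        qed
        also have "((real K)\<^sup>2) powr (\<epsilon> - ?n * p / 2) = real K powr (2 * (\<epsilon> - ?n * p / 2))"
        proof -
          have "(real K)\<^sup>2 = real K powr 2" using K by simp
          then show ?thesis by (simp only: powr_powr)
        qed
        also have "c1 powr (- (\<epsilon> - ?n * p / 2)) \<le> c1 powr (?n * p / 2)" using c1 \<epsilon> by (intro powr_mono) auto
        finally show ?thesis by (simp add: mult_right_mono)
      qed
      have "\<mu> powr (- p) * (M powr p * D) = M powr p * C * L powr (\<epsilon> - ?n * p / 2) * (\<mu> powr (- p) * \<mu> powr 1)"
        using \<mu> by (simp add: D_def mult_ac)
      also have "\<mu> powr (- p) * \<mu> powr 1 = real K powr (- 2 * ?n * (1 - p))"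
        unfolding powr_add[symmetric] unfolding \<mu>K by (simp add: powr_powr)
      also have "M powr p * C * L powr (\<epsilon> - ?n * p / 2) * real K powr (- 2 * ?n * (1 - p))
         \<le> M powr p * C * (c1 powr (?n * p / 2) * real K powr (2 * (\<epsilon> - ?n * p / 2))) * real K powr (- 2 * ?n * (1 - p))"
        using LK C by (intro mult_right_mono mult_left_mono) auto
      also have "\<dots> = C' * (real K powr (2 * (\<epsilon> - ?n * p / 2)) * real K powr (- 2 * ?n * (1 - p)))"
        by (simp add: C'_def mult_ac)
      also have "real K powr (2 * (\<epsilon> - ?n * p / 2)) * real K powr (- 2 * ?n * (1 - p)) = real K powr (2 * (?n * (p / 2 - 1) + \<epsilon>))"
        unfolding powr_add[symmetric] by (rule arg_cong[where f = "\<lambda>x. real K powr x"]) (simp add: field_simps)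
      finally show "\<mu> powr (- p) * (M powr p * D) \<le> C' * real K powr (2 * (?n * (p / 2 - 1) + \<epsilon>))" .
    qed simp
    finally show ?thesis unfolding I_def t_def s_def .
  qed
  show thesis
    by (rule that[OF C']) (unfold step_bound_def, intro allI impI, rule step)
qed

section \<open>Iteration over scales\<close>

definition staggered_scale :: "'k set \<Rightarrow> nat \<Rightarrow> nat \<Rightarrow> 'k \<Rightarrow> int" where
  "staggered_scale A K j = (\<lambda>i. if i \<in> A then int K ^ (j + 1) else int K ^ j)"

text \<open>
  Steps for \<open>A\<close> and for its complement alternate: a step in the directions of \<open>A\<close> takes the sides
  \<open>K^(j + 2)\<close> and \<open>K^(j + 1)\<close> to \<open>K^j\<close> and \<open>K^(j + 1)\<close>, which is the scale \<open>j\<close> with the two halves exchanged. At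
  \<open>j = 0\<close> the longer sides \<open>K\<close> are cut trivially.
\<close>

lemma iterated_steps:
  fixes A :: "'k::finite set"
  assumes K: "K > 0" and \<rho>: "\<rho> > 0" and G: "integrable lborel G" and p: "p > 1" and X: "X \<ge> 0"
    and "step_bound A K X p \<rho> G" "step_bound (- A) K X p \<rho> G"
  shows "Lp_pow p (inv_FT (cell_part \<rho> (staggered_scale A K j) m G))
     \<le> ennreal (X ^ j * (real K ^ CARD('k)) powr (p - 1)) * (\<Sum>k\<in>subcells (staggered_scale A K j) m. Lp_pow p (inv_FT (cell_part \<rho> (\<lambda>_. 1) k G)))"
  using assms(6,7)
proof (induction j arbitrary: A m)
  case 0
  have eq: "staggered_scale A K 0 = (\<lambda>i. 1 * (if i \<in> A then int K else 1))" by (auto simp: staggered_scale_def)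
  show ?case unfolding eq
    using trivial_split[OF \<rho> _ _ G p, of "\<lambda>_. 1" "\<lambda>i. if i \<in> A then int K else 1" "int K" m] K
    by simp
next
  case (Suc j)
  let ?T = "int K ^ j"
  let ?t = "\<lambda>i. if i \<in> A then ?T else int K * ?T"
  let ?s = "\<lambda>i. if i \<in> A then (int K)\<^sup>2 else 1"
  let ?Y = "(real K ^ CARD('k)) powr (p - 1)"
  let ?f = "\<lambda>k. Lp_pow p (inv_FT (cell_part \<rho> (\<lambda>_. 1) k G))"
  have t: "?t = staggered_scale (- A) K j" by (auto simp: staggered_scale_def)
  have ts: "staggered_scale A K (Suc j) = (\<lambda>i. ?t i * ?s i)" by (auto simp: staggered_scale_def power2_eq_square)
  have pos: "?t i > 0" "?s i > 0" for i using K by auto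
  have "Lp_pow p (inv_FT (cell_part \<rho> (staggered_scale A K (Suc j)) m G)) \<le> ennreal X * (\<Sum>k\<in>subcells ?s m. Lp_pow p (inv_FT (cell_part \<rho> ?t k G)))"
    unfolding ts using Suc.prems(1) K unfolding step_bound_def by simp
  also have "\<dots> \<le> ennreal X * (\<Sum>k\<in>subcells ?s m. ennreal (X ^ j * ?Y) * (\<Sum>k'\<in>subcells ?t k. ?f k'))"
    unfolding t using Suc.prems by (intro mult_left_mono sum_mono Suc.IH) auto
  also have "\<dots> = ennreal (X ^ Suc j * ?Y) * (\<Sum>k\<in>subcells ?s m. \<Sum>k'\<in>subcells ?t k. ?f k')"
    using X by (simp add: sum_distrib_left ennreal_mult mult.assoc)
  also have "(\<Sum>k\<in>subcells ?s m. \<Sum>k'\<in>subcells ?t k. ?f k') = (\<Sum>k'\<in>subcells (staggered_scale A K (Suc j)) m. ?f k')"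
    unfolding ts subcells_mult[OF pos(2,1)]
    using pos finite_subcells[of ?s] finite_subcells[of ?t]
    by (intro sum.UNION_disjoint[symmetric]) (auto simp: disjoint_subcells)
  finally show ?case .
qed

lemma coarse_split:
  fixes t :: "'k::finite \<Rightarrow> int" and \<rho> :: real
  assumes \<rho>: "\<rho> > 0" and t: "\<And>i. t i > 0" "\<And>i. \<rho> * t i \<ge> 1" and G: "integrable lborel G" and p: "p > 1"
    and supp: "\<And>\<zeta> \<tau> i. G (\<zeta>, \<tau>) \<noteq> 0 \<Longrightarrow> -1 \<le> \<zeta> $ i \<and> \<zeta> $ i \<le> 2"
  shows "Lp_pow p (inv_FT G) \<le> ennreal ((4 ^ CARD('k)) powr (p - 1)) * (\<Sum>m\<in>PiE UNIV (\<lambda>_. {-1..2}). Lp_pow p (inv_FT (cell_part \<rho> t m G)))"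
proof -
  let ?I = "PiE UNIV (\<lambda>_. {-1..2}) :: ('k \<Rightarrow> int) set"
  have fin: "finite ?I" by (intro finite_PiE) auto
  have card: "card ?I = 4 ^ CARD('k)" by (simp add: card_PiE)
  have mem: "cell \<rho> t \<zeta> \<in> ?I" if "G (\<zeta>, \<tau>) \<noteq> 0" for \<zeta> \<tau>
  proof -
    have "cell \<rho> t \<zeta> i \<in> {-1..2}" for i
    proof -
      let ?m = "cell \<rho> t \<zeta> i" and ?r = "\<rho> * t i"
      have c: "?r * ?m \<le> \<zeta> $ i" "\<zeta> $ i < ?r * (?m + 1)"
        using cell_iff[of \<rho> t \<zeta> "cell \<rho> t \<zeta>"] \<rho> t by auto
      have b: "-1 \<le> \<zeta> $ i" "\<zeta> $ i \<le> 2" using supp[OF that] by auto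
      have "-1 \<le> ?m"
      proof (rule ccontr)
        assume "\<not> -1 \<le> ?m"
        then have "real_of_int ?m + 1 \<le> -1" by linarith
        then have "?r * (real_of_int ?m + 1) \<le> ?r * (-1)" using t(2)[of i] by (intro mult_left_mono) auto
        then show False using c b t(2)[of i] by simp
      qed
      moreover have "?m \<le> 2"
      proof (rule ccontr)
        assume "\<not> ?m \<le> 2"
        then have "3 \<le> real_of_int ?m" by linarith
        then have "?r * 3 \<le> ?r * real_of_int ?m" using t(2)[of i] by (intro mult_left_mono) auto
        then show False using c b t(2)[of i] by simp
      qed
      ultimately show ?thesis by simp
    qed
    then show ?thesis by auto
  qed
  have "G = (\<lambda>\<omega>. \<Sum>m\<in>?I. cell_part \<rho> t m G \<omega>)"
  proof
    fix \<omega> :: "(real^'k) \<times> real"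
    show "G \<omega> = (\<Sum>m\<in>?I. cell_part \<rho> t m G \<omega>)"
      using fin mem[of "fst \<omega>" "snd \<omega>"] by (auto simp: cell_part_def sum.delta')
  qed
  then have "Lp_pow p (inv_FT G) = Lp_pow p (inv_FT (\<lambda>\<omega>. \<Sum>m\<in>?I. cell_part \<rho> t m G \<omega>))" by simp
  also have "\<dots> = Lp_pow p (\<lambda>x. \<Sum>m\<in>?I. inv_FT (cell_part \<rho> t m G) x)"
    using fin \<rho> t G by (subst inv_FT_sum) (auto intro!: integrable_cell_part)
  also have "\<dots> \<le> ennreal (real (card ?I) powr (p - 1)) * (\<Sum>m\<in>?I. Lp_pow p (inv_FT (cell_part \<rho> t m G)))"
    using fin \<rho> t G p by (intro Lp_pow_sum_le borel_measurable_inv_FT integrable_cell_part) auto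
  finally show ?thesis unfolding card by simp
qed

text \<open>
  About \<open>log R / (2 * log K)\<close> steps lead from boxes of side 1 to boxes of side \<open>R powr (- 1/2)\<close>. A step costs
  a constant times a power of \<open>K\<close> with the correct exponent; taking \<open>K\<close> large, but independent of \<open>R\<close>, the
  constant is absorbed into \<open>K powr (2 * \<delta>)\<close>, so that the product of all costs is the correct power of \<open>R\<close> up to
  the factor \<open>R powr \<epsilon>\<close>. The bounds \<open>-1\<close> and 2 leave room for the neighborhood of the unit cube.
\<close>

theorem fine_scale_decoupling:
  fixes v :: "real^'k" and u u' :: "real^'n" and \<iota> \<iota>' :: "'n \<Rightarrow> 'k"
  assumes inj: "inj \<iota>" "inj \<iota>'" and rng: "range \<iota>' = - range \<iota>"
    and u: "\<And>j. u $ j = v $ \<iota> j" "\<And>j. u' $ j = v $ \<iota>' j" and v: "\<And>i. \<bar>v $ i\<bar> \<le> 1"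
    and rc: "restriction_conjecture u" "restriction_conjecture u'"
    and p: "2 \<le> p" "p \<le> 2 + 2 / real CARD('n)" and \<epsilon>: "\<epsilon> > 0" and C0: "C0 \<ge> 0"
  obtains C where "C > 0"
    "\<And>R G. \<lbrakk>R \<ge> 1; integrable lborel G; near_paraboloid v (C0 / R) G;
       \<And>\<zeta> \<tau> i. G (\<zeta>, \<tau>) \<noteq> 0 \<Longrightarrow> -1 \<le> \<zeta> $ i \<and> \<zeta> $ i \<le> 2\<rbrakk> \<Longrightarrow>
       \<exists>M. finite M \<and> Lp_pow p (inv_FT G) \<le> ennreal (C * R powr (real CARD('n) * (p / 2 - 1) + \<epsilon>)) *
          (\<Sum>m\<in>M. Lp_pow p (inv_FT (cell_part (R powr (- (1/2))) (\<lambda>_. 1) m G)))"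
proof -
  let ?n = "real CARD('n)"
  define \<delta> where "\<delta> = \<epsilon> / 2"
  have \<delta>: "\<delta> > 0" using \<epsilon> by (simp add: \<delta>_def)
  define \<beta> where "\<beta> = ?n * (p / 2 - 1)"
  have \<beta>: "\<beta> \<ge> 0" using p by (simp add: \<beta>_def)
  obtain C1 c1 where C1: "C1 > 0" and s1: "\<And>(K::nat) \<rho> G. \<lbrakk>real K \<ge> c1; K > 0; \<rho> > 0; integrable lborel G; near_paraboloid v (C0 * \<rho>\<^sup>2) G\<rbrakk> \<Longrightarrow>
      step_bound (range \<iota>) K (C1 * real K powr (2 * (?n * (p / 2 - 1) + \<delta>))) p \<rho> G"
    by (rule decoupling_step[OF inj(1) u(1) v rc(1) p \<delta> C0]) blast
  obtain C2 c2 where C2: "C2 > 0" and s2: "\<And>(K::nat) \<rho> G. \<lbrakk>real K \<ge> c2; K > 0; \<rho> > 0; integrable lborel G; near_paraboloid v (C0 * \<rho>\<^sup>2) G\<rbrakk> \<Longrightarrow>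
      step_bound (range \<iota>') K (C2 * real K powr (2 * (?n * (p / 2 - 1) + \<delta>))) p \<rho> G"
    by (rule decoupling_step[OF inj(2) u(2) v rc(2) p \<delta> C0]) blast
  define C3 where "C3 = max C1 C2"
  define K where "K = nat \<lceil>max (max c1 c2) (max 2 (C3 powr (1 / (2 * \<delta>))))\<rceil>"
  have "max (max c1 c2) (max 2 (C3 powr (1 / (2 * \<delta>)))) \<le> real K" unfolding K_def by (rule real_nat_ceiling_ge)
  then have K: "c1 \<le> real K" "c2 \<le> real K" "2 \<le> real K" "C3 powr (1 / (2 * \<delta>)) \<le> real K" by auto
  have C3: "C3 > 0" using C1 by (simp add: C3_def less_max_iff_disj)
  have C3K: "C3 \<le> real K powr (2 * \<delta>)"
  proof -
    have "C3 = (C3 powr (1 / (2 * \<delta>))) powr (2 * \<delta>)" using C3 \<delta> by (simp add: powr_powr)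
    also have "\<dots> \<le> real K powr (2 * \<delta>)" using K \<delta> by (intro powr_mono2) auto
    finally show ?thesis .
  qed
  define X where "X = real K powr (2 * (\<beta> + \<epsilon>))"
  have X: "C1 * real K powr (2 * (?n * (p / 2 - 1) + \<delta>)) \<le> X" "C2 * real K powr (2 * (?n * (p / 2 - 1) + \<delta>)) \<le> X"
  proof -
    have "C3 * real K powr (2 * (\<beta> + \<delta>)) \<le> real K powr (2 * \<delta>) * real K powr (2 * (\<beta> + \<delta>))"
      using C3K by (intro mult_right_mono) auto
    also have "\<dots> = X" unfolding X_def powr_add[symmetric] by (simp add: \<delta>_def algebra_simps)
    finally have "C3 * real K powr (2 * (\<beta> + \<delta>)) \<le> X" .
    moreover have "C1 * real K powr (2 * (\<beta> + \<delta>)) \<le> C3 * real K powr (2 * (\<beta> + \<delta>))" "C2 * real K powr (2 * (\<beta> + \<delta>)) \<le> C3 * real K powr (2 * (\<beta> + \<delta>))"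
      by (auto simp: C3_def intro!: mult_right_mono)
    ultimately show "C1 * real K powr (2 * (?n * (p / 2 - 1) + \<delta>)) \<le> X" "C2 * real K powr (2 * (?n * (p / 2 - 1) + \<delta>)) \<le> X"
      unfolding \<beta>_def by auto
  qed
  let ?Y = "(real K ^ CARD('k)) powr (p - 1)"
  let ?W = "(4 ^ CARD('k)) powr (p - 1) :: real"
  define C where "C = ?W * (real K powr (2 * (\<beta> + \<epsilon>)) * ?Y)"
  have C: "C > 0" using K by (simp add: C_def)
  have main: "\<exists>M. finite M \<and> Lp_pow p (inv_FT G) \<le> ennreal (C * R powr (?n * (p / 2 - 1) + \<epsilon>)) *
          (\<Sum>m\<in>M. Lp_pow p (inv_FT (cell_part (R powr (- (1/2))) (\<lambda>_. 1) m G)))"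
    if R: "R \<ge> 1" and G: "integrable lborel G" and s: "near_paraboloid v (C0 / R) G"
      and bd: "\<And>\<zeta> \<tau> i. G (\<zeta>, \<tau>) \<noteq> 0 \<Longrightarrow> -1 \<le> \<zeta> $ i \<and> \<zeta> $ i \<le> 2" for R G
  proof -
    define \<rho> where "\<rho> = R powr (- (1/2))"
    have \<rho>: "\<rho> > 0" using R by (simp add: \<rho>_def)
    have \<rho>2: "\<rho>\<^sup>2 = 1 / R"
    proof -
      have "\<rho>\<^sup>2 = R powr (- (1/2) + - (1/2))" unfolding \<rho>_def power2_eq_square powr_add ..
      then show ?thesis using R by (simp add: powr_minus_divide)
    qed
    have s': "near_paraboloid v (C0 * \<rho>\<^sup>2) G" using s by (simp add: \<rho>2)
    have K0: "K > 0" using K(3) by (cases K) auto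
    define J where "J = nat \<lceil>log (real K) (1 / \<rho>)\<rceil>"
    have r1: "1 / \<rho> = R powr (1/2)" using R by (simp add: \<rho>_def powr_minus_divide)
    have r1': "1 / \<rho> \<ge> 1" unfolding r1 using R by (intro ge_one_powr_ge_zero) auto
    have J1: "1 / \<rho> \<le> real K ^ J"
    proof -
      have "log (real K) (1 / \<rho>) \<le> real J" unfolding J_def by (rule real_nat_ceiling_ge)
      then have "1 / \<rho> \<le> real K powr real J" using K(3) r1' \<rho> by (subst (asm) log_le_iff) auto
      then show ?thesis using K0 by (simp add: powr_realpow)
    qed
    have J2: "real K ^ J \<le> real K * R powr (1/2)"
    proof -
      have "0 \<le> log (real K) (1 / \<rho>)" using K(3) r1' \<rho> by (intro zero_le_log_cancel_iff[THEN iffD2]) auto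
      then have "real J \<le> log (real K) (1 / \<rho>) + 1" unfolding J_def by linarith
      then have "real K powr real J \<le> real K powr (log (real K) (1 / \<rho>) + 1)" using K(3) by (intro powr_mono) auto
      also have "\<dots> = (1 / \<rho>) * real K" using K(3) \<rho> by (subst powr_add) (simp add: powr_log_cancel)
      finally show ?thesis using K0 by (simp add: powr_realpow r1 mult.commute)
    qed
    let ?A = "range \<iota>"
    have b: "step_bound ?A K X p \<rho> G" "step_bound (- ?A) K X p \<rho> G"
      using step_bound_mono[OF s1[OF K(1) K0 \<rho> G s'] X(1)] step_bound_mono[OF s2[OF K(2) K0 \<rho> G s'] X(2)]
      by (simp_all add: rng)
    let ?t = "staggered_scale ?A K J"
    let ?I = "PiE UNIV (\<lambda>_. {-1..2}) :: ('k \<Rightarrow> int) set"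
    let ?f = "\<lambda>k. Lp_pow p (inv_FT (cell_part \<rho> (\<lambda>_. 1) k G))"
    have t: "?t i > 0" for i using K0 by (simp add: staggered_scale_def)
    have t1: "\<rho> * ?t i \<ge> 1" for i
    proof -
      have "1 \<le> \<rho> * real K ^ J" using J1 \<rho> by (simp add: pos_divide_le_eq mult.commute)
      also have "\<dots> \<le> \<rho> * ?t i"
      proof -
        have "1 * real K ^ J \<le> real K * real K ^ J" using K(3) by (intro mult_right_mono) auto
        then show ?thesis using \<rho> by (auto simp: staggered_scale_def)
      qed
      finally show ?thesis .
    qed
    have p1: "p > 1" using p by simp
    define M where "M = (\<Union>m\<in>?I. subcells ?t m)"
    have finI: "finite ?I" by (intro finite_PiE) auto
    have fs: "finite (subcells ?t m)" for m by (rule finite_subcells) (rule t)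
    have "finite M" unfolding M_def using finI fs by blast
    moreover have "Lp_pow p (inv_FT G) \<le> ennreal (C * R powr (?n * (p / 2 - 1) + \<epsilon>)) * (\<Sum>m\<in>M. ?f m)"
    proof -
      have "Lp_pow p (inv_FT G) \<le> ennreal ?W * (\<Sum>m\<in>?I. Lp_pow p (inv_FT (cell_part \<rho> ?t m G)))"
        by (rule coarse_split[OF \<rho> t t1 G p1 bd])
      also have "\<dots> \<le> ennreal ?W * (\<Sum>m\<in>?I. ennreal (X ^ J * ?Y) * (\<Sum>k\<in>subcells ?t m. ?f k))"
        by (intro mult_left_mono sum_mono iterated_steps[OF K0 \<rho> G p1 _ b]) (auto simp: X_def)
      also have "\<dots> = ennreal (?W * (X ^ J * ?Y)) * (\<Sum>m\<in>?I. \<Sum>k\<in>subcells ?t m. ?f k)"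
        by (simp add: X_def sum_distrib_left ennreal_mult mult.assoc)
      also have "(\<Sum>m\<in>?I. \<Sum>k\<in>subcells ?t m. ?f k) = (\<Sum>m\<in>M. ?f m)"
        unfolding M_def using finI fs
        by (intro sum.UNION_disjoint[symmetric]) (auto simp: disjoint_subcells)
      also have "ennreal (?W * (X ^ J * ?Y)) * (\<Sum>m\<in>M. ?f m) \<le> ennreal (C * R powr (?n * (p / 2 - 1) + \<epsilon>)) * (\<Sum>m\<in>M. ?f m)"
      proof (intro mult_right_mono ennreal_leI)
        have "X ^ J = (real K ^ J) powr (2 * (\<beta> + \<epsilon>))"
          unfolding X_def using K0 by (simp add: powr_powr mult.commute flip: powr_realpow)
        also have "\<dots> \<le> (real K * R powr (1/2)) powr (2 * (\<beta> + \<epsilon>))"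
          using J2 \<beta> \<epsilon> by (intro powr_mono2) auto
        also have "\<dots> = real K powr (2 * (\<beta> + \<epsilon>)) * R powr (\<beta> + \<epsilon>)"
        proof -
          have "1 / 2 * (2 * (\<beta> + \<epsilon>)) = \<beta> + \<epsilon>" by simp
          then show ?thesis by (simp only: powr_mult powr_powr of_nat_0_le_iff powr_ge_zero)
        qed
        finally have "?W * (X ^ J * ?Y) \<le> ?W * ((real K powr (2 * (\<beta> + \<epsilon>)) * R powr (\<beta> + \<epsilon>)) * ?Y)"
          by (intro mult_left_mono mult_right_mono) auto
        then show "?W * (X ^ J * ?Y) \<le> C * R powr (?n * (p / 2 - 1) + \<epsilon>)" by (simp add: C_def \<beta>_def mult_ac)
      qed simp
      finally show ?thesis .
    qed
    ultimately show ?thesis unfolding \<rho>_def by blast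
  qed
  show thesis by (rule that[OF C main])
qed

section \<open>From boxes to caps\<close>

text \<open>
  Moving by at most \<open>1 / R\<close> from a point of the unit cube changes the square of each coordinate by at most
  \<open>3 / R\<close>, because the sum of the two coordinates is at most 3.
\<close>

lemma nbhd_paraboloid_subset:
  fixes v :: "real^'k"
  assumes v: "\<And>i. \<bar>v $ i\<bar> \<le> 1" and R: "R \<ge> 1" and x: "(\<zeta>, \<tau>) \<in> nbhd (paraboloid v) (1 / R)"
  shows "\<bar>\<tau> - quad v \<zeta>\<bar> \<le> (1 + 3 * real CARD('k)) / R" "-1 \<le> \<zeta> $ i" "\<zeta> $ i \<le> 2"
proof -
  obtain \<eta> where \<eta>: "\<eta> \<in> unit_cube" "dist (\<zeta>, \<tau>) (\<eta>, quad v \<eta>) < 1 / R"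
    using x by (auto simp: nbhd_def paraboloid_def paraboloid_point_def quad_def)
  have R1: "1 / R \<le> 1" using R by simp
  have d1: "\<bar>\<zeta> $ j - \<eta> $ j\<bar> \<le> 1 / R" for j
  proof -
    have "\<bar>\<zeta> $ j - \<eta> $ j\<bar> \<le> norm (\<zeta> - \<eta>)" using component_le_norm_cart[of "\<zeta> - \<eta>" j] by simp
    also have "\<dots> \<le> dist (\<zeta>, \<tau>) (\<eta>, quad v \<eta>)" using dist_fst_le[of "(\<zeta>, \<tau>)" "(\<eta>, quad v \<eta>)"] by (simp add: dist_norm)
    finally show ?thesis using \<eta>(2) by simp
  qed
  have d2: "\<bar>\<tau> - quad v \<eta>\<bar> \<le> 1 / R"
    using dist_snd_le[of "(\<zeta>, \<tau>)" "(\<eta>, quad v \<eta>)"] \<eta>(2) by (simp add: dist_real_def)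
  have cube: "0 \<le> \<eta> $ j" "\<eta> $ j \<le> 1" for j using \<eta>(1) by (auto simp: unit_cube_def)
  show bd: "-1 \<le> \<zeta> $ i" "\<zeta> $ i \<le> 2" for i using d1[of i] cube[of i] R1 by linarith+
  have "\<bar>quad v \<eta> - quad v \<zeta>\<bar> \<le> (\<Sum>j\<in>(UNIV::'k set). 3 * (1 / R))"
    unfolding quad_def sum_subtractf[symmetric]
  proof (intro order_trans[OF sum_abs] sum_mono)
    fix j
    have "\<bar>\<eta> $ j + \<zeta> $ j\<bar> \<le> 3" using cube[of j] bd[of j] by linarith
    moreover have "\<bar>\<eta> $ j - \<zeta> $ j\<bar> \<le> 1 / R" using d1[of j] by (simp add: abs_minus_commute)
    ultimately have "\<bar>\<eta> $ j + \<zeta> $ j\<bar> * \<bar>\<eta> $ j - \<zeta> $ j\<bar> \<le> 3 * (1 / R)" by (intro mult_mono) auto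
    then have "\<bar>(\<eta> $ j)\<^sup>2 - (\<zeta> $ j)\<^sup>2\<bar> \<le> 3 * (1 / R)"
      unfolding power2_eq_square square_diff_square_factored abs_mult .
    then have "\<bar>v $ j\<bar> * \<bar>(\<eta> $ j)\<^sup>2 - (\<zeta> $ j)\<^sup>2\<bar> \<le> 1 * (3 * (1 / R))"
      using v[of j] by (intro mult_mono) auto
    then show "\<bar>v $ j * (\<eta> $ j)\<^sup>2 - v $ j * (\<zeta> $ j)\<^sup>2\<bar> \<le> 3 * (1 / R)"
      by (simp add: abs_mult flip: right_diff_distrib)
  qed
  then have "\<bar>quad v \<eta> - quad v \<zeta>\<bar> \<le> 3 * real CARD('k) / R" by (simp add: mult.commute)
  then show "\<bar>\<tau> - quad v \<zeta>\<bar> \<le> (1 + 3 * real CARD('k)) / R"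
    using d2 by (simp add: add_divide_distrib)
qed

lemma borel_version:
  fixes G :: "'a::euclidean_space \<Rightarrow> complex"
  assumes "integrable lebesgue G"
  obtains G' where "integrable lborel G'" "AE x in lebesgue. G x = G' x"
proof -
  have m: "G \<in> borel_measurable (completion lborel)" using assms by auto
  obtain g1 where g1: "g1 \<in> borel_measurable lborel" "AE x in lborel. Re (G x) = g1 x"
    using completion_ex_borel_measurable_real[of "\<lambda>x. Re (G x)" lborel] m by auto
  obtain g2 where g2: "g2 \<in> borel_measurable lborel" "AE x in lborel. Im (G x) = g2 x"
    using completion_ex_borel_measurable_real[of "\<lambda>x. Im (G x)" lborel] m by auto
  define G' where "G' x = Complex (g1 x) (g2 x)" for x
  have G'm: "G' \<in> borel_measurable lborel"
    using g1(1) g2(1) unfolding G'_def[abs_def] Complex_eq by measurable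
  have ae: "AE x in lborel. G x = G' x"
    using g1(2) g2(2) by eventually_elim (simp add: G'_def complex_eq_iff)
  then have ae': "AE x in lebesgue. G x = G' x" by (rule AE_completion)
  have "integrable lebesgue G'"
    using integrable_cong_AE[of G lebesgue G'] assms ae' m measurable_completion[OF G'm] by auto
  then have "integrable lborel G'" using integrable_completion[OF G'm] by simp
  then show thesis using ae' by (rule that)
qed

lemma AE_lebesgue_coordinate_neq: "AE \<omega> in lebesgue. fst (\<omega> :: (real^'k) \<times> real) $ i \<noteq> c"
proof -
  have "AE \<omega> in lborel. \<omega> \<bullet> (axis i (1 :: real), 0 :: real) \<noteq> c"
  proof (rule AE_lborel_inner_neq)
    have "axis i (1::real) \<in> Basis" by (auto simp: Basis_vec_def)
    then show "(axis i (1 :: real), 0 :: real) \<in> Basis" unfolding Basis_prod_def by (intro UnI1 imageI)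
  qed
  then have "AE \<omega> in lborel. fst (\<omega> :: (real^'k) \<times> real) $ i \<noteq> c"
    by eventually_elim (simp add: inner_prod_def inner_axis)
  then show ?thesis by (rule AE_completion)
qed

lemma open_nbhd: "open (nbhd S r)"
proof -
  have "nbhd S r = (\<Union>y\<in>S. ball y r)" by (auto simp: nbhd_def dist_commute)
  moreover have "open (\<Union>y\<in>S. ball y r)" by (intro open_UN ballI open_ball)
  ultimately show ?thesis by simp
qed

definition closed_box :: "real \<Rightarrow> ('k \<Rightarrow> int) \<Rightarrow> (real^'k) set" where
  "closed_box \<rho> m = {\<xi>. \<forall>i. \<xi> $ i \<in> {\<rho> * m i .. \<rho> * m i + \<rho>}}"

lemma closed_box_eq_cbox: "closed_box \<rho> m = cbox (\<chi> i. \<rho> * m i) (\<chi> i. \<rho> * m i + \<rho>)"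
  by (auto simp: closed_box_def mem_box_cart)

lemma freq_proj_closed_box:
  fixes G G' :: "(real^'k) \<times> real \<Rightarrow> complex"
  assumes \<rho>: "\<rho> > 0" and G: "integrable lebesgue G" and G': "integrable lborel G'"
    and ae: "AE \<omega> in lebesgue. G \<omega> = G' \<omega>"
    and N: "open N" and supp: "AE \<omega> in lebesgue. \<omega> \<notin> N \<longrightarrow> G \<omega> = 0"
  shows "freq_proj ((closed_box \<rho> m \<times> UNIV) \<inter> N) G = inv_FT (cell_part \<rho> (\<lambda>_. 1) m G')"
proof
  fix x
  let ?\<theta> = "(closed_box \<rho> m \<times> UNIV) \<inter> N"
  let ?H = "cell_part \<rho> (\<lambda>_. 1) m G'"
  have "closed (closed_box \<rho> m \<times> (UNIV :: real set))" unfolding closed_box_eq_cbox by (intro closed_Times) auto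
  then have "?\<theta> \<in> sets borel" using N by auto
  then have \<theta>: "?\<theta> \<in> sets lebesgue" by simp
  have H: "integrable lborel ?H" using \<rho> G' by (intro integrable_cell_part) auto
  have He: "(\<lambda>\<omega>. ?H \<omega> * e (\<omega> \<bullet> x)) \<in> borel_measurable lborel"
    using borel_measurable_integrable[OF H] by measurable
  have "freq_proj ?\<theta> G x = (LINT \<omega>|lebesgue. indicator ?\<theta> \<omega> *\<^sub>R (G \<omega> * e (\<omega> \<bullet> x)))"
    unfolding freq_proj_def using \<theta> by (subst integral_restrict_space) auto
  also have "\<dots> = (LINT \<omega>|lebesgue. ?H \<omega> * e (\<omega> \<bullet> x))"
  proof (rule integral_cong_AE)
    have "(\<lambda>\<omega>. e (\<omega> \<bullet> x)) \<in> borel_measurable lebesgue" by (intro measurable_completion) measurable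
    then show "(\<lambda>\<omega>. indicator ?\<theta> \<omega> *\<^sub>R (G \<omega> * e (\<omega> \<bullet> x))) \<in> borel_measurable lebesgue"
      using \<theta> borel_measurable_integrable[OF G] by (intro borel_measurable_scaleR borel_measurable_indicator borel_measurable_times)
    show "(\<lambda>\<omega>. ?H \<omega> * e (\<omega> \<bullet> x)) \<in> borel_measurable lebesgue" by (rule measurable_completion[OF He])
    have "AE \<omega> in lebesgue. \<forall>i\<in>UNIV. fst (\<omega> :: (real^'k) \<times> real) $ i \<noteq> \<rho> * m i + \<rho>"
      by (subst AE_finite_all) (auto intro: AE_lebesgue_coordinate_neq)
    with ae supp show "AE \<omega> in lebesgue. indicator ?\<theta> \<omega> *\<^sub>R (G \<omega> * e (\<omega> \<bullet> x)) = ?H \<omega> * e (\<omega> \<bullet> x)"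
    proof eventually_elim
      case (elim \<omega>)
      show ?case
      proof (cases "\<omega> \<in> N")
        case True
        have "fst \<omega> \<in> closed_box \<rho> m \<longleftrightarrow> cell \<rho> (\<lambda>_. 1) (fst \<omega>) = m"
          using elim(3) \<rho> by (subst cell_iff) (auto simp: closed_box_def algebra_simps order_less_le)
        then have "indicator ?\<theta> \<omega> = (if cell \<rho> (\<lambda>_. 1) (fst \<omega>) = m then 1 else 0 :: real)"
          using True by (cases \<omega>) (auto simp: indicator_def)
        then show ?thesis using elim(1) by (simp add: cell_part_def)
      qed (use elim in \<open>auto simp: cell_part_def\<close>)
    qed
  qed
  also have "\<dots> = inv_FT ?H x" unfolding inv_FT_def by (rule integral_completion[OF He])
  finally show "freq_proj ?\<theta> G x = inv_FT ?H x" .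
qed

lemma inv_FT_AE_zero:
  assumes "AE \<omega> in lborel. G \<omega> = 0"
  shows "inv_FT G = (\<lambda>_. 0)"
proof
  fix x
  have "AE \<omega> in lborel. G \<omega> * e (\<omega> \<bullet> x) = 0" using assms by eventually_elim simp
  then show "inv_FT G x = 0" unfolding inv_FT_def by (rule integral_eq_zero_AE)
qed

text \<open>
  Half-open boxes and the closed boxes of the caps differ by null sets. Since the caps are collected as sets,
  two boxes with the same cap are counted once on the right; but then that cap lies in a common face of the
  boxes, and the corresponding pieces vanish.
\<close>

lemma sum_closed_boxes_le_sum_caps:
  fixes v :: "real^'k" and G G' :: "(real^'k) \<times> real \<Rightarrow> complex"
  assumes R: "R \<ge> 1" and G: "integrable lebesgue G" and G': "integrable lborel G'"
    and ae: "AE \<omega> in lebesgue. G \<omega> = G' \<omega>"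
    and supp: "AE \<omega> in lebesgue. \<omega> \<notin> nbhd (paraboloid v) (1 / R) \<longrightarrow> G \<omega> = 0"
    and M: "finite M" and p: "p > 0"
  shows "(\<Sum>m\<in>M. Lp_pow p (inv_FT (cell_part (R powr (- (1/2))) (\<lambda>_. 1) m G')))
     \<le> (\<Sum>\<theta>\<in>caps v (\<chi> i. 1 / 2) R. Lp_pow p (freq_proj \<theta> G))"
proof -
  define \<rho> where "\<rho> = R powr (- (1/2))"
  have \<rho>: "\<rho> > 0" using R by (simp add: \<rho>_def)
  let ?N = "nbhd (paraboloid v) (1 / R)"
  define \<theta> where "\<theta> m = (closed_box \<rho> m \<times> UNIV) \<inter> ?N" for m
  let ?f = "\<lambda>m. Lp_pow p (inv_FT (cell_part \<rho> (\<lambda>_. 1) m G'))"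
  have fq: "freq_proj (\<theta> m) G = inv_FT (cell_part \<rho> (\<lambda>_. 1) m G')" for m
    unfolding \<theta>_def by (rule freq_proj_closed_box[OF \<rho> G G' ae open_nbhd supp])
  have caps: "\<theta> m \<in> caps v (\<chi> i. 1 / 2) R" for m
  proof -
    let ?c = "\<chi> i. \<rho> * m i"
    have B: "closed_box \<rho> m = {\<xi>. \<forall>i. \<xi> $ i \<in> {?c $ i .. ?c $ i + R powr (- ((\<chi> i. 1 / 2) $ i))}}"
      by (simp add: closed_box_def \<rho>_def)
    have "\<forall>i. \<exists>k::int. ?c $ i = R powr (- ((\<chi> i. 1 / 2) $ i)) * of_int k" by (auto simp: \<rho>_def)
    then show ?thesis unfolding caps_def \<theta>_def using B by blast
  qed
  define M' where "M' = {m \<in> M. ?f m \<noteq> 0}"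
  have inj: "inj_on \<theta> M'"
  proof (rule inj_onI, rule ccontr)
    fix m m' assume mm: "m \<in> M'" "m' \<in> M'" "\<theta> m = \<theta> m'" "m \<noteq> m'"
    then obtain i where i: "m i \<noteq> m' i" by (auto simp: fun_eq_iff)
    have "AE \<omega> in lebesgue. cell_part \<rho> (\<lambda>_. 1) m G' \<omega> = 0"
      using ae supp AE_lebesgue_coordinate_neq[of i "\<rho> * m i"]
    proof eventually_elim
      case (elim \<omega>)
      show ?case
      proof (rule ccontr)
        assume nz: "cell_part \<rho> (\<lambda>_. 1) m G' \<omega> \<noteq> 0"
        then have c: "cell \<rho> (\<lambda>_. 1) (fst \<omega>) = m" and "G' \<omega> \<noteq> 0" by (auto simp: cell_part_def split: if_splits)
        then have "\<omega> \<in> ?N" using elim by auto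
        have h: "\<rho> * m j \<le> fst \<omega> $ j" "fst \<omega> $ j < \<rho> * (m j + 1)" for j
          using c cell_iff[of \<rho> "\<lambda>_. 1" "fst \<omega>" m] \<rho> by auto
        then have "fst \<omega> \<in> closed_box \<rho> m" by (auto simp: closed_box_def algebra_simps less_imp_le)
        then have "\<omega> \<in> \<theta> m'" using \<open>\<omega> \<in> ?N\<close> mm(3) unfolding \<theta>_def by (cases \<omega>) auto
        then have "fst \<omega> \<in> closed_box \<rho> m'" unfolding \<theta>_def by (cases \<omega>) auto
        then have h': "\<rho> * m' i \<le> fst \<omega> $ i" "fst \<omega> $ i \<le> \<rho> * (m' i + 1)" by (auto simp: closed_box_def algebra_simps)
        have "\<rho> * m' i < \<rho> * (m i + 1)" using h(2)[of i] h'(1) by linarith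
        then have "m' i < m i + 1" using \<rho> by (simp add: mult_less_cancel_left_pos)
        then have "m' i + 1 \<le> m i" using i by linarith
        then have "\<rho> * (m' i + 1) \<le> \<rho> * m i" using \<rho> by (intro mult_left_mono) linarith+
        then show False using h(1)[of i] h'(2) elim(3) by linarith
      qed
    qed
    then have "inv_FT (cell_part \<rho> (\<lambda>_. 1) m G') = (\<lambda>_. 0)"
      by (intro inv_FT_AE_zero) (simp add: AE_completion_iff)
    then have "?f m = 0" using p by (simp add: Lp_pow_def)
    then show False using mm(1) by (simp add: M'_def)
  qed
  have "(\<Sum>m\<in>M. ?f m) = (\<Sum>m\<in>M'. ?f m)"
    unfolding M'_def using M by (intro sum.mono_neutral_right) auto
  also have "\<dots> = (\<Sum>m\<in>M'. Lp_pow p (freq_proj (\<theta> m) G))" unfolding fq ..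
  also have "\<dots> = (\<Sum>t\<in>\<theta> ` M'. Lp_pow p (freq_proj t G))" by (simp add: sum.reindex[OF inj])
  also have "\<dots> \<le> (\<Sum>t\<in>caps v (\<chi> i. 1 / 2) R. Lp_pow p (freq_proj t G))"
    using caps R by (intro sum_mono2 finite_caps) auto
  finally show ?thesis unfolding \<rho>_def .
qed

lemma Lp_norm_lebesgue: "Lp_norm lebesgue p F = ennreal_powr (Lp_pow p F) (1 / p)"
  by (simp add: Lp_norm_def Lp_pow_def nn_integral_completion)

section \<open>Restriction implies decoupling\<close>

text \<open>
  The two halves \<open>\<iota>\<close> and \<open>\<iota>'\<close> of the coordinates use the conjecture for the two corresponding parts of
  \<open>v\<close>. The critical exponents agree because \<open>2 + 4 / (2 * n) = 2 + 2 / n\<close>.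
\<close>

theorem restriction_imp_decoupling:
  fixes v :: "real^'k" and u u' :: "real^'n" and \<iota> \<iota>' :: "'n \<Rightarrow> 'k"
  assumes inj: "inj \<iota>" "inj \<iota>'" and rng: "range \<iota>' = - range \<iota>"
    and u: "\<And>j. u $ j = v $ \<iota> j" "\<And>j. u' $ j = v $ \<iota>' j" and v: "\<And>i. \<bar>v $ i\<bar> \<le> 1"
    and rc: "restriction_conjecture u" "restriction_conjecture u'"
    and card: "CARD('k) = 2 * CARD('n)"
  shows "decoupling v"
  unfolding decoupling_def
proof (intro allI impI)
  fix p \<epsilon> :: real
  assume as: "2 \<le> p \<and> p \<le> 2 + 4 / real CARD('k) \<and> \<epsilon> > 0"
  let ?n = "real CARD('n)"
  have p: "2 \<le> p" "p \<le> 2 + 2 / ?n" using as by (auto simp: card)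
  have \<epsilon>p: "\<epsilon> * p > 0" using as by simp
  have C0: "1 + 3 * real CARD('k) \<ge> 0" by simp
  obtain C where C: "C > 0" and main: "\<And>R G. \<lbrakk>R \<ge> 1; integrable lborel G; near_paraboloid v ((1 + 3 * real CARD('k)) / R) G;
       \<And>\<zeta> \<tau> i. G (\<zeta>, \<tau>) \<noteq> 0 \<Longrightarrow> -1 \<le> \<zeta> $ i \<and> \<zeta> $ i \<le> 2\<rbrakk> \<Longrightarrow>
       \<exists>M. finite M \<and> Lp_pow p (inv_FT G) \<le> ennreal (C * R powr (?n * (p / 2 - 1) + \<epsilon> * p)) *
          (\<Sum>m\<in>M. Lp_pow p (inv_FT (cell_part (R powr (- (1/2))) (\<lambda>_. 1) m G)))"
    by (rule fine_scale_decoupling[OF inj rng u v rc p \<epsilon>p C0]) blast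
  show "\<exists>C::real. \<forall>R\<ge>1. \<forall>F G.
          has_fourier_transform F G \<and>
          (AE \<xi> in lebesgue. \<xi> \<notin> nbhd (paraboloid v) (1 / R) \<longrightarrow> G \<xi> = 0) \<longrightarrow>
          Lp_norm lebesgue p F
            \<le> ennreal (C * R powr (1 / 2 * real CARD('k) * (1 / 2 - 1 / p) + \<epsilon>)) *
               ennreal_powr
                 (\<Sum>\<theta>\<in>caps v (\<chi> i. 1 / 2) R. ennreal_powr (Lp_norm lebesgue p (freq_proj \<theta> G)) p)
                 (1 / p)"
  proof (intro exI[of _ "C powr (1 / p)"] allI impI)
    fix R :: real and F G :: "(real^'k) \<times> real \<Rightarrow> complex"
    assume R: "1 \<le> R" and FG: "has_fourier_transform F G \<and> (AE \<xi> in lebesgue. \<xi> \<notin> nbhd (paraboloid v) (1 / R) \<longrightarrow> G \<xi> = 0)"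
    let ?N = "nbhd (paraboloid v) (1 / R)"
    have G: "integrable lebesgue G" and F: "\<And>x. F x = (LINT \<xi>|lebesgue. G \<xi> * e (\<xi> \<bullet> x))"
      and supp: "AE \<xi> in lebesgue. \<xi> \<notin> ?N \<longrightarrow> G \<xi> = 0"
      using FG by (auto simp: has_fourier_transform_def)
    obtain G1 where G1: "integrable lborel G1" "AE \<xi> in lebesgue. G \<xi> = G1 \<xi>" by (rule borel_version[OF G])
    define G' where "G' \<xi> = indicator ?N \<xi> *\<^sub>R G1 \<xi>" for \<xi>
    have N: "?N \<in> sets borel" by (rule borel_open[OF open_nbhd])
    have G': "integrable lborel G'"
      unfolding G'_def using N G1(1) by (intro integrable_mult_indicator) auto
    have ae: "AE \<xi> in lebesgue. G \<xi> = G' \<xi>"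
      using G1(2) supp by eventually_elim (auto simp: G'_def indicator_def)
    have FeqFT: "F = inv_FT G'"
    proof
      fix x
      have m: "(\<lambda>\<xi>. G' \<xi> * e (\<xi> \<bullet> x)) \<in> borel_measurable lborel"
        using borel_measurable_integrable[OF G'] by measurable
      have me: "(\<lambda>\<omega>. e (\<omega> \<bullet> x)) \<in> borel_measurable lebesgue" by (intro measurable_completion) measurable
      have "F x = (LINT \<xi>|lebesgue. G' \<xi> * e (\<xi> \<bullet> x))" unfolding F
      proof (rule integral_cong_AE)
        show "(\<lambda>\<xi>. G \<xi> * e (\<xi> \<bullet> x)) \<in> borel_measurable lebesgue"
          using me borel_measurable_integrable[OF G] by (intro borel_measurable_times)
        show "(\<lambda>\<xi>. G' \<xi> * e (\<xi> \<bullet> x)) \<in> borel_measurable lebesgue" by (rule measurable_completion[OF m])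
        show "AE \<xi> in lebesgue. G \<xi> * e (\<xi> \<bullet> x) = G' \<xi> * e (\<xi> \<bullet> x)" using ae by eventually_elim simp
      qed
      also have "\<dots> = inv_FT G' x" unfolding inv_FT_def by (rule integral_completion[OF m])
      finally show "F x = inv_FT G' x" .
    qed
    have inN: "(\<zeta>, \<tau>) \<in> ?N" if "G' (\<zeta>, \<tau>) \<noteq> 0" for \<zeta> \<tau> using that by (auto simp: G'_def indicator_def split: if_splits)
    have "\<exists>M. finite M \<and> Lp_pow p (inv_FT G') \<le> ennreal (C * R powr (?n * (p / 2 - 1) + \<epsilon> * p)) *
          (\<Sum>m\<in>M. Lp_pow p (inv_FT (cell_part (R powr (- (1/2))) (\<lambda>_. 1) m G')))"
    proof (rule main[OF R G'])
      show "near_paraboloid v ((1 + 3 * real CARD('k)) / R) G'"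
        using nbhd_paraboloid_subset(1)[OF v R inN] by (simp add: near_paraboloid_def)
      show "-1 \<le> \<zeta> $ i \<and> \<zeta> $ i \<le> 2" if "G' (\<zeta>, \<tau>) \<noteq> 0" for \<zeta> \<tau> i
        using nbhd_paraboloid_subset(2,3)[OF v R inN[OF that]] by simp
    qed
    then obtain M where M: "finite M" "Lp_pow p (inv_FT G') \<le> ennreal (C * R powr (?n * (p / 2 - 1) + \<epsilon> * p)) *
          (\<Sum>m\<in>M. Lp_pow p (inv_FT (cell_part (R powr (- (1/2))) (\<lambda>_. 1) m G')))"
      by (elim exE conjE)
    let ?S = "\<Sum>\<theta>\<in>caps v (\<chi> i. 1 / 2) R. Lp_pow p (freq_proj \<theta> G)"
    have p0: "p > 0" using p by simp
    have "Lp_pow p F \<le> ennreal (C * R powr (?n * (p / 2 - 1) + \<epsilon> * p)) * ?S"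
      unfolding FeqFT by (rule order_trans[OF M(2) mult_left_mono[OF sum_closed_boxes_le_sum_caps[OF R G G' ae supp M(1) p0]]]) simp
    then have "Lp_norm lebesgue p F \<le> ennreal_powr (ennreal (C * R powr (?n * (p / 2 - 1) + \<epsilon> * p)) * ?S) (1 / p)"
      unfolding Lp_norm_lebesgue using p0 by (intro ennreal_powr_mono) auto
    also have "\<dots> = ennreal ((C * R powr (?n * (p / 2 - 1) + \<epsilon> * p)) powr (1 / p)) * ennreal_powr ?S (1 / p)"
      using C R by (intro ennreal_powr_cmult) simp
    also have "(C * R powr (?n * (p / 2 - 1) + \<epsilon> * p)) powr (1 / p) = C powr (1 / p) * R powr (1 / 2 * real CARD('k) * (1 / 2 - 1 / p) + \<epsilon>)"
    proof -
      have "(?n * (p / 2 - 1) + \<epsilon> * p) * (1 / p) = 1 / 2 * real CARD('k) * (1 / 2 - 1 / p) + \<epsilon>"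
        using p0 by (simp add: card field_simps)
      moreover have "(C * R powr a) powr b = C powr b * R powr (a * b)" for a b
        using C by (simp add: powr_mult powr_powr)
      ultimately show ?thesis by (simp only:)
    qed
    also have "?S = (\<Sum>\<theta>\<in>caps v (\<chi> i. 1 / 2) R. ennreal_powr (Lp_norm lebesgue p (freq_proj \<theta> G)) p)"
      using p0 by (simp add: Lp_norm_lebesgue ennreal_powr_powr)
    finally show "Lp_norm lebesgue p F
            \<le> ennreal (C powr (1 / p) * R powr (1 / 2 * real CARD('k) * (1 / 2 - 1 / p) + \<epsilon>)) *
               ennreal_powr
                 (\<Sum>\<theta>\<in>caps v (\<chi> i. 1 / 2) R. ennreal_powr (Lp_norm lebesgue p (freq_proj \<theta> G)) p)
                 (1 / p)" .
  qed
qed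

lemma split_coordinates:
  assumes "CARD('k::finite) = 2 * CARD('n::finite)"
  obtains \<iota> \<iota>' :: "'n::finite \<Rightarrow> 'k::finite" where "inj \<iota>" "inj \<iota>'" "range \<iota>' = - range \<iota>"
proof -
  obtain S :: "'k set" where S: "card S = CARD('n)"
    using obtain_subset_with_card_n[of "CARD('n)" "UNIV :: 'k set"] assms by auto
  have S': "card (- S) = CARD('n)" using S assms by (simp add: Compl_eq_Diff_UNIV card_Diff_subset)
  obtain \<iota> where "bij_betw \<iota> (UNIV :: 'n set) S"
    using finite_same_card_bij[of "UNIV :: 'n set" S] S by auto
  moreover obtain \<iota>' where "bij_betw \<iota>' (UNIV :: 'n set) (- S)"
    using finite_same_card_bij[of "UNIV :: 'n set" "- S"] S' by auto
  ultimately show thesis by (intro that[of \<iota> \<iota>']) (auto simp: bij_betw_def)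
qed

theorem theorem1p3:
  fixes d :: nat
  assumes "d \<ge> 2"
    and "CARD('n::finite) = d - 1"
    and "CARD('k::finite) = 2 * d - 2"
  shows "((\<forall>u \<in> (sign_vectors :: (real^'n) set). restriction_conjecture u) \<longrightarrow>
            (\<forall>v \<in> (sign_vectors :: (real^'k) set). decoupling v)) \<and>
         (restriction_conjecture ((\<chi> i. 1) :: real^'n) \<longrightarrow>
            decoupling ((\<chi> i. 1) :: real^'k))"
proof -
  have card: "CARD('k) = 2 * CARD('n)" using assms by simp
  obtain \<iota> \<iota>' :: "'n \<Rightarrow> 'k" where \<iota>: "inj \<iota>" "inj \<iota>'" "range \<iota>' = - range \<iota>"
    by (rule split_coordinates[OF card])
  have dec: "decoupling v"
    if v: "\<And>i. \<bar>v $ i\<bar> \<le> 1" and rc: "restriction_conjecture ((\<chi> j. v $ \<iota> j) :: real^'n)" "restriction_conjecture ((\<chi> j. v $ \<iota>' j) :: real^'n)"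
    for v :: "real^'k"
    by (rule restriction_imp_decoupling[OF \<iota> _ _ v rc card]) simp_all
  show ?thesis
  proof (intro conjI impI ballI)
    fix v :: "real^'k"
    assume rc: "\<forall>u \<in> (sign_vectors :: (real^'n) set). restriction_conjecture u" and "v \<in> sign_vectors"
    then have v: "v $ i = -1 \<or> v $ i = 1" for i by (auto simp: sign_vectors_def)
    show "decoupling v"
    proof (rule dec)
      show "\<bar>v $ i\<bar> \<le> 1" for i using v[of i] by auto
      show "restriction_conjecture ((\<chi> j. v $ \<iota> j) :: real^'n)" "restriction_conjecture ((\<chi> j. v $ \<iota>' j) :: real^'n)"
        using rc v by (auto simp: sign_vectors_def)
    qed
  next
    assume "restriction_conjecture ((\<chi> i. 1) :: real^'n)"
    then show "decoupling ((\<chi> i. 1) :: real^'k)" by (intro dec) auto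
  qed
qed

end
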